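(* Let $n\geq 1$, let $(\mathcal{C},\mathbb{E},\mathfrak{s})$ be an $n$-exangulated category and suppose $\mathscr{F}\colon\mathcal{C}\to\mathcal{C}'$ is an equivalence of categories. Then there is a biadditive functor $\mathbb{E}'\colon\mathcal{C}'^{\mathrm{op}}\times\mathcal{C}'\to\mathsf{Ab}$ and an exact realisation $\mathfrak{s}'$ of $\mathbb{E}'$ such that $(\mathcal{C}',\mathbb{E}',\mathfrak{s}')$ is an $n$-exangulated category and $\mathscr{F}$ is an $n$-exangle equivalence.
   Context: Fix an integer $n\geq 1$, an additive category $\mathcal{C}$ and a biadditive functor $\mathbb{E}\colon\mathcal{C}^{\mathrm{op}}\times\mathcal{C}\to\mathsf{Ab}$ (additive in each variable). $\mathsf{C}^n_{\mathcal{C}}$ is the category of cochain complexes in $\mathcal{C}$ concentrated in degrees $0,\dots,n+1$. **Extensions.** An $\mathbb{E}$-extension is an element $\delta\in\mathbb{E}(C,A)$. For $x\colon A\to X$ and $z\colon Z\to C$ put $x_{\mathbb{E}}\delta=\mathbb{E}(C,x)(\delta)\in\mathbb{E}(C,X)$ and $z^{\mathbb{E}}\delta=\mathbb{E}(z,A)(\delta)\in\mathbb{E}(Z,A)$. A morphism of extensions from $\delta\in\mathbb{E}(C,A)$ to $\varepsilon\in\mathbb{E}(D,B)$ is a pair $(a\colon A\to B,\ c\colon C\to D)$ with $a_{\mathbb{E}}\delta=c^{\mathbb{E}}\varepsilon$. Each $\delta\in\mathbb{E}(C,A)$ induces natural transformations $\delta^\sharp_{\mathbb{E}}\colon\mathcal{C}(A,-)\Rightarrow\mathbb{E}(C,-)$,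 $a\mapsto a_{\mathbb{E}}\delta$, and $\delta_\sharp^{\mathbb{E}}\colon\mathcal{C}(-,C)\Rightarrow\mathbb{E}(-,A)$, $d\mapsto d^{\mathbb{E}}\delta$. **$n$-exangles.** A pair $\langle X^\bullet,\delta\rangle$ with $X^\bullet\in\mathsf{C}^n_{\mathcal{C}}$ and $\delta\in\mathbb{E}(X^{n+1},X^0)$ is an $n$-exangle if for all $Z\in\mathcal{C}$ the sequences $\mathcal{C}(Z,X^0)\to\mathcal{C}(Z,X^1)\to\cdots\to\mathcal{C}(Z,X^{n+1})\xrightarrow{(\delta_\sharp^{\mathbb{E}})_Z}\mathbb{E}(Z,X^0)$ and $\mathcal{C}(X^{n+1},Z)\to\mathcal{C}(X^n,Z)\to\cdots\to\mathcal{C}(X^0,Z)\xrightarrow{(\delta^\sharp_{\mathbb{E}})_Z}\mathbb{E}(X^{n+1},Z)$ are exact. **Homotopy classes.** For $A,C\in\mathcal{C}$, $\mathsf{C}^n_{(A,C)}$ is the category of complexes $X^\bullet\in\mathsf{C}^n_{\mathcal{C}}$ with $X^0=A$, $X^{n+1}=C$, with morphisms the chain maps $f^\bullet$ with $f^0=1_A$, $f^{n+1}=1_C$. Identifying morphisms that are homotopic in the usual sense gives the category $\mathsf{K}^n_{(A,C)}$; $X^\bullet,Y^\bullet$ are homotopy equivalent if isomorphic in $\mathsf{K}^n_{(A,C)}$, and $[X^\bullet]$ is the homotopy equivalence class in $\mathsf{C}^n_{(A,C)}$. **Realisations.** Let $\mathfrak{s}$ assign to each $\delta\in\mathbb{E}(C,A)$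 (all $A,C$) a homotopy equivalence class $\mathfrak{s}(\delta)=[X^\bullet]$ with $X^\bullet\in\mathsf{C}^n_{(A,C)}$. It is a realisation of $\mathbb{E}$ if (R0) for all $\delta\in\mathbb{E}(C,A)$, $\varepsilon\in\mathbb{E}(D,B)$ with $\mathfrak{s}(\delta)=[X^\bullet]$, $\mathfrak{s}(\varepsilon)=[Y^\bullet]$ and every morphism $(a,c)\colon\delta\to\varepsilon$ there is a chain map $f^\bullet\colon X^\bullet\to Y^\bullet$ with $f^0=a$, $f^{n+1}=c$ (then $f^\bullet$ is said to realise $(a,c)$). It is exact if moreover (R1) $\langle X^\bullet,\delta\rangle$ is an $n$-exangle whenever $\mathfrak{s}(\delta)=[X^\bullet]$; and (R2) for every $A$, the zero element of $\mathbb{E}(0,A)$ is sent to $[A\xrightarrow{1_A}A\to0\to\cdots\to0]$ and the zero element of $\mathbb{E}(A,0)$ is sent to $[0\to\cdots\to0\to A\xrightarrow{1_A}A]$. If $\mathfrak{s}(\delta)=[X^\bullet]$, then $X^\bullet$ is an $\mathfrak{s}$-conflation, $d_X^0$ an $\mathfrak{s}$-inflation and $d_X^n$ an $\mathfrak{s}$-deflation. **$n$-exangulated categories.** $(\mathcal{C},\mathbb{E},\mathfrak{s})$, with $\mathfrak{s}$ an exact realisation of $\mathbb{E}$, is an $n$-exangulated category if: ($n$-EA1) $\mathfrak{s}$-inflations are closed under composition, and $\mathfrak{s}$-deflations are closed under composition. ($n$-EA2) For $\delta\in\mathbb{E}(D,A)$ and $c\colon C\to D$, if $\mathfrak{s}(c^{\mathbb{E}}\delta)=[X^\bullet]$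 and $\mathfrak{s}(\delta)=[Y^\bullet]$, there is a morphism $f^\bullet=(1_A,f^1,\dots,f^n,c)\colon X^\bullet\to Y^\bullet$ realising $(1_A,c)\colon c^{\mathbb{E}}\delta\to\delta$ such that $\mathfrak{s}((d_X^0)_{\mathbb{E}}\delta)$ is the class of the mapping cone of $(f^1,\dots,f^n,c)$, i.e. of $X^1\to X^2\oplus Y^1\to\cdots\to X^{n+1}\oplus Y^n\to Y^{n+1}$ with first differential $\begin{pmatrix}-d_X^1\\ f^1\end{pmatrix}$, last differential $(f^{n+1}\ \ d_Y^n)$ (where $f^{n+1}=c$) and intermediate differentials $\begin{pmatrix}-d_X^{i}&0\\ f^{i}&d_Y^{i-1}\end{pmatrix}\colon X^i\oplus Y^{i-1}\to X^{i+1}\oplus Y^i$ for $2\leq i\leq n$. ($n$-EA2$^{\mathrm{op}}$) The dual of ($n$-EA2), i.e. ($n$-EA2) in the opposite category: for $\delta\in\mathbb{E}(C,A)$ and $a\colon A\to B$, if $\mathfrak{s}(\delta)=[X^\bullet]$ and $\mathfrak{s}(a_{\mathbb{E}}\delta)=[Y^\bullet]$, there is a morphism $f^\bullet=(a,f^1,\dots,f^n,1_C)\colon X^\bullet\to Y^\bullet$ realising $(a,1_C)\colon\delta\to a_{\mathbb{E}}\delta$ such that $\mathfrak{s}((d_Y^n)^{\mathbb{E}}\delta)$ is the class of $X^0\to X^1\oplus Y^0\to\cdots\to X^n\oplus Y^{n-1}\to Y^n$ with first differential $\begin{pmatrix}d_X^0\\ a\end{pmatrix}$, last differential $(f^n\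 \ {-d_Y^{n-1}})$ and intermediate differentials $\begin{pmatrix}d_X^i&0\\ f^i&-d_Y^{i-1}\end{pmatrix}$ for $1\leq i\leq n-1$. **$n$-exangulated functors.** An additive covariant functor $\mathscr{F}\colon\mathcal{C}\to\mathcal{C}'$ between $n$-exangulated categories $(\mathcal{C},\mathbb{E},\mathfrak{s})$, $(\mathcal{C}',\mathbb{E}',\mathfrak{s}')$ is $n$-exangulated if there is a natural transformation $\Gamma\colon\mathbb{E}(-,-)\Rightarrow\mathbb{E}'(\mathscr{F}-,\mathscr{F}-)$ of functors $\mathcal{C}^{\mathrm{op}}\times\mathcal{C}\to\mathsf{Ab}$ such that $\mathfrak{s}(\delta)=[X^\bullet]$ implies $\mathfrak{s}'(\Gamma_{(X^{n+1},X^0)}(\delta))=[\mathscr{F}_{\mathsf{C}}X^\bullet]$, where $\mathscr{F}_{\mathsf{C}}$ applies $\mathscr{F}$ degreewise. It is an $n$-exangle equivalence if it is $n$-exangulated and an equivalence of categories. *)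

theory Defs
  imports "HOL-Algebra.Coset"
begin

section \<open>Additive categories\<close>

record ('o, 'm) cat =
  Obj :: "'o set"
  Arr :: "'m set"
  Dom :: "'m \<Rightarrow> 'o"
  Cod :: "'m \<Rightarrow> 'o"
  Ident :: "'o \<Rightarrow> 'm"
  Comp :: "'m \<Rightarrow> 'm \<Rightarrow> 'm"  (infixl \<open>\<cdot>\<index>\<close> 70)

definition Hom :: "('o, 'm) cat \<Rightarrow> 'o \<Rightarrow> 'o \<Rightarrow> 'm set" where
  "Hom C A B = {f \<in> Arr C. Dom C f = A \<and> Cod C f = B}"

locale category =
  fixes C :: "('o, 'm) cat" (structure)
  assumes dom_cod: "f \<in> Arr C \<Longrightarrow> Dom C f \<in> Obj C \<and> Cod C f \<in> Obj C"
    and ident: "A \<in> Obj C \<Longrightarrow> Ident C A \<in> Hom C A A"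
    and comp: "f \<in> Hom C A B \<Longrightarrow> g \<in> Hom C B D \<Longrightarrow> g \<cdot> f \<in> Hom C A D"
    and ident_left: "f \<in> Hom C A B \<Longrightarrow> Ident C B \<cdot> f = f"
    and ident_right: "f \<in> Hom C A B \<Longrightarrow> f \<cdot> Ident C A = f"
    and assoc: "f \<in> Hom C A B \<Longrightarrow> g \<in> Hom C B D \<Longrightarrow> h \<in> Hom C D K
                  \<Longrightarrow> (h \<cdot> g) \<cdot> f = h \<cdot> (g \<cdot> f)"

text \<open>Abelian groups are written as commutative groups in the sense of HOL-Algebra. Thus
  \<open>\<otimes>\<close>, \<open>\<one>\<close> and \<open>inv\<close> below stand for addition, zero and negation.\<close>

definition preadditive_structure ::
    "('o, 'm) cat \<Rightarrow> ('o \<Rightarrow> 'o \<Rightarrow> 'm monoid) \<Rightarrow> bool" where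
  "preadditive_structure C P \<longleftrightarrow>
     (\<forall>A \<in> Obj C. \<forall>B \<in> Obj C. comm_group (P A B) \<and> carrier (P A B) = Hom C A B) \<and>
     (\<forall>A \<in> Obj C. \<forall>B \<in> Obj C. \<forall>D \<in> Obj C.
        (\<forall>g \<in> Hom C B D. (\<lambda>f. g \<cdot>\<^bsub>C\<^esub> f) \<in> hom (P A B) (P A D)) \<and>
        (\<forall>f \<in> Hom C A B. (\<lambda>g. g \<cdot>\<^bsub>C\<^esub> f) \<in> hom (P B D) (P A D)))"

text \<open>Being additive is a property of a category: in the presence of a zero object and binary
  biproducts the preadditive structure is unique (on hom-sets between objects), so that
  choosing one by \<open>SOME\<close> involves no choice.\<close>

definition hom_group :: "('o, 'm) cat \<Rightarrow> 'o \<Rightarrow> 'o \<Rightarrow> 'm monoid" where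
  "hom_group C = (SOME P. preadditive_structure C P)"

definition hadd :: "('o, 'm) cat \<Rightarrow> 'm \<Rightarrow> 'm \<Rightarrow> 'm" where
  "hadd C f g = f \<otimes>\<^bsub>hom_group C (Dom C f) (Cod C f)\<^esub> g"

definition hneg :: "('o, 'm) cat \<Rightarrow> 'm \<Rightarrow> 'm" where
  "hneg C f = inv\<^bsub>hom_group C (Dom C f) (Cod C f)\<^esub> f"

definition hzero :: "('o, 'm) cat \<Rightarrow> 'o \<Rightarrow> 'o \<Rightarrow> 'm" where
  "hzero C A B = \<one>\<^bsub>hom_group C A B\<^esub>"

definition zero_object :: "('o, 'm) cat \<Rightarrow> 'o \<Rightarrow> bool" where
  "zero_object C Z \<longleftrightarrow> Z \<in> Obj C \<and>
     (\<forall>A \<in> Obj C. (\<exists>!f. f \<in> Hom C Z A) \<and> (\<exists>!f. f \<in> Hom C A Z))"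

record ('o, 'm) biprod =
  bobj :: 'o
  in1 :: 'm
  in2 :: 'm
  pr1 :: 'm
  pr2 :: 'm

definition is_biproduct :: "('o, 'm) cat \<Rightarrow> 'o \<Rightarrow> 'o \<Rightarrow> ('o, 'm) biprod \<Rightarrow> bool" where
  "is_biproduct C A B S \<longleftrightarrow>
     bobj S \<in> Obj C \<and>
     in1 S \<in> Hom C A (bobj S) \<and> in2 S \<in> Hom C B (bobj S) \<and>
     pr1 S \<in> Hom C (bobj S) A \<and> pr2 S \<in> Hom C (bobj S) B \<and>
     pr1 S \<cdot>\<^bsub>C\<^esub> in1 S = Ident C A \<and> pr2 S \<cdot>\<^bsub>C\<^esub> in2 S = Ident C B \<and>
     pr1 S \<cdot>\<^bsub>C\<^esub> in2 S = hzero C B A \<and> pr2 S \<cdot>\<^bsub>C\<^esub> in1 S = hzero C A B \<and>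
     hadd C (in1 S \<cdot>\<^bsub>C\<^esub> pr1 S) (in2 S \<cdot>\<^bsub>C\<^esub> pr2 S) = Ident C (bobj S)"

locale additive_category = category C
  for C :: "('o, 'm) cat" (structure) +
  assumes preadditive: "\<exists>P. preadditive_structure C P"
    and zero: "\<exists>Z. zero_object C Z"
    and biproducts: "A \<in> Obj C \<Longrightarrow> B \<in> Obj C \<Longrightarrow> \<exists>S. is_biproduct C A B S"

definition col :: "('o, 'm) cat \<Rightarrow> ('o, 'm) biprod \<Rightarrow> 'm \<Rightarrow> 'm \<Rightarrow> 'm" where
  "col C S f g = hadd C (in1 S \<cdot>\<^bsub>C\<^esub> f) (in2 S \<cdot>\<^bsub>C\<^esub> g)"

definition row :: "('o, 'm) cat \<Rightarrow> ('o, 'm) biprod \<Rightarrow> 'm \<Rightarrow> 'm \<Rightarrow> 'm" where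
  "row C S f g = hadd C (f \<cdot>\<^bsub>C\<^esub> pr1 S) (g \<cdot>\<^bsub>C\<^esub> pr2 S)"

text \<open>\<open>matrix C S T a b c d\<close> is the morphism from \<open>S\<close> to \<open>T\<close> with first row \<open>a, b\<close> and
  second row \<open>c, d\<close>.\<close>

definition matrix :: "('o, 'm) cat \<Rightarrow> ('o, 'm) biprod \<Rightarrow> ('o, 'm) biprod
    \<Rightarrow> 'm \<Rightarrow> 'm \<Rightarrow> 'm \<Rightarrow> 'm \<Rightarrow> 'm" where
  "matrix C S T a b c d = col C T (row C S a b) (row C S c d)"


section \<open>Functors and equivalences\<close>

record ('o, 'm, 'p, 'q) func =
  fobj :: "'o \<Rightarrow> 'p"
  fmap :: "'m \<Rightarrow> 'q"

locale cfunctor = C: category C + D: category D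
  for C :: "('o, 'm) cat" and D :: "('p, 'q) cat" +
  fixes F :: "('o, 'm, 'p, 'q) func"
  assumes fobj: "A \<in> Obj C \<Longrightarrow> fobj F A \<in> Obj D"
    and fmap: "f \<in> Hom C A B \<Longrightarrow> fmap F f \<in> Hom D (fobj F A) (fobj F B)"
    and fmap_ident: "A \<in> Obj C \<Longrightarrow> fmap F (Ident C A) = Ident D (fobj F A)"
    and fmap_comp: "f \<in> Hom C A B \<Longrightarrow> g \<in> Hom C B K
                      \<Longrightarrow> fmap F (g \<cdot>\<^bsub>C\<^esub> f) = fmap F g \<cdot>\<^bsub>D\<^esub> fmap F f"

definition id_func :: "('o, 'm, 'o, 'm) func" where
  "id_func = \<lparr>fobj = (\<lambda>A. A), fmap = (\<lambda>f. f)\<rparr>"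

definition comp_func ::
    "('p, 'q, 'r, 's) func \<Rightarrow> ('o, 'm, 'p, 'q) func \<Rightarrow> ('o, 'm, 'r, 's) func" where
  "comp_func G F = \<lparr>fobj = (\<lambda>A. fobj G (fobj F A)), fmap = (\<lambda>f. fmap G (fmap F f))\<rparr>"

definition isomorphism :: "('o, 'm) cat \<Rightarrow> 'o \<Rightarrow> 'o \<Rightarrow> 'm \<Rightarrow> bool" where
  "isomorphism C A B f \<longleftrightarrow> f \<in> Hom C A B \<and>
     (\<exists>g \<in> Hom C B A. g \<cdot>\<^bsub>C\<^esub> f = Ident C A \<and> f \<cdot>\<^bsub>C\<^esub> g = Ident C B)"

definition natural_isomorphism :: "('o, 'm) cat \<Rightarrow> ('p, 'q) cat
    \<Rightarrow> ('o, 'm, 'p, 'q) func \<Rightarrow> ('o, 'm, 'p, 'q) func \<Rightarrow> ('o \<Rightarrow> 'q) \<Rightarrow> bool" where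
  "natural_isomorphism C D F G \<tau> \<longleftrightarrow>
     (\<forall>A \<in> Obj C. isomorphism D (fobj F A) (fobj G A) (\<tau> A)) \<and>
     (\<forall>A \<in> Obj C. \<forall>B \<in> Obj C. \<forall>f \<in> Hom C A B. \<tau> B \<cdot>\<^bsub>D\<^esub> fmap F f = fmap G f \<cdot>\<^bsub>D\<^esub> \<tau> A)"

definition equivalence_of_categories ::
    "('o, 'm) cat \<Rightarrow> ('p, 'q) cat \<Rightarrow> ('o, 'm, 'p, 'q) func \<Rightarrow> bool" where
  "equivalence_of_categories C D F \<longleftrightarrow> cfunctor C D F \<and>
     (\<exists>G \<eta> \<epsilon>. cfunctor D C G \<and>
        natural_isomorphism C C id_func (comp_func G F) \<eta> \<and>
        natural_isomorphism D D (comp_func F G) id_func \<epsilon>)"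

definition additive_functor ::
    "('o, 'm) cat \<Rightarrow> ('p, 'q) cat \<Rightarrow> ('o, 'm, 'p, 'q) func \<Rightarrow> bool" where
  "additive_functor C D F \<longleftrightarrow> cfunctor C D F \<and>
     (\<forall>A \<in> Obj C. \<forall>B \<in> Obj C.
        fmap F \<in> hom (hom_group C A B) (hom_group D (fobj F A) (fobj F B)))"


section \<open>Biadditive functors and extensions\<close>

text \<open>For \<open>z : Z \<rightarrow> D\<close> and \<open>x : A \<rightarrow> X\<close>, \<open>emap E z x\<close> is the map from \<open>egrp E D A\<close> to
  \<open>egrp E Z X\<close> (contravariant in the first argument).\<close>

record ('o, 'm, 'e) bifunctor =
  egrp :: "'o \<Rightarrow> 'o \<Rightarrow> 'e monoid"
  emap :: "'m \<Rightarrow> 'm \<Rightarrow> 'e \<Rightarrow> 'e"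

abbreviation ext :: "('o, 'm, 'e) bifunctor \<Rightarrow> 'o \<Rightarrow> 'o \<Rightarrow> 'e set" where
  "ext E D A \<equiv> carrier (egrp E D A)"

text \<open>For \<open>\<delta> \<in> ext E D A\<close>: \<open>push C E D x \<delta> = x\<^sub>E \<delta>\<close> and \<open>pull C E A z \<delta> = z\<^sup>E \<delta>\<close>.\<close>

definition push :: "('o, 'm) cat \<Rightarrow> ('o, 'm, 'e) bifunctor \<Rightarrow> 'o \<Rightarrow> 'm \<Rightarrow> 'e \<Rightarrow> 'e" where
  "push C E D x \<delta> = emap E (Ident C D) x \<delta>"

definition pull :: "('o, 'm) cat \<Rightarrow> ('o, 'm, 'e) bifunctor \<Rightarrow> 'o \<Rightarrow> 'm \<Rightarrow> 'e \<Rightarrow> 'e" where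
  "pull C E A z \<delta> = emap E z (Ident C A) \<delta>"

locale biadditive_functor = additive_category C
  for C :: "('o, 'm) cat" (structure) +
  fixes E :: "('o, 'm, 'e) bifunctor"
  assumes egrp: "D \<in> Obj C \<Longrightarrow> A \<in> Obj C \<Longrightarrow> comm_group (egrp E D A)"
    and emap: "z \<in> Hom C Z D \<Longrightarrow> x \<in> Hom C A X \<Longrightarrow> emap E z x \<in> hom (egrp E D A) (egrp E Z X)"
    and emap_ident: "D \<in> Obj C \<Longrightarrow> A \<in> Obj C \<Longrightarrow> \<delta> \<in> ext E D A
          \<Longrightarrow> emap E (Ident C D) (Ident C A) \<delta> = \<delta>"
    and emap_comp: "z \<in> Hom C Z D \<Longrightarrow> z' \<in> Hom C Z' Z \<Longrightarrow> x \<in> Hom C A X \<Longrightarrow> x' \<in> Hom C X X'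
          \<Longrightarrow> \<delta> \<in> ext E D A \<Longrightarrow> emap E (z \<cdot> z') (x' \<cdot> x) \<delta> = emap E z' x' (emap E z x \<delta>)"
    and push_add: "D \<in> Obj C \<Longrightarrow> x \<in> Hom C A X \<Longrightarrow> y \<in> Hom C A X \<Longrightarrow> \<delta> \<in> ext E D A
          \<Longrightarrow> push C E D (hadd C x y) \<delta> = push C E D x \<delta> \<otimes>\<^bsub>egrp E D X\<^esub> push C E D y \<delta>"
    and pull_add: "A \<in> Obj C \<Longrightarrow> z \<in> Hom C Z D \<Longrightarrow> w \<in> Hom C Z D \<Longrightarrow> \<delta> \<in> ext E D A
          \<Longrightarrow> pull C E A (hadd C z w) \<delta> = pull C E A z \<delta> \<otimes>\<^bsub>egrp E Z A\<^esub> pull C E A w \<delta>"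

text \<open>\<open>(a, c)\<close> is a morphism from \<open>\<delta> \<in> ext E D A\<close> to \<open>\<epsilon> \<in> ext E D' A'\<close>.\<close>

definition ext_morphism :: "('o, 'm) cat \<Rightarrow> ('o, 'm, 'e) bifunctor
    \<Rightarrow> 'o \<Rightarrow> 'o \<Rightarrow> 'e \<Rightarrow> 'o \<Rightarrow> 'o \<Rightarrow> 'e \<Rightarrow> 'm \<Rightarrow> 'm \<Rightarrow> bool" where
  "ext_morphism C E D A \<delta> D' A' \<epsilon> a c \<longleftrightarrow>
     a \<in> Hom C A A' \<and> c \<in> Hom C D D' \<and> push C E D a \<delta> = pull C E A' c \<epsilon>"


section \<open>Complexes and homotopy classes\<close>

text \<open>A complex concentrated in degrees \<open>0..n+1\<close> is given by its objects \<open>X\<^sup>i\<close> for \<open>i \<le> n + 1\<close>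
  and its differentials \<open>d\<^sup>i : X\<^sup>i \<rightarrow> X\<^sup>i\<^sup>+\<^sup>1\<close> for \<open>i \<le> n\<close>; all other values of the two
  sequences below are irrelevant and are ignored throughout. The same holds for the
  components of chain maps beyond degree \<open>n + 1\<close>.\<close>

record ('o, 'm) cpx =
  cobj :: "nat \<Rightarrow> 'o"
  diff :: "nat \<Rightarrow> 'm"

definition complexes :: "nat \<Rightarrow> ('o, 'm) cat \<Rightarrow> ('o, 'm) cpx set" where
  "complexes n C = {X.
     (\<forall>i \<le> n + 1. cobj X i \<in> Obj C) \<and>
     (\<forall>i \<le> n. diff X i \<in> Hom C (cobj X i) (cobj X (i + 1))) \<and>
     (\<forall>i < n. diff X (i + 1) \<cdot>\<^bsub>C\<^esub> diff X i = hzero C (cobj X i) (cobj X (i + 2)))}"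

definition complexes_betw ::
    "nat \<Rightarrow> ('o, 'm) cat \<Rightarrow> 'o \<Rightarrow> 'o \<Rightarrow> ('o, 'm) cpx set" where
  "complexes_betw n C A D = {X \<in> complexes n C. cobj X 0 = A \<and> cobj X (n + 1) = D}"

definition chain_map :: "nat \<Rightarrow> ('o, 'm) cat \<Rightarrow> ('o, 'm) cpx \<Rightarrow> ('o, 'm) cpx
    \<Rightarrow> (nat \<Rightarrow> 'm) \<Rightarrow> bool" where
  "chain_map n C X Y f \<longleftrightarrow>
     (\<forall>i \<le> n + 1. f i \<in> Hom C (cobj X i) (cobj Y i)) \<and>
     (\<forall>i \<le> n. f (i + 1) \<cdot>\<^bsub>C\<^esub> diff X i = diff Y i \<cdot>\<^bsub>C\<^esub> f i)"

text \<open>Morphisms of complexes with common end terms which are the identity on both end terms.\<close>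

definition end_fixing :: "nat \<Rightarrow> ('o, 'm) cat \<Rightarrow> ('o, 'm) cpx \<Rightarrow> ('o, 'm) cpx
    \<Rightarrow> (nat \<Rightarrow> 'm) \<Rightarrow> bool" where
  "end_fixing n C X Y f \<longleftrightarrow> chain_map n C X Y f \<and>
     f 0 = Ident C (cobj X 0) \<and> f (n + 1) = Ident C (cobj X (n + 1))"

text \<open>The usual notion of homotopy: \<open>f\<^sup>i = g\<^sup>i + (d\<^sup>i\<^sup>-\<^sup>1 h\<^sup>i + h\<^sup>i\<^sup>+\<^sup>1 d\<^sup>i)\<close> in every degree, where
  \<open>h\<^sup>i : X\<^sup>i \<rightarrow> Y\<^sup>i\<^sup>-\<^sup>1\<close>. One of the two summands vanishes in degree \<open>0\<close> and in degree \<open>n + 1\<close>.\<close>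

definition homotopic :: "nat \<Rightarrow> ('o, 'm) cat \<Rightarrow> ('o, 'm) cpx \<Rightarrow> ('o, 'm) cpx
    \<Rightarrow> (nat \<Rightarrow> 'm) \<Rightarrow> (nat \<Rightarrow> 'm) \<Rightarrow> bool" where
  "homotopic n C X Y f g \<longleftrightarrow> (\<exists>h.
     (\<forall>i \<in> {1..n + 1}. h i \<in> Hom C (cobj X i) (cobj Y (i - 1))) \<and>
     f 0 = hadd C (g 0) (h 1 \<cdot>\<^bsub>C\<^esub> diff X 0) \<and>
     (\<forall>i \<in> {1..n}. f i = hadd C (g i)
        (hadd C (diff Y (i - 1) \<cdot>\<^bsub>C\<^esub> h i) (h (i + 1) \<cdot>\<^bsub>C\<^esub> diff X i))) \<and>
     f (n + 1) = hadd C (g (n + 1)) (diff Y n \<cdot>\<^bsub>C\<^esub> h (n + 1)))"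

definition homotopy_equivalent ::
    "nat \<Rightarrow> ('o, 'm) cat \<Rightarrow> ('o, 'm) cpx \<Rightarrow> ('o, 'm) cpx \<Rightarrow> bool" where
  "homotopy_equivalent n C X Y \<longleftrightarrow> (\<exists>f g.
     end_fixing n C X Y f \<and> end_fixing n C Y X g \<and>
     homotopic n C X X (\<lambda>i. g i \<cdot>\<^bsub>C\<^esub> f i) (\<lambda>i. Ident C (cobj X i)) \<and>
     homotopic n C Y Y (\<lambda>i. f i \<cdot>\<^bsub>C\<^esub> g i) (\<lambda>i. Ident C (cobj Y i)))"

definition hclass :: "nat \<Rightarrow> ('o, 'm) cat \<Rightarrow> ('o, 'm) cpx \<Rightarrow> ('o, 'm) cpx set" where
  "hclass n C X = {Y \<in> complexes_betw n C (cobj X 0) (cobj X (n + 1)).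
                     homotopy_equivalent n C X Y}"


section \<open>Exangles and exact realisations\<close>

definition exact_at :: "'a monoid \<Rightarrow> 'b monoid \<Rightarrow> 'c monoid
    \<Rightarrow> ('a \<Rightarrow> 'b) \<Rightarrow> ('b \<Rightarrow> 'c) \<Rightarrow> bool" where
  "exact_at G H K f g \<longleftrightarrow> f ` carrier G = kernel H K g"

definition n_exangle :: "nat \<Rightarrow> ('o, 'm) cat \<Rightarrow> ('o, 'm, 'e) bifunctor
    \<Rightarrow> ('o, 'm) cpx \<Rightarrow> 'e \<Rightarrow> bool" where
  "n_exangle n C E X \<delta> \<longleftrightarrow>
     X \<in> complexes n C \<and> \<delta> \<in> ext E (cobj X (n + 1)) (cobj X 0) \<and>
     (\<forall>Z \<in> Obj C.
        (\<forall>i < n. exact_at (hom_group C Z (cobj X i)) (hom_group C Z (cobj X (i + 1)))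
                   (hom_group C Z (cobj X (i + 2)))
                   (\<lambda>g. diff X i \<cdot>\<^bsub>C\<^esub> g) (\<lambda>g. diff X (i + 1) \<cdot>\<^bsub>C\<^esub> g)) \<and>
        exact_at (hom_group C Z (cobj X n)) (hom_group C Z (cobj X (n + 1)))
          (egrp E Z (cobj X 0))
          (\<lambda>g. diff X n \<cdot>\<^bsub>C\<^esub> g) (\<lambda>g. pull C E (cobj X 0) g \<delta>) \<and>
        (\<forall>i < n. exact_at (hom_group C (cobj X (i + 2)) Z) (hom_group C (cobj X (i + 1)) Z)
                   (hom_group C (cobj X i) Z)
                   (\<lambda>g. g \<cdot>\<^bsub>C\<^esub> diff X (i + 1)) (\<lambda>g. g \<cdot>\<^bsub>C\<^esub> diff X i)) \<and>
        exact_at (hom_group C (cobj X 1) Z) (hom_group C (cobj X 0) Z)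
          (egrp E (cobj X (n + 1)) Z)
          (\<lambda>g. g \<cdot>\<^bsub>C\<^esub> diff X 0) (\<lambda>g. push C E (cobj X (n + 1)) g \<delta>))"

text \<open>A candidate realisation assigns to objects \<open>D\<close>, \<open>A\<close> and \<open>\<delta> \<in> ext E D A\<close> a set of
  complexes. The objects are arguments because the groups \<open>ext E D A\<close> need not be disjoint
  as subsets of the type \<open>'e\<close>.\<close>

type_synonym ('o, 'm, 'e) realis = "'o \<Rightarrow> 'o \<Rightarrow> 'e \<Rightarrow> ('o, 'm) cpx set"

definition realised_by :: "nat \<Rightarrow> ('o, 'm) cat \<Rightarrow> ('o, 'm, 'e) realis
    \<Rightarrow> 'o \<Rightarrow> 'o \<Rightarrow> 'e \<Rightarrow> ('o, 'm) cpx \<Rightarrow> bool" where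
  "realised_by n C s D A \<delta> X \<longleftrightarrow> X \<in> complexes_betw n C A D \<and> s D A \<delta> = hclass n C X"

definition left_trivial :: "('o, 'm) cat \<Rightarrow> 'o \<Rightarrow> 'o \<Rightarrow> ('o, 'm) cpx" where
  "left_trivial C Z A =
     \<lparr>cobj = (\<lambda>i. if i \<le> 1 then A else Z),
      diff = (\<lambda>i. if i = 0 then Ident C A else if i = 1 then hzero C A Z else hzero C Z Z)\<rparr>"

definition right_trivial :: "nat \<Rightarrow> ('o, 'm) cat \<Rightarrow> 'o \<Rightarrow> 'o \<Rightarrow> ('o, 'm) cpx" where
  "right_trivial n C Z A =
     \<lparr>cobj = (\<lambda>i. if i < n then Z else A),
      diff = (\<lambda>i. if i + 1 < n then hzero C Z Z
                   else if i + 1 = n then hzero C Z A else Ident C A)\<rparr>"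

locale realisation = biadditive_functor C E
  for n :: nat and C :: "('o, 'm) cat" and E :: "('o, 'm, 'e) bifunctor" +
  fixes s :: "('o, 'm, 'e) realis"
  assumes realised: "D \<in> Obj C \<Longrightarrow> A \<in> Obj C \<Longrightarrow> \<delta> \<in> ext E D A \<Longrightarrow> \<exists>X. realised_by n C s D A \<delta> X"
    and R0: "D \<in> Obj C \<Longrightarrow> A \<in> Obj C \<Longrightarrow> \<delta> \<in> ext E D A
          \<Longrightarrow> D' \<in> Obj C \<Longrightarrow> A' \<in> Obj C \<Longrightarrow> \<epsilon> \<in> ext E D' A'
          \<Longrightarrow> realised_by n C s D A \<delta> X \<Longrightarrow> realised_by n C s D' A' \<epsilon> Y
          \<Longrightarrow> ext_morphism C E D A \<delta> D' A' \<epsilon> a c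
          \<Longrightarrow> \<exists>f. chain_map n C X Y f \<and> f 0 = a \<and> f (n + 1) = c"

text \<open>In the last two axioms the zero object is allowed to be any zero object.\<close>

locale exact_realisation = realisation n C E s
  for n :: nat and C :: "('o, 'm) cat" and E :: "('o, 'm, 'e) bifunctor"
    and s :: "('o, 'm, 'e) realis" +
  assumes R1: "D \<in> Obj C \<Longrightarrow> A \<in> Obj C \<Longrightarrow> \<delta> \<in> ext E D A \<Longrightarrow> realised_by n C s D A \<delta> X
          \<Longrightarrow> n_exangle n C E X \<delta>"
    and R2_left: "zero_object C Z \<Longrightarrow> A \<in> Obj C
          \<Longrightarrow> s Z A \<one>\<^bsub>egrp E Z A\<^esub> = hclass n C (left_trivial C Z A)"
    and R2_right: "zero_object C Z \<Longrightarrow> A \<in> Obj C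
          \<Longrightarrow> s A Z \<one>\<^bsub>egrp E A Z\<^esub> = hclass n C (right_trivial n C Z A)"

definition conflation :: "nat \<Rightarrow> ('o, 'm) cat \<Rightarrow> ('o, 'm, 'e) bifunctor
    \<Rightarrow> ('o, 'm, 'e) realis \<Rightarrow> ('o, 'm) cpx \<Rightarrow> bool" where
  "conflation n C E s X \<longleftrightarrow>
     (\<exists>D \<in> Obj C. \<exists>A \<in> Obj C. \<exists>\<delta> \<in> ext E D A. realised_by n C s D A \<delta> X)"

definition inflation :: "nat \<Rightarrow> ('o, 'm) cat \<Rightarrow> ('o, 'm, 'e) bifunctor
    \<Rightarrow> ('o, 'm, 'e) realis \<Rightarrow> 'm \<Rightarrow> bool" where
  "inflation n C E s f \<longleftrightarrow> (\<exists>X. conflation n C E s X \<and> f = diff X 0)"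

definition deflation :: "nat \<Rightarrow> ('o, 'm) cat \<Rightarrow> ('o, 'm, 'e) bifunctor
    \<Rightarrow> ('o, 'm, 'e) realis \<Rightarrow> 'm \<Rightarrow> bool" where
  "deflation n C E s f \<longleftrightarrow> (\<exists>X. conflation n C E s X \<and> f = diff X n)"


section \<open>Exangulated categories and functors\<close>

text \<open>\<open>M\<close> is the mapping cone of \<open>(f\<^sup>1, \<dots>, f\<^sup>n\<^sup>+\<^sup>1)\<close>, for a choice \<open>B\<close> of the direct sums
  \<open>B i = X\<^sup>i\<^sup>+\<^sup>1 \<oplus> Y\<^sup>i\<close> in the degrees \<open>i = 1..n\<close> of \<open>M\<close>. Different choices give complexes which are
  isomorphic via maps that are the identity on the end terms, hence the same homotopy class.\<close>

definition mapping_cone :: "nat \<Rightarrow> ('o, 'm) cat \<Rightarrow> ('o, 'm) cpx \<Rightarrow> ('o, 'm) cpx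
    \<Rightarrow> (nat \<Rightarrow> 'm) \<Rightarrow> ('o, 'm) cpx \<Rightarrow> bool" where
  "mapping_cone n C X Y f M \<longleftrightarrow> (\<exists>B.
     (\<forall>i \<in> {1..n}. is_biproduct C (cobj X (i + 1)) (cobj Y i) (B i) \<and> cobj M i = bobj (B i)) \<and>
     cobj M 0 = cobj X 1 \<and> cobj M (n + 1) = cobj Y (n + 1) \<and>
     diff M 0 = col C (B 1) (hneg C (diff X 1)) (f 1) \<and>
     (\<forall>i \<in> {1..<n}. diff M i = matrix C (B i) (B (i + 1))
        (hneg C (diff X (i + 1))) (hzero C (cobj Y i) (cobj X (i + 2)))
        (f (i + 1))               (diff Y i)) \<and>
     diff M n = row C (B n) (f (n + 1)) (diff Y n))"

text \<open>The dual cone of \<open>(f\<^sup>0, \<dots>, f\<^sup>n)\<close>, with \<open>B i = X\<^sup>i \<oplus> Y\<^sup>i\<^sup>-\<^sup>1\<close>.\<close>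

definition mapping_cocone :: "nat \<Rightarrow> ('o, 'm) cat \<Rightarrow> ('o, 'm) cpx \<Rightarrow> ('o, 'm) cpx
    \<Rightarrow> (nat \<Rightarrow> 'm) \<Rightarrow> ('o, 'm) cpx \<Rightarrow> bool" where
  "mapping_cocone n C X Y f M \<longleftrightarrow> (\<exists>B.
     (\<forall>i \<in> {1..n}. is_biproduct C (cobj X i) (cobj Y (i - 1)) (B i) \<and> cobj M i = bobj (B i)) \<and>
     cobj M 0 = cobj X 0 \<and> cobj M (n + 1) = cobj Y n \<and>
     diff M 0 = col C (B 1) (diff X 0) (f 0) \<and>
     (\<forall>i \<in> {1..<n}. diff M i = matrix C (B i) (B (i + 1))
        (diff X i) (hzero C (cobj Y (i - 1)) (cobj X (i + 1)))
        (f i)      (hneg C (diff Y (i - 1)))) \<and>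
     diff M n = row C (B n) (f n) (hneg C (diff Y (n - 1))))"

locale n_exangulated_category = exact_realisation n C E s
  for n :: nat and C :: "('o, 'm) cat" (structure) and E :: "('o, 'm, 'e) bifunctor"
    and s :: "('o, 'm, 'e) realis" +
  assumes EA1_inflation: "inflation n C E s f \<Longrightarrow> inflation n C E s g \<Longrightarrow> Cod C f = Dom C g
          \<Longrightarrow> inflation n C E s (g \<cdot> f)"
    and EA1_deflation: "deflation n C E s f \<Longrightarrow> deflation n C E s g \<Longrightarrow> Cod C f = Dom C g
          \<Longrightarrow> deflation n C E s (g \<cdot> f)"
    and EA2: "D \<in> Obj C \<Longrightarrow> A \<in> Obj C \<Longrightarrow> \<delta> \<in> ext E D A \<Longrightarrow> c \<in> Hom C K D
          \<Longrightarrow> realised_by n C s K A (pull C E A c \<delta>) X \<Longrightarrow> realised_by n C s D A \<delta> Y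
          \<Longrightarrow> \<exists>f M. chain_map n C X Y f \<and> f 0 = Ident C A \<and> f (n + 1) = c \<and>
                mapping_cone n C X Y f M \<and>
                realised_by n C s D (cobj X 1) (push C E D (diff X 0) \<delta>) M"
    and EA2_op: "D \<in> Obj C \<Longrightarrow> A \<in> Obj C \<Longrightarrow> \<delta> \<in> ext E D A \<Longrightarrow> a \<in> Hom C A B
          \<Longrightarrow> realised_by n C s D A \<delta> X \<Longrightarrow> realised_by n C s D B (push C E D a \<delta>) Y
          \<Longrightarrow> \<exists>f M. chain_map n C X Y f \<and> f 0 = a \<and> f (n + 1) = Ident C D \<and>
                mapping_cocone n C X Y f M \<and>
                realised_by n C s (cobj Y n) A (pull C E A (diff Y n) \<delta>) M"

definition map_cpx :: "('o, 'm, 'p, 'q) func \<Rightarrow> ('o, 'm) cpx \<Rightarrow> ('p, 'q) cpx" where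
  "map_cpx F X = \<lparr>cobj = (\<lambda>i. fobj F (cobj X i)), diff = (\<lambda>i. fmap F (diff X i))\<rparr>"

text \<open>\<open>\<Gamma>\<close> is a natural transformation from \<open>E(-,-)\<close> to \<open>E'(F-,F-)\<close>, as functors to abelian
  groups.\<close>

definition ext_transformation :: "('o, 'm) cat \<Rightarrow> ('o, 'm, 'e) bifunctor
    \<Rightarrow> ('p, 'q, 'd) bifunctor \<Rightarrow> ('o, 'm, 'p, 'q) func \<Rightarrow> ('o \<Rightarrow> 'o \<Rightarrow> 'e \<Rightarrow> 'd) \<Rightarrow> bool" where
  "ext_transformation C E E' F \<Gamma> \<longleftrightarrow>
     (\<forall>D \<in> Obj C. \<forall>A \<in> Obj C. \<Gamma> D A \<in> hom (egrp E D A) (egrp E' (fobj F D) (fobj F A))) \<and>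
     (\<forall>D \<in> Obj C. \<forall>A \<in> Obj C. \<forall>Z \<in> Obj C. \<forall>X \<in> Obj C.
        \<forall>z \<in> Hom C Z D. \<forall>x \<in> Hom C A X. \<forall>\<delta> \<in> ext E D A.
          \<Gamma> Z X (emap E z x \<delta>) = emap E' (fmap F z) (fmap F x) (\<Gamma> D A \<delta>))"

locale n_exangulated_functor =
  S: n_exangulated_category n C E s + T: n_exangulated_category n C' E' s'
  for n :: nat
    and C :: "('o, 'm) cat" and E :: "('o, 'm, 'e) bifunctor" and s :: "('o, 'm, 'e) realis"
    and C' :: "('p, 'q) cat" and E' :: "('p, 'q, 'd) bifunctor" and s' :: "('p, 'q, 'd) realis" +
  fixes F :: "('o, 'm, 'p, 'q) func"
  assumes additive: "additive_functor C C' F"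
    and exangulated: "\<exists>\<Gamma>. ext_transformation C E E' F \<Gamma> \<and>
          (\<forall>D \<in> Obj C. \<forall>A \<in> Obj C. \<forall>\<delta> \<in> ext E D A. \<forall>X. realised_by n C s D A \<delta> X \<longrightarrow>
             realised_by n C' s' (fobj F D) (fobj F A) (\<Gamma> D A \<delta>) (map_cpx F X))"

locale n_exangle_equivalence = n_exangulated_functor n C E s C' E' s' F
  for n :: nat
    and C :: "('o, 'm) cat" and E :: "('o, 'm, 'e) bifunctor" and s :: "('o, 'm, 'e) realis"
    and C' :: "('p, 'q) cat" and E' :: "('p, 'q, 'd) bifunctor" and s' :: "('p, 'q, 'd) realis"
    and F :: "('o, 'm, 'p, 'q) func" +
  assumes equivalence: "equivalence_of_categories C C' F"

end

(* Fix a quasi-inverse G of F with \<eta> : 1 \<cong> G F. Put E'(D, A) = E(G D, G A), let X in C' realise an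
   E'-extension iff G X realises it in C, and let \<Gamma> be conjugation by \<eta>. Since G is fully faithful,
   and additive because the preadditive structure of an additive category is unique, the axioms for
   C' pull back to the axioms for C. What this needs from C is that conflations are closed under
   arbitrary isomorphisms of complexes: F need not be injective on objects, and complexes produced
   in C lie in the image of G only up to isomorphism. Closure holds because two exangles with the
   same end terms that are connected by end-fixing maps in both directions are homotopy
   equivalent. *)
theory Submission
  imports Defs
begin

section \<open>Calculus in preadditive categories\<close>

text \<open>Two obstacles shape the details. Objects are compared by equality: hom-sets, the end
  terms of a homotopy class and composability all refer to objects on the nose. A complex of
  \<open>C\<close> is therefore lifted along \<open>G\<close> by choosing an isomorphism in each
  degree, with the identity forced where objects or a differential must come out exactly; which
  degrees these are depends on the axiom. Further, \<open>C'\<close> is only a category and its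
  addition is a chosen structure, a priori unrelated to that of \<open>C\<close>. Uniqueness is
  available where biproducts are known, that is in \<open>C\<close>: the structure of
  \<open>C'\<close> pulled back along \<open>F\<close> must be the given one, so \<open>F\<close> is
  additive, and additivity of \<open>G\<close> follows from that of \<open>F\<close>. As for the
  homotopy equivalence, an end-fixing endomorphism p of an exangle is homotopic to 1 up to a
  remainder in the top degree; since 1 - p vanishes there, 1 - (1 - p)^2 is homotopic to 1, and it
  arises when one of two opposite maps f, g is replaced by 2g - gfg.\<close>

lemma in_Hom: "f \<in> Hom C A B \<longleftrightarrow> f \<in> Arr C \<and> Dom C f = A \<and> Cod C f = B"
  by (auto simp: Hom_def)

context category
begin

lemma dom_in_Obj [simp]: "f \<in> Arr C \<Longrightarrow> Dom C f \<in> Obj C"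
  and cod_in_Obj [simp]: "f \<in> Arr C \<Longrightarrow> Cod C f \<in> Obj C"
  using dom_cod by auto

text \<open>Typing is carried by \<open>Arr\<close>, \<open>Dom\<close> and \<open>Cod\<close>
  instead of \<open>Hom\<close>: these facts propagate through a composite by rewriting, whereas a
  membership in \<open>Hom\<close> requires the intermediate object to be supplied.\<close>

lemma comp_simps [simp]:
  assumes "f \<in> Arr C" "g \<in> Arr C" "Cod C f = Dom C g"
  shows "g \<cdot> f \<in> Arr C" "Dom C (g \<cdot> f) = Dom C f" "Cod C (g \<cdot> f) = Cod C g"
  using comp[of f "Dom C f" "Cod C f" g "Cod C g"] assms by (auto simp: in_Hom)

lemma ident_simps [simp]:
  assumes "A \<in> Obj C"
  shows "Ident C A \<in> Arr C" "Dom C (Ident C A) = A" "Cod C (Ident C A) = A"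
  using ident[OF assms] by (auto simp: in_Hom)

lemma comp_ident [simp]:
  "f \<in> Arr C \<Longrightarrow> Cod C f = B \<Longrightarrow> Ident C B \<cdot> f = f"
  "f \<in> Arr C \<Longrightarrow> Dom C f = A \<Longrightarrow> f \<cdot> Ident C A = f"
  by (auto intro: ident_left ident_right simp: in_Hom)

lemma comp_assoc [simp]:
  assumes "f \<in> Arr C" "g \<in> Arr C" "h \<in> Arr C" "Cod C f = Dom C g" "Cod C g = Dom C h"
  shows "(h \<cdot> g) \<cdot> f = h \<cdot> (g \<cdot> f)"
  using assoc[of f "Dom C f" "Cod C f" g "Cod C g" h "Cod C h"] assms by (auto simp: in_Hom)

end

section \<open>Addition of morphisms with the chosen group structure\<close>

text \<open>Kept apart from \<open>additive_category\<close> because \<open>C'\<close> is first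
  known to carry only an addition; its zero object and biproducts are established later with the
  help of this calculus.\<close>

locale preadditive_category = category C
  for C :: "('o, 'm) cat" (structure) +
  assumes preadditive: "\<exists>P. preadditive_structure C P"
begin

lemma structure_hom_group: "preadditive_structure C (hom_group C)"
  unfolding hom_group_def by (rule someI_ex[OF preadditive])

lemma hom_group_comm:
  "A \<in> Obj C \<Longrightarrow> B \<in> Obj C \<Longrightarrow> comm_group (hom_group C A B)"
  using structure_hom_group unfolding preadditive_structure_def by auto

lemma hom_group_carrier [simp]:
  "A \<in> Obj C \<Longrightarrow> B \<in> Obj C \<Longrightarrow> carrier (hom_group C A B) = Hom C A B"
  using structure_hom_group unfolding preadditive_structure_def by auto

lemma hadd_simps [simp]:
  assumes "f \<in> Arr C" "g \<in> Arr C" "Dom C f = Dom C g" "Cod C f = Cod C g"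
  shows "hadd C f g \<in> Arr C" "Dom C (hadd C f g) = Dom C g" "Cod C (hadd C f g) = Cod C g"
proof -
  interpret G: comm_group "hom_group C (Dom C g) (Cod C g)"
    using assms by (intro hom_group_comm) auto
  have "hadd C f g \<in> Hom C (Dom C g) (Cod C g)"
    using G.m_closed[of f g] assms by (simp add: hadd_def in_Hom)
  then show "hadd C f g \<in> Arr C" "Dom C (hadd C f g) = Dom C g" "Cod C (hadd C f g) = Cod C g"
    by (auto simp: in_Hom)
qed

lemma hneg_simps [simp]:
  assumes "f \<in> Arr C"
  shows "hneg C f \<in> Arr C" "Dom C (hneg C f) = Dom C f" "Cod C (hneg C f) = Cod C f"
proof -
  interpret G: comm_group "hom_group C (Dom C f) (Cod C f)"
    using assms by (intro hom_group_comm) auto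
  have "hneg C f \<in> Hom C (Dom C f) (Cod C f)"
    using G.inv_closed[of f] assms by (simp add: hneg_def in_Hom)
  then show "hneg C f \<in> Arr C" "Dom C (hneg C f) = Dom C f" "Cod C (hneg C f) = Cod C f"
    by (auto simp: in_Hom)
qed

lemma hzero_simps [simp]:
  assumes "A \<in> Obj C" "B \<in> Obj C"
  shows "hzero C A B \<in> Arr C" "Dom C (hzero C A B) = A" "Cod C (hzero C A B) = B"
proof -
  interpret G: comm_group "hom_group C A B"
    using assms by (rule hom_group_comm)
  have "hzero C A B \<in> Hom C A B"
    using G.one_closed assms by (simp add: hzero_def)
  then show "hzero C A B \<in> Arr C" "Dom C (hzero C A B) = A" "Cod C (hzero C A B) = B"
    by (auto simp: in_Hom)
qed

lemma hadd_assoc: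
  assumes "f \<in> Arr C" "g \<in> Arr C" "h \<in> Arr C"
    and "Dom C f = Dom C g" "Cod C f = Cod C g" "Dom C g = Dom C h" "Cod C g = Cod C h"
  shows "hadd C (hadd C f g) h = hadd C f (hadd C g h)"
proof -
  interpret G: comm_group "hom_group C (Dom C h) (Cod C h)"
    using assms by (intro hom_group_comm) auto
  have "hadd C (hadd C f g) h = hadd C f g \<otimes>\<^bsub>hom_group C (Dom C h) (Cod C h)\<^esub> h"
    using assms by (simp add: hadd_def[of C "hadd C f g"])
  moreover have "hadd C f (hadd C g h) = f \<otimes>\<^bsub>hom_group C (Dom C h) (Cod C h)\<^esub> hadd C g h"
    using assms by (simp add: hadd_def[of C f])
  ultimately show ?thesis
    using G.m_assoc[of f g h] assms by (simp add: in_Hom) (simp add: hadd_def)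
qed

lemma hadd_comm:
  assumes "f \<in> Arr C" "g \<in> Arr C" "Dom C f = Dom C g" "Cod C f = Cod C g"
  shows "hadd C f g = hadd C g f"
proof -
  interpret G: comm_group "hom_group C (Dom C g) (Cod C g)"
    using assms by (intro hom_group_comm) auto
  show ?thesis
    using G.m_comm[of f g] assms by (simp add: in_Hom hadd_def)
qed

lemma hadd_left_comm:
  assumes "f \<in> Arr C" "g \<in> Arr C" "h \<in> Arr C"
    and "Dom C f = Dom C g" "Cod C f = Cod C g" "Dom C g = Dom C h" "Cod C g = Cod C h"
  shows "hadd C f (hadd C g h) = hadd C g (hadd C f h)"
  using hadd_assoc[of f g h] hadd_assoc[of g f h] hadd_comm[of f g] assms by simp

lemmas hadd_ac = hadd_assoc hadd_comm hadd_left_comm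

lemma hadd_zero [simp]:
  assumes "f \<in> Arr C" "Dom C f = A" "Cod C f = B"
  shows "hadd C f (hzero C A B) = f" "hadd C (hzero C A B) f = f"
proof -
  interpret G: comm_group "hom_group C A B"
    using assms by (intro hom_group_comm) auto
  have "A \<in> Obj C" "B \<in> Obj C"
    using assms by auto
  then show "hadd C f (hzero C A B) = f" "hadd C (hzero C A B) f = f"
    using G.r_one[of f] G.l_one[of f] assms hzero_simps[of A B]
    by (auto simp: hadd_def in_Hom) (auto simp: hzero_def)
qed

lemma hadd_neg [simp]:
  assumes "f \<in> Arr C"
  shows "hadd C f (hneg C f) = hzero C (Dom C f) (Cod C f)"
    "hadd C (hneg C f) f = hzero C (Dom C f) (Cod C f)"
proof -
  interpret G: comm_group "hom_group C (Dom C f) (Cod C f)"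
    using assms by (intro hom_group_comm) auto
  show "hadd C f (hneg C f) = hzero C (Dom C f) (Cod C f)"
    using G.r_inv[of f] assms by (simp add: hadd_def hneg_def in_Hom hzero_def)
  then show "hadd C (hneg C f) f = hzero C (Dom C f) (Cod C f)"
    using hadd_comm[of f "hneg C f"] assms by simp
qed

lemma hadd_neg_cancel [simp]:
  assumes "f \<in> Arr C" "g \<in> Arr C" "Dom C f = Dom C g" "Cod C f = Cod C g"
  shows "hadd C f (hadd C (hneg C f) g) = g" "hadd C (hneg C f) (hadd C f g) = g"
  using hadd_assoc[of f "hneg C f" g] hadd_assoc[of "hneg C f" f g] assms by auto

lemma hadd_right_cancel:
  assumes "f \<in> Arr C" "g \<in> Arr C" "h \<in> Arr C" "hadd C f h = hadd C g h"
    and "Dom C f = Dom C h" "Cod C f = Cod C h" "Dom C g = Dom C h" "Cod C g = Cod C h"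
  shows "f = g"
proof -
  have "f = hadd C (hadd C f h) (hneg C h)" "g = hadd C (hadd C g h) (hneg C h)"
    using assms(1-3,5-) by (simp_all add: hadd_assoc)
  then show ?thesis
    using assms(4) by simp
qed

lemma hneg_unique:
  assumes "f \<in> Arr C" "g \<in> Arr C" "Dom C f = Dom C g" "Cod C f = Cod C g"
    and "hadd C f g = hzero C (Dom C g) (Cod C g)"
  shows "f = hneg C g"
  by (rule hadd_right_cancel[of _ _ g]) (use assms in auto)

text \<open>In a group x + x = x forces x = 0; this is how additive maps are seen to preserve
  zero.\<close>

lemma zero_unique:
  assumes "f \<in> Arr C" "hadd C f f = f"
  shows "f = hzero C (Dom C f) (Cod C f)"
  by (rule hadd_right_cancel[of _ _ f]) (use assms in auto)

lemma hneg_hadd [simp]: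
  assumes "f \<in> Arr C" "g \<in> Arr C" "Dom C f = Dom C g" "Cod C f = Cod C g"
  shows "hneg C (hadd C f g) = hadd C (hneg C f) (hneg C g)"
proof (rule hneg_unique[symmetric])
  have "hadd C (hadd C (hneg C f) (hneg C g)) (hadd C f g) =
        hadd C (hneg C f) (hadd C f (hadd C (hneg C g) g))"
    using assms by (simp add: hadd_assoc hadd_left_comm[of "hneg C g" f g] del: hadd_neg hadd_neg_cancel)
  then show "hadd C (hadd C (hneg C f) (hneg C g)) (hadd C f g) =
      hzero C (Dom C (hadd C f g)) (Cod C (hadd C f g))"
    using assms by simp
qed (use assms in auto)

lemma comp_hom:
  assumes "A \<in> Obj C" "B \<in> Obj C" "D \<in> Obj C"
  shows "g \<in> Hom C B D \<Longrightarrow> (\<lambda>f. g \<cdot> f) \<in> hom (hom_group C A B) (hom_group C A D)"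
    and "f \<in> Hom C A B \<Longrightarrow> (\<lambda>g. g \<cdot> f) \<in> hom (hom_group C B D) (hom_group C A D)"
  using structure_hom_group assms unfolding preadditive_structure_def by simp_all

lemma comp_hadd_left [simp]:
  assumes "f \<in> Arr C" "g \<in> Arr C" "h \<in> Arr C"
    and "Dom C f = Dom C g" "Cod C f = Cod C g" "Cod C g = Dom C h"
  shows "h \<cdot> hadd C f g = hadd C (h \<cdot> f) (h \<cdot> g)"
proof -
  have "(\<lambda>f. h \<cdot> f) \<in> hom (hom_group C (Dom C g) (Dom C h)) (hom_group C (Dom C g) (Cod C h))"
    using assms by (intro comp_hom(1)) (auto simp: in_Hom)
  from hom_mult[OF this, of f g] show ?thesis
    using assms by (simp add: in_Hom hadd_def)
qed

lemma comp_hadd_right [simp]: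
  assumes "f \<in> Arr C" "g \<in> Arr C" "h \<in> Arr C"
    and "Dom C f = Dom C g" "Cod C f = Cod C g" "Dom C g = Cod C h"
  shows "hadd C f g \<cdot> h = hadd C (f \<cdot> h) (g \<cdot> h)"
proof -
  have "(\<lambda>f. f \<cdot> h) \<in> hom (hom_group C (Cod C h) (Cod C g)) (hom_group C (Dom C h) (Cod C g))"
    using assms by (intro comp_hom(2)) (auto simp: in_Hom)
  from hom_mult[OF this, of f g] show ?thesis
    using assms by (simp add: in_Hom hadd_def)
qed

lemma comp_zero [simp]:
  "h \<in> Arr C \<Longrightarrow> A \<in> Obj C \<Longrightarrow> Dom C h = B \<Longrightarrow> h \<cdot> hzero C A B = hzero C A (Cod C h)"
  "h \<in> Arr C \<Longrightarrow> B \<in> Obj C \<Longrightarrow> Cod C h = A \<Longrightarrow> hzero C A B \<cdot> h = hzero C (Dom C h) B"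
proof -
  assume *: "h \<in> Arr C" "A \<in> Obj C" "Dom C h = B"
  have "hadd C (h \<cdot> hzero C A B) (h \<cdot> hzero C A B) = h \<cdot> hzero C A B"
    using * by (subst comp_hadd_left[symmetric]) auto
  from zero_unique[OF _ this] show "h \<cdot> hzero C A B = hzero C A (Cod C h)"
    using * by auto
next
  assume *: "h \<in> Arr C" "B \<in> Obj C" "Cod C h = A"
  have "hadd C (hzero C A B \<cdot> h) (hzero C A B \<cdot> h) = hzero C A B \<cdot> h"
    using * by (subst comp_hadd_right[symmetric]) auto
  from zero_unique[OF _ this] show "hzero C A B \<cdot> h = hzero C (Dom C h) B"
    using * by auto
qed

lemma comp_hneg [simp]:
  assumes "f \<in> Arr C" "h \<in> Arr C" "Cod C f = Dom C h"
  shows "h \<cdot> hneg C f = hneg C (h \<cdot> f)" "hneg C h \<cdot> f = hneg C (h \<cdot> f)"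
proof -
  show "h \<cdot> hneg C f = hneg C (h \<cdot> f)"
  proof (rule hneg_unique)
    show "hadd C (h \<cdot> hneg C f) (h \<cdot> f) = hzero C (Dom C (h \<cdot> f)) (Cod C (h \<cdot> f))"
      using assms by (subst comp_hadd_left[symmetric]) simp_all
  qed (use assms in auto)
  show "hneg C h \<cdot> f = hneg C (h \<cdot> f)"
  proof (rule hneg_unique)
    show "hadd C (hneg C h \<cdot> f) (h \<cdot> f) = hzero C (Dom C (h \<cdot> f)) (Cod C (h \<cdot> f))"
      using assms by (subst comp_hadd_right[symmetric]) simp_all
  qed (use assms in auto)
qed

text \<open>The additive form of \<open>1 - (1 - p)\<^sup>2 = 2 p - p\<^sup>2\<close>, with \<open>p = 1 + t\<close>.\<close>

lemma double_minus_square: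
  assumes t: "t \<in> Arr C" "Dom C t = A" "Cod C t = A"
    and p: "p = hadd C (Ident C A) t"
  shows "hadd C p (hadd C p (hneg C (p \<cdot> p))) = hadd C (Ident C A) (hneg C (t \<cdot> t))"
proof -
  have A: "A \<in> Obj C"
    using t by auto
  have p': "p \<in> Arr C" "Dom C p = A" "Cod C p = A"
    using p t A by auto
  have "p \<cdot> p = hadd C p (hadd C t (t \<cdot> t))"
    unfolding p using t A by (simp add: hadd_assoc)
  then have "hadd C p (hneg C (p \<cdot> p)) = hadd C (hneg C t) (hneg C (t \<cdot> t))"
    using p' t A by simp
  then show ?thesis
    using p t A by (simp add: hadd_assoc)
qed

end

sublocale additive_category \<subseteq> preadditive_category
  by unfold_locales (rule preadditive)

section \<open>Homotopy equivalence of complexes\<close>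

lemma complexesD:
  assumes "X \<in> complexes n C"
  shows "i \<le> Suc n \<Longrightarrow> cobj X i \<in> Obj C"
    and "i \<le> n \<Longrightarrow> diff X i \<in> Arr C"
    and "i \<le> n \<Longrightarrow> Dom C (diff X i) = cobj X i"
    and "i \<le> n \<Longrightarrow> Cod C (diff X i) = cobj X (Suc i)"
    and "i < n \<Longrightarrow> diff X (Suc i) \<cdot>\<^bsub>C\<^esub> diff X i = hzero C (cobj X i) (cobj X (Suc (Suc i)))"
  using assms by (auto simp: complexes_def in_Hom)

lemma chain_mapD:
  assumes "chain_map n C X Y f"
  shows "i \<le> Suc n \<Longrightarrow> f i \<in> Arr C"
    and "i \<le> Suc n \<Longrightarrow> Dom C (f i) = cobj X i"
    and "i \<le> Suc n \<Longrightarrow> Cod C (f i) = cobj Y i"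
    and "i \<le> n \<Longrightarrow> f (Suc i) \<cdot>\<^bsub>C\<^esub> diff X i = diff Y i \<cdot>\<^bsub>C\<^esub> f i"
  using assms by (auto simp: chain_map_def in_Hom)

text \<open>Shifts the homotopy by one, \<open>k i = h (Suc i)\<close>, so that \<open>k i\<close>
  goes from \<open>cobj X (Suc i)\<close> to \<open>cobj Y i\<close> and no truncated subtraction
  remains; the inner degrees are indexed by \<open>Suc i\<close> with i < n.\<close>

lemma homotopic_iff:
  "homotopic n C X Y f g \<longleftrightarrow> (\<exists>k.
     (\<forall>i \<le> n. k i \<in> Hom C (cobj X (Suc i)) (cobj Y i)) \<and>
     f 0 = hadd C (g 0) (k 0 \<cdot>\<^bsub>C\<^esub> diff X 0) \<and>
     (\<forall>i < n. f (Suc i) = hadd C (g (Suc i))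
        (hadd C (diff Y i \<cdot>\<^bsub>C\<^esub> k i) (k (Suc i) \<cdot>\<^bsub>C\<^esub> diff X (Suc i)))) \<and>
     f (Suc n) = hadd C (g (Suc n)) (diff Y n \<cdot>\<^bsub>C\<^esub> k n))"
  (is "_ \<longleftrightarrow> (\<exists>k. ?P k)")
proof
  assume "homotopic n C X Y f g"
  then obtain h where h: "\<forall>i \<in> {1..n + 1}. h i \<in> Hom C (cobj X i) (cobj Y (i - 1))"
     "f 0 = hadd C (g 0) (h 1 \<cdot>\<^bsub>C\<^esub> diff X 0)"
     "\<forall>i \<in> {1..n}. f i = hadd C (g i)
        (hadd C (diff Y (i - 1) \<cdot>\<^bsub>C\<^esub> h i) (h (i + 1) \<cdot>\<^bsub>C\<^esub> diff X i))"
     "f (n + 1) = hadd C (g (n + 1)) (diff Y n \<cdot>\<^bsub>C\<^esub> h (n + 1))"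
    unfolding homotopic_def by blast
  show "\<exists>k. ?P k"
    by (rule exI[of _ "\<lambda>i. h (Suc i)"]) (use h in \<open>auto dest: bspec[of _ _ "Suc _"]\<close>)
next
  assume "\<exists>k. ?P k"
  then obtain k where k: "?P k" ..
  show "homotopic n C X Y f g"
    unfolding homotopic_def
  proof (intro exI conjI ballI)
    fix i assume "i \<in> {1..n + 1}"
    then show "k (i - 1) \<in> Hom C (cobj X i) (cobj Y (i - 1))"
      using k by (cases i) auto
  next
    fix i assume "i \<in> {1..n}"
    then show "f i = hadd C (g i)
        (hadd C (diff Y (i - 1) \<cdot>\<^bsub>C\<^esub> k (i - 1)) (k (i + 1 - 1) \<cdot>\<^bsub>C\<^esub> diff X i))"
      using k by (cases i) auto
  qed (use k in auto)
qed

lemma end_fixingD: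
  assumes "end_fixing n C X Y f"
  shows "chain_map n C X Y f" "f 0 = Ident C (cobj X 0)" "f (Suc n) = Ident C (cobj X (Suc n))"
  using assms by (auto simp: end_fixing_def)

text \<open>Each \<open>diff X (Suc i)\<close> is a weak cokernel of \<open>diff X i\<close>. This
  is the contravariant exactness of an exangle at the inner degrees; as it mentions no extension, it
  can be transferred along maps of complexes alone.\<close>

definition right_exact :: "nat \<Rightarrow> ('o, 'm) cat \<Rightarrow> ('o, 'm) cpx \<Rightarrow> bool" where
  "right_exact n C X \<longleftrightarrow>
     (\<forall>i < n. \<forall>g \<in> Arr C. Dom C g = cobj X (Suc i) \<longrightarrow>
        g \<cdot>\<^bsub>C\<^esub> diff X i = hzero C (cobj X i) (Cod C g) \<longrightarrow>
        (\<exists>h \<in> Hom C (cobj X (Suc (Suc i))) (Cod C g). g = h \<cdot>\<^bsub>C\<^esub> diff X (Suc i)))"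

context preadditive_category
begin

lemma complexes_comp_zero:
  assumes "X \<in> complexes n C" "i < n" "g \<in> Arr C" "Cod C g = cobj X i"
  shows "diff X (Suc i) \<cdot> (diff X i \<cdot> g) = hzero C (Dom C g) (cobj X (Suc (Suc i)))"
proof -
  note [simp] = complexesD[OF assms(1)]
  have "diff X (Suc i) \<cdot> (diff X i \<cdot> g) = (diff X (Suc i) \<cdot> diff X i) \<cdot> g"
    using assms(2-4) by (subst comp_assoc) auto
  then show ?thesis
    using assms(2-4) by simp
qed

lemma chain_map_comp_diff:
  assumes "chain_map n C X Y f" "X \<in> complexes n C" "Y \<in> complexes n C"
    and "i \<le> n" "g \<in> Arr C" "Cod C g = cobj X i"
  shows "f (Suc i) \<cdot> (diff X i \<cdot> g) = diff Y i \<cdot> (f i \<cdot> g)"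
proof -
  note [simp] = complexesD[OF assms(2)] complexesD[OF assms(3)] chain_mapD[OF assms(1)]
  have "f (Suc i) \<cdot> (diff X i \<cdot> g) = (f (Suc i) \<cdot> diff X i) \<cdot> g"
    using assms(4-6) by (subst comp_assoc) auto
  also have "\<dots> = (diff Y i \<cdot> f i) \<cdot> g"
    using assms(4-6) by simp
  also have "\<dots> = diff Y i \<cdot> (f i \<cdot> g)"
    using assms(4-6) by (subst comp_assoc) auto
  finally show ?thesis .
qed

lemma chain_map_comp:
  assumes "chain_map n C X Y f" "chain_map n C Y Z g"
    and "X \<in> complexes n C" "Y \<in> complexes n C" "Z \<in> complexes n C"
  shows "chain_map n C X Z (\<lambda>i. g i \<cdot> f i)"
proof -
  note [simp] = complexesD[OF assms(3)] complexesD[OF assms(4)] complexesD[OF assms(5)]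
    chain_mapD[OF assms(1)] chain_mapD[OF assms(2)] chain_map_comp_diff[OF assms(2,4,5)]
  show ?thesis
    by (auto simp: chain_map_def in_Hom)
qed

lemma end_fixing_comp:
  assumes "end_fixing n C X Y f" "end_fixing n C Y Z g"
    and "X \<in> complexes n C" "Y \<in> complexes n C" "Z \<in> complexes n C"
  shows "end_fixing n C X Z (\<lambda>i. g i \<cdot> f i)"
proof -
  note f = end_fixingD[OF assms(1)] and g = end_fixingD[OF assms(2)]
  note [simp] = complexesD[OF assms(3)] complexesD[OF assms(4)] complexesD[OF assms(5)]
    chain_mapD[OF f(1)] chain_mapD[OF g(1)]
  have "cobj Y 0 = cobj X 0" "cobj Y (Suc n) = cobj X (Suc n)"
    using chain_mapD(3)[OF f(1), of 0] chain_mapD(3)[OF f(1), of "Suc n"] f(2,3) by auto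
  then show ?thesis
    using chain_map_comp[OF f(1) g(1) assms(3-5)] f(2,3) g(2,3) by (simp add: end_fixing_def)
qed

lemma end_fixing_ident:
  assumes "X \<in> complexes n C"
  shows "end_fixing n C X X (\<lambda>i. Ident C (cobj X i))"
proof -
  note [simp] = complexesD[OF assms]
  show ?thesis
    by (auto simp: end_fixing_def chain_map_def in_Hom)
qed

lemma homotopy_equivalent_refl:
  assumes "X \<in> complexes n C"
  shows "homotopy_equivalent n C X X"
proof -
  note [simp] = complexesD[OF assms]
  note e = end_fixing_ident[OF assms]
  have "homotopic n C X X (\<lambda>i. Ident C (cobj X i) \<cdot> Ident C (cobj X i)) (\<lambda>i. Ident C (cobj X i))"
    unfolding homotopic_iff
    by (rule exI[of _ "\<lambda>i. hzero C (cobj X (Suc i)) (cobj X i)"]) (auto simp: in_Hom)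
  then show ?thesis
    unfolding homotopy_equivalent_def using e by blast
qed

lemma homotopy_equivalent_sym:
  "homotopy_equivalent n C X Y \<Longrightarrow> homotopy_equivalent n C Y X"
  unfolding homotopy_equivalent_def by blast

text \<open>If g f = 1 + (d k + k d) and p = 1 + (d l + l d), then g p f = g f + g (d l + l d) f,
  and the second summand is the boundary of g l f because f and g commute with the differentials. So
  k + g l f is the required homotopy. With p the round trip of a second homotopy equivalence this is
  the heart of transitivity.\<close>

lemma homotopic_sandwich:
  assumes f: "end_fixing n C X Y f" and g: "end_fixing n C Y X g"
    and p: "chain_map n C Y Y p"
    and X: "X \<in> complexes n C" and Y: "Y \<in> complexes n C"
    and gf: "homotopic n C X X (\<lambda>i. g i \<cdot> f i) (\<lambda>i. Ident C (cobj X i))"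
    and hp: "homotopic n C Y Y p (\<lambda>i. Ident C (cobj Y i))"
  shows "homotopic n C X X (\<lambda>i. g i \<cdot> (p i \<cdot> f i)) (\<lambda>i. Ident C (cobj X i))"
proof -
  note fD = end_fixingD[OF f] and gD = end_fixingD[OF g]
  note XD = complexesD[OF X] and YD = complexesD[OF Y]
  note fc = chain_mapD[OF fD(1)] and gc = chain_mapD[OF gD(1)] and pc = chain_mapD[OF p]
  obtain k where k: "\<And>i. i \<le> n \<Longrightarrow> k i \<in> Hom C (cobj X (Suc i)) (cobj X i)"
     "g 0 \<cdot> f 0 = hadd C (Ident C (cobj X 0)) (k 0 \<cdot> diff X 0)"
     "\<And>i. i < n \<Longrightarrow> g (Suc i) \<cdot> f (Suc i) = hadd C (Ident C (cobj X (Suc i)))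
        (hadd C (diff X i \<cdot> k i) (k (Suc i) \<cdot> diff X (Suc i)))"
     "g (Suc n) \<cdot> f (Suc n) = hadd C (Ident C (cobj X (Suc n))) (diff X n \<cdot> k n)"
    using gf unfolding homotopic_iff by blast
  obtain l where l: "\<And>i. i \<le> n \<Longrightarrow> l i \<in> Hom C (cobj Y (Suc i)) (cobj Y i)"
     "p 0 = hadd C (Ident C (cobj Y 0)) (l 0 \<cdot> diff Y 0)"
     "\<And>i. i < n \<Longrightarrow> p (Suc i) = hadd C (Ident C (cobj Y (Suc i)))
        (hadd C (diff Y i \<cdot> l i) (l (Suc i) \<cdot> diff Y (Suc i)))"
     "p (Suc n) = hadd C (Ident C (cobj Y (Suc n))) (diff Y n \<cdot> l n)"
    using hp unfolding homotopic_iff by blast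
  have kT: "k i \<in> Arr C" "Dom C (k i) = cobj X (Suc i)" "Cod C (k i) = cobj X i" if "i \<le> n" for i
    using k(1)[OF that] by (auto simp: in_Hom)
  have lT: "l i \<in> Arr C" "Dom C (l i) = cobj Y (Suc i)" "Cod C (l i) = cobj Y i" if "i \<le> n" for i
    using l(1)[OF that] by (auto simp: in_Hom)
  note [simp] = XD(1-4) YD(1-4) fc(1-3) gc(1-3) kT lT
  have gdiff: "g (Suc i) \<cdot> (diff Y i \<cdot> u) = diff X i \<cdot> (g i \<cdot> u)"
    if "i \<le> n" "u \<in> Arr C" "Cod C u = cobj Y i" for i u
    using chain_map_comp_diff[OF gD(1) Y X that] .
  define m where "m i = hadd C (k i) (g i \<cdot> (l i \<cdot> f (Suc i)))" for i
  show ?thesis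
    unfolding homotopic_iff
  proof (rule exI[of _ m], intro conjI allI impI)
    fix i assume "i \<le> n"
    then show "m i \<in> Hom C (cobj X (Suc i)) (cobj X i)"
      by (simp add: m_def in_Hom)
  next
    show "g 0 \<cdot> (p 0 \<cdot> f 0) = hadd C (Ident C (cobj X 0)) (m 0 \<cdot> diff X 0)"
      by (simp add: l(2) m_def k(2) fc(4) hadd_assoc)
  next
    show "g (Suc n) \<cdot> (p (Suc n) \<cdot> f (Suc n)) =
        hadd C (Ident C (cobj X (Suc n))) (diff X n \<cdot> m n)"
      by (simp add: l(4) m_def k(4) gdiff hadd_assoc)
  next
    fix i assume i: "i < n"
    then show "g (Suc i) \<cdot> (p (Suc i) \<cdot> f (Suc i)) = hadd C (Ident C (cobj X (Suc i)))
        (hadd C (diff X i \<cdot> m i) (m (Suc i) \<cdot> diff X (Suc i)))"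
      by (simp add: l(3) m_def k(3) gdiff fc(4) hadd_assoc)
        (simp add: hadd_ac)
  qed
qed

lemma homotopy_equivalent_trans:
  assumes "homotopy_equivalent n C X Y" "homotopy_equivalent n C Y Z"
    and X: "X \<in> complexes n C" and Y: "Y \<in> complexes n C" and Z: "Z \<in> complexes n C"
  shows "homotopy_equivalent n C X Z"
proof -
  obtain f g where f: "end_fixing n C X Y f" and g: "end_fixing n C Y X g"
    and gf: "homotopic n C X X (\<lambda>i. g i \<cdot> f i) (\<lambda>i. Ident C (cobj X i))"
    and fg: "homotopic n C Y Y (\<lambda>i. f i \<cdot> g i) (\<lambda>i. Ident C (cobj Y i))"
    using assms(1) unfolding homotopy_equivalent_def by blast
  obtain f' g' where f': "end_fixing n C Y Z f'" and g': "end_fixing n C Z Y g'"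
    and gf': "homotopic n C Y Y (\<lambda>i. g' i \<cdot> f' i) (\<lambda>i. Ident C (cobj Y i))"
    and fg': "homotopic n C Z Z (\<lambda>i. f' i \<cdot> g' i) (\<lambda>i. Ident C (cobj Z i))"
    using assms(2) unfolding homotopy_equivalent_def by blast
  note m = end_fixingD(1)[OF f] end_fixingD(1)[OF g] end_fixingD(1)[OF f'] end_fixingD(1)[OF g']
  note [simp] = chain_mapD(1-3)[OF m(1)] chain_mapD(1-3)[OF m(2)] chain_mapD(1-3)[OF m(3)]
    chain_mapD(1-3)[OF m(4)]
  have 1: "homotopic n C X X (\<lambda>i. g i \<cdot> ((g' i \<cdot> f' i) \<cdot> f i)) (\<lambda>i. Ident C (cobj X i))"
    by (rule homotopic_sandwich[OF f g _ X Y gf gf']) (rule chain_map_comp[OF m(3,4) Y Z Y])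
  have 2: "homotopic n C Z Z (\<lambda>i. f' i \<cdot> ((f i \<cdot> g i) \<cdot> g' i)) (\<lambda>i. Ident C (cobj Z i))"
    by (rule homotopic_sandwich[OF g' f' _ Z Y fg' fg]) (rule chain_map_comp[OF m(2,1) Y X Y])
  have "homotopic n C X X (\<lambda>i. (g i \<cdot> g' i) \<cdot> (f' i \<cdot> f i)) (\<lambda>i. Ident C (cobj X i))"
    using 1 unfolding homotopic_iff by (auto cong: conj_cong)
  moreover have "homotopic n C Z Z (\<lambda>i. (f' i \<cdot> f i) \<cdot> (g i \<cdot> g' i)) (\<lambda>i. Ident C (cobj Z i))"
    using 2 unfolding homotopic_iff by (auto cong: conj_cong)
  ultimately show ?thesis
    unfolding homotopy_equivalent_def
    using end_fixing_comp[OF f f' X Y Z] end_fixing_comp[OF g' g Z Y X] by blast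
qed

text \<open>A morphism determines its codomain: the component of an end-fixing map in degree 0 is
  the identity of \<open>cobj X 0\<close> and also ends in \<open>cobj Y 0\<close>; likewise in
  degree n + 1.\<close>

lemma homotopy_equivalent_ends:
  assumes "homotopy_equivalent n C X Y"
  shows "cobj Y 0 = cobj X 0" "cobj Y (Suc n) = cobj X (Suc n)"
proof -
  obtain g where g: "end_fixing n C Y X g"
    using assms unfolding homotopy_equivalent_def by blast
  obtain f where f: "end_fixing n C X Y f"
    using assms unfolding homotopy_equivalent_def by blast
  note fD = end_fixingD[OF f] and gD = end_fixingD[OF g]
  show "cobj Y 0 = cobj X 0" "cobj Y (Suc n) = cobj X (Suc n)"
    using chain_mapD(3)[OF fD(1), of 0] chain_mapD(3)[OF fD(1), of "Suc n"]
      chain_mapD(1,2)[OF fD(1), of 0] chain_mapD(1,2)[OF fD(1), of "Suc n"]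
      fD(2,3) ident_simps dom_in_Obj by (metis order_refl le0)+
qed

lemma hclass_eq:
  assumes "X \<in> complexes n C" "Y \<in> complexes n C" "homotopy_equivalent n C X Y"
  shows "hclass n C X = hclass n C Y"
proof -
  have "homotopy_equivalent n C X Z \<longleftrightarrow> homotopy_equivalent n C Y Z" if "Z \<in> complexes n C" for Z
    using homotopy_equivalent_trans[OF assms(3) _ assms(1,2) that]
      homotopy_equivalent_trans[OF homotopy_equivalent_sym[OF assms(3)] _ assms(2,1) that] by blast
  then show ?thesis
    using homotopy_equivalent_ends[OF assms(3)] unfolding hclass_def complexes_betw_def by auto
qed

lemma hclass_self: "X \<in> complexes n C \<Longrightarrow> X \<in> hclass n C X"
  by (simp add: hclass_def complexes_betw_def homotopy_equivalent_refl)

section \<open>Homotopies of end-fixing endomorphisms\<close>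

text \<open>The comparison argument, carried from left to right: once k is found up to index m, the
  defect of p - 1 in degree m + 1 kills \<open>diff X m\<close> and thus factors through the weak
  cokernel \<open>diff X (Suc m)\<close>; the factor is the next component. Starting with zero fits
  because p is the identity in degree 0. Degree n + 1 is not covered, since no differential leaves
  it.\<close>

lemma null_homotopy_of_difference:
  assumes X: "X \<in> complexes n C" and ex: "right_exact n C X" and p: "end_fixing n C X X p"
    and m: "m \<le> n"
  shows "\<exists>k. (\<forall>i \<le> m. k i \<in> Hom C (cobj X (Suc i)) (cobj X i)) \<and>
     k 0 = hzero C (cobj X 1) (cobj X 0) \<and>
     (\<forall>i < m. p (Suc i) = hadd C (Ident C (cobj X (Suc i)))
        (hadd C (diff X i \<cdot> k i) (k (Suc i) \<cdot> diff X (Suc i))))"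
  using m
proof (induction m)
  case 0
  then show ?case
    using complexesD(1)[OF X] by (intro exI[of _ "\<lambda>_. hzero C (cobj X 1) (cobj X 0)"]) (auto simp: in_Hom)
next
  case (Suc m)
  note XD = complexesD[OF X] and pD = end_fixingD[OF p]
  note pc = chain_mapD[OF pD(1)]
  obtain k where k: "\<And>i. i \<le> m \<Longrightarrow> k i \<in> Hom C (cobj X (Suc i)) (cobj X i)"
     "k 0 = hzero C (cobj X 1) (cobj X 0)"
     "\<And>i. i < m \<Longrightarrow> p (Suc i) = hadd C (Ident C (cobj X (Suc i)))
        (hadd C (diff X i \<cdot> k i) (k (Suc i) \<cdot> diff X (Suc i)))"
    using Suc by auto
  have kT: "k i \<in> Arr C" "Dom C (k i) = cobj X (Suc i)" "Cod C (k i) = cobj X i" if "i \<le> m" for i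
    using k(1)[OF that] by (auto simp: in_Hom)
  note [simp] = XD pc(1-3) kT complexes_comp_zero[OF X]
  \<comment> \<open>What \<open>k m\<close> leaves over of p - 1 in degree m + 1; it has to become
    the composite of \<open>k (Suc m)\<close> with \<open>diff X (Suc m)\<close>.\<close>
  define r where "r = hadd C (hneg C (diff X m \<cdot> k m)) (hadd C (hneg C (Ident C (cobj X (Suc m)))) (p (Suc m)))"
  have r: "r \<in> Arr C" "Dom C r = cobj X (Suc m)" "Cod C r = cobj X (Suc m)"
    using Suc.prems by (auto simp: r_def)
  have "p (Suc m) \<cdot> diff X m = diff X m \<cdot> p m"
    using pc(4) Suc.prems by simp
  \<comment> \<open>For \<open>m = Suc j\<close> the summand of \<open>p m\<close> that starts with
    \<open>diff X j\<close> on the left dies after \<open>diff X m\<close>; for m = 0 both sides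
    reduce to \<open>diff X 0\<close>, as \<open>p 0\<close> is an identity and \<open>k 0\<close>
    is zero.\<close>
  also have "\<dots> = hadd C (diff X m) (diff X m \<cdot> (k m \<cdot> diff X m))"
  proof (cases m)
    case 0
    then show ?thesis
      using Suc.prems by (simp add: pD(2) k(2))
  next
    case (Suc j)
    then show ?thesis
      using Suc.prems by (simp add: k(3))
  qed
  finally have "r \<cdot> diff X m = hzero C (cobj X m) (Cod C r)"
    using Suc.prems r(3) unfolding r_def by (simp add: hadd_assoc)
  then obtain h where h: "h \<in> Hom C (cobj X (Suc (Suc m))) (cobj X (Suc m))"
      and rh: "r = h \<cdot> diff X (Suc m)"
    using ex r Suc.prems unfolding right_exact_def by (metis Suc_le_lessD)
  have step: "p (Suc m) = hadd C (Ident C (cobj X (Suc m))) (hadd C (diff X m \<cdot> k m) (h \<cdot> diff X (Suc m)))"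
    unfolding rh[symmetric] r_def using Suc.prems by (simp)
  show ?case
    by (rule exI[of _ "k (Suc m := h)"]) (use k h step in \<open>auto simp: le_Suc_eq less_Suc_eq\<close>)
qed

text \<open>Since the homotopy runs from the left, \<open>p - 1\<close> is only homotopic to a map concentrated in
  degree \<open>n + 1\<close>; multiplying by \<open>1 - p\<close>, which vanishes there, removes this remainder.\<close>

lemma homotopic_double_minus_square:
  assumes X: "X \<in> complexes n C" and ex: "right_exact n C X" and p: "end_fixing n C X X p"
  shows "homotopic n C X X (\<lambda>i. hadd C (p i) (hadd C (p i) (hneg C (p i \<cdot> p i))))
     (\<lambda>i. Ident C (cobj X i))"
proof -
  note XD = complexesD[OF X] and pD = end_fixingD[OF p]
  note pc = chain_mapD[OF pD(1)]
  obtain k where k: "\<And>i. i \<le> n \<Longrightarrow> k i \<in> Hom C (cobj X (Suc i)) (cobj X i)"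
     "k 0 = hzero C (cobj X 1) (cobj X 0)"
     "\<And>i. i < n \<Longrightarrow> p (Suc i) = hadd C (Ident C (cobj X (Suc i)))
        (hadd C (diff X i \<cdot> k i) (k (Suc i) \<cdot> diff X (Suc i)))"
    using null_homotopy_of_difference[OF assms order_refl] by auto
  have kT: "k i \<in> Arr C" "Dom C (k i) = cobj X (Suc i)" "Cod C (k i) = cobj X i" if "i \<le> n" for i
    using k(1)[OF that] by (auto simp: in_Hom)
  note [simp] = XD pc(1-3) kT
  have pdiff: "p (Suc i) \<cdot> (diff X i \<cdot> u) = diff X i \<cdot> (p i \<cdot> u)"
    if "i \<le> n" "u \<in> Arr C" "Cod C u = cobj X i" for i u
    using chain_map_comp_diff[OF pD(1) X X that] .
  \<comment> \<open>This is (1 - p) k. As p commutes with the differentials, the boundary t of k in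
    an inner degree turns into t - p t = -t^2.\<close>
  define l where "l i = hadd C (k i) (hneg C (p i \<cdot> k i))" for i
  show ?thesis
    unfolding homotopic_iff
  proof (rule exI[of _ l], intro conjI allI impI)
    fix i assume "i \<le> n"
    then show "l i \<in> Hom C (cobj X (Suc i)) (cobj X i)"
      by (simp add: l_def in_Hom)
  next
    show "hadd C (p 0) (hadd C (p 0) (hneg C (p 0 \<cdot> p 0))) =
        hadd C (Ident C (cobj X 0)) (l 0 \<cdot> diff X 0)"
      by (simp add: pD(2) l_def k(2))
  next
    \<comment> \<open>In the top degree p is the identity, so d p k = p d k = d k and the boundary
      of l vanishes there.\<close>
    have "diff X n \<cdot> (p n \<cdot> k n) = diff X n \<cdot> k n"
      using pdiff[of n "k n"] by (simp add: pD(3))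
    then show "hadd C (p (Suc n)) (hadd C (p (Suc n)) (hneg C (p (Suc n) \<cdot> p (Suc n)))) =
        hadd C (Ident C (cobj X (Suc n))) (diff X n \<cdot> l n)"
      by (simp add: pD(3) l_def)
  next
    fix i assume i: "i < n"
    define t where "t = hadd C (diff X i \<cdot> k i) (k (Suc i) \<cdot> diff X (Suc i))"
    have t: "t \<in> Arr C" "Dom C t = cobj X (Suc i)" "Cod C t = cobj X (Suc i)"
      using i by (auto simp: t_def)
    have pt: "p (Suc i) = hadd C (Ident C (cobj X (Suc i))) t"
      using k(3)[OF i] by (simp add: t_def)
    have "hadd C (diff X i \<cdot> l i) (l (Suc i) \<cdot> diff X (Suc i)) =
        hadd C t (hneg C (p (Suc i) \<cdot> t))"
      unfolding l_def using i by (simp add: t_def pdiff) (simp add: hadd_ac)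
    also have "\<dots> = hneg C (t \<cdot> t)"
      using t i by (simp add: pt)
    finally show "hadd C (p (Suc i)) (hadd C (p (Suc i)) (hneg C (p (Suc i) \<cdot> p (Suc i)))) =
        hadd C (Ident C (cobj X (Suc i))) (hadd C (diff X i \<cdot> l i) (l (Suc i) \<cdot> diff X (Suc i)))"
      using double_minus_square[OF t pt] by simp
  qed
qed

text \<open>Keep f and replace g by g' = 2g - gfg. With p = gf and q = fg one gets g'f = 2p - p^2
  and fg' = 2q - q^2, both homotopic to the identity by the weak cokernels in X and in Y; g' still
  fixes the ends, where 2 - 1 = 1.\<close>

lemma homotopy_equivalentI:
  assumes X: "X \<in> complexes n C" and Y: "Y \<in> complexes n C"
    and eX: "right_exact n C X" and eY: "right_exact n C Y"
    and f: "end_fixing n C X Y f" and g: "end_fixing n C Y X g"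
  shows "homotopy_equivalent n C X Y"
proof -
  note fD = end_fixingD[OF f] and gD = end_fixingD[OF g]
  note fc = chain_mapD[OF fD(1)] and gc = chain_mapD[OF gD(1)]
  note [simp] = complexesD[OF X] complexesD[OF Y] fc(1-3) gc(1-3)
  have ends: "cobj Y 0 = cobj X 0" "cobj Y (Suc n) = cobj X (Suc n)"
    using fc(3)[of 0] fc(3)[of "Suc n"] fD(2,3) by auto
  define g' where "g' i = hadd C (g i) (hadd C (g i) (hneg C (g i \<cdot> (f i \<cdot> g i))))" for i
  have g': "end_fixing n C Y X g'"
    unfolding end_fixing_def
  proof (intro conjI)
    show "chain_map n C Y X g'"
      using chain_map_comp_diff[OF fD(1) X Y] chain_map_comp_diff[OF gD(1) Y X]
      by (auto simp: chain_map_def in_Hom g'_def fc(4) gc(4))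
  qed (use gD fD ends in \<open>auto simp: g'_def\<close>)
  have "homotopic n C X X (\<lambda>i. g' i \<cdot> f i) (\<lambda>i. Ident C (cobj X i))"
    using homotopic_double_minus_square[OF X eX end_fixing_comp[OF f g X Y X]]
    unfolding homotopic_iff g'_def by (auto cong: conj_cong)
  moreover have "homotopic n C Y Y (\<lambda>i. f i \<cdot> g' i) (\<lambda>i. Ident C (cobj Y i))"
    using homotopic_double_minus_square[OF Y eY end_fixing_comp[OF g f Y X Y]]
    unfolding homotopic_iff g'_def by (auto cong: conj_cong)
  ultimately show ?thesis
    unfolding homotopy_equivalent_def using f g' by blast
qed

end

section \<open>Conflations are closed under isomorphism\<close>

lemma (in preadditive_category) n_exangle_right_exact:
  assumes "n_exangle n C E X \<delta>"
  shows "right_exact n C X"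
  unfolding right_exact_def
proof (intro allI impI ballI)
  fix i g
  assume i: "i < n" and g: "g \<in> Arr C" "Dom C g = cobj X (Suc i)"
    "g \<cdot> diff X i = hzero C (cobj X i) (Cod C g)"
  have "X \<in> complexes n C"
    using assms by (simp add: n_exangle_def)
  note [simp] = complexesD[OF this]
  have "exact_at (hom_group C (cobj X (i + 2)) (Cod C g)) (hom_group C (cobj X (i + 1)) (Cod C g))
     (hom_group C (cobj X i) (Cod C g)) (\<lambda>g. g \<cdot> diff X (i + 1)) (\<lambda>g. g \<cdot> diff X i)"
    using assms i g(1) unfolding n_exangle_def by auto
  then have *: "(\<lambda>g. g \<cdot> diff X (Suc i)) ` Hom C (cobj X (Suc (Suc i))) (Cod C g) =
      {h \<in> Hom C (cobj X (Suc i)) (Cod C g). h \<cdot> diff X i = hzero C (cobj X i) (Cod C g)}"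
    using i g(1) by (simp add: exact_at_def kernel_def hzero_def)
  have "g \<in> (\<lambda>g. g \<cdot> diff X (Suc i)) ` Hom C (cobj X (Suc (Suc i))) (Cod C g)"
    unfolding * using g by (simp add: in_Hom)
  then show "\<exists>h\<in>Hom C (cobj X (Suc (Suc i))) (Cod C g). g = h \<cdot> diff X (Suc i)"
    by blast
qed

text \<open>Weak cokernels pass to retracts: if u kills the differential of Y, then u f kills that
  of X, so u f = h d_X, and u = u f g = h d_X g = (h g) d_Y.\<close>

lemma (in preadditive_category) right_exact_iso:
  assumes ex: "right_exact n C X" and X: "X \<in> complexes n C" and Y: "Y \<in> complexes n C"
    and f: "chain_map n C X Y f" and g: "chain_map n C Y X g"
    and fg: "\<And>i. i \<le> Suc n \<Longrightarrow> f i \<cdot> g i = Ident C (cobj Y i)"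
  shows "right_exact n C Y"
  unfolding right_exact_def
proof (intro allI impI ballI)
  fix i u
  assume i: "i < n" and u: "u \<in> Arr C" "Dom C u = cobj Y (Suc i)"
    "u \<cdot> diff Y i = hzero C (cobj Y i) (Cod C u)"
  note [simp] = complexesD[OF X] complexesD[OF Y] chain_mapD(1-3)[OF f] chain_mapD(1-3)[OF g]
  have "(u \<cdot> f (Suc i)) \<cdot> diff X i = (u \<cdot> diff Y i) \<cdot> f i"
    using i u(1,2) chain_mapD(4)[OF f, of i] by simp
  also have "\<dots> = hzero C (cobj X i) (Cod C (u \<cdot> f (Suc i)))"
    using i u by simp
  finally obtain h where h: "h \<in> Hom C (cobj X (Suc (Suc i))) (Cod C (u \<cdot> f (Suc i)))"
    and uh: "u \<cdot> f (Suc i) = h \<cdot> diff X (Suc i)"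
    using ex i u(1,2) unfolding right_exact_def by (metis comp_simps(1,2) chain_mapD(1-3)[OF f]
      Suc_le_mono le_SucI less_imp_le)
  have hT: "h \<in> Arr C" "Dom C h = cobj X (Suc (Suc i))" "Cod C h = Cod C u"
    using h i u(1,2) by (auto simp: in_Hom)
  have "u = (u \<cdot> f (Suc i)) \<cdot> g (Suc i)"
    using i u(1,2) fg[of "Suc i"] by simp
  also have "\<dots> = (h \<cdot> g (Suc (Suc i))) \<cdot> diff Y (Suc i)"
    unfolding uh using i hT chain_mapD(4)[OF g, of "Suc i"] by simp
  finally show "\<exists>h\<in>Hom C (cobj Y (Suc (Suc i))) (Cod C u). u = h \<cdot> diff Y (Suc i)"
    by (rule bexI) (use i hT in \<open>simp add: in_Hom\<close>)
qed

lemma realised_byD: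
  assumes "realised_by n C s D A \<delta> X"
  shows "X \<in> complexes n C" "cobj X 0 = A" "cobj X (Suc n) = D" "s D A \<delta> = hclass n C X"
  using assms by (auto simp: realised_by_def complexes_betw_def)

text \<open>Let W realise the transported extension, which is \<delta> pulled back along g and
  pushed forward along f. R0 supplies maps between X and W in both directions with the end
  components of f and g; composed with g and f they become end-fixing maps between Y and W. Both
  complexes are right exact, Y as an isomorphic copy of X, so Y lies in the class of W.\<close>

lemma (in exact_realisation) realised_by_iso:
  assumes r: "realised_by n C s D A \<delta> X" and \<delta>: "\<delta> \<in> ext E D A" and Y: "Y \<in> complexes n C"
    and f: "chain_map n C X Y f" and g: "chain_map n C Y X g"
    and fg: "\<And>i. i \<le> Suc n \<Longrightarrow> f i \<cdot>\<^bsub>C\<^esub> g i = Ident C (cobj Y i)"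
    and gf: "\<And>i. i \<le> Suc n \<Longrightarrow> g i \<cdot>\<^bsub>C\<^esub> f i = Ident C (cobj X i)"
  shows "realised_by n C s (cobj Y (Suc n)) (cobj Y 0) (emap E (g (Suc n)) (f 0) \<delta>) Y"
proof -
  note X = realised_byD[OF r]
  note [simp] = complexesD[OF X(1)] complexesD[OF Y] chain_mapD(1-3)[OF f] chain_mapD(1-3)[OF g]
  have obj [simp]: "D \<in> Obj C" "A \<in> Obj C"
    using complexesD(1)[OF X(1), of 0] complexesD(1)[OF X(1), of "Suc n"] X(2,3) by auto
  let ?D = "cobj Y (Suc n)" and ?A = "cobj Y 0"
  let ?\<epsilon> = "emap E (g (Suc n)) (f 0) \<delta>"
  have gH: "g (Suc n) \<in> Hom C ?D D" and fH: "f 0 \<in> Hom C A ?A"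
    and g0H: "g 0 \<in> Hom C ?A A" and fnH: "f (Suc n) \<in> Hom C D ?D"
    using X(2,3) by (auto simp: in_Hom)
  have id: "Ident C D \<in> Hom C D D" "Ident C A \<in> Hom C A A"
    "Ident C ?D \<in> Hom C ?D ?D" "Ident C ?A \<in> Hom C ?A ?A"
    by (auto intro: ident)
  have \<epsilon>: "?\<epsilon> \<in> ext E ?D ?A"
    using hom_in_carrier[OF emap[OF gH fH] \<delta>] .
  \<comment> \<open>Pulling back along \<open>f (Suc n)\<close> undoes the pull-back along
    \<open>g (Suc n)\<close>, so both sides are the push-forward of \<delta> along
    \<open>f 0\<close>.\<close>
  have m1: "ext_morphism C E D A \<delta> ?D ?A ?\<epsilon> (f 0) (f (Suc n))"
    using emap_comp[OF gH fnH fH id(4) \<delta>] fH fnH gf[of "Suc n"] X(2,3)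
    by (simp add: ext_morphism_def push_def pull_def)
  have m2: "ext_morphism C E ?D ?A ?\<epsilon> D A \<delta> (g 0) (g (Suc n))"
    using emap_comp[OF gH id(3) fH g0H \<delta>] gH g0H gf[of 0] X(2,3)
    by (simp add: ext_morphism_def push_def pull_def)
  obtain W where W: "realised_by n C s ?D ?A ?\<epsilon> W"
    using realised[OF _ _ \<epsilon>] by auto
  note WD = realised_byD[OF W]
  obtain p where p: "chain_map n C X W p" "p 0 = f 0" "p (n + 1) = f (Suc n)"
    using R0[OF _ _ \<delta> _ _ \<epsilon> r W m1] by auto
  obtain q where q: "chain_map n C W X q" "q 0 = g 0" "q (n + 1) = g (Suc n)"
    using R0[OF _ _ \<epsilon> _ _ \<delta> W r m2] by auto
  have eW: "right_exact n C W"
    using n_exangle_right_exact[OF R1[OF _ _ \<epsilon> W]] by simp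
  have eY: "right_exact n C Y"
    using right_exact_iso[OF n_exangle_right_exact[OF R1[OF _ _ \<delta> r]] X(1) Y f g fg] by simp
  have 1: "end_fixing n C Y W (\<lambda>i. p i \<cdot>\<^bsub>C\<^esub> g i)"
    using chain_map_comp[OF g p(1) Y X(1) WD(1)] p(2,3) fg[of 0] fg[of "Suc n"]
    by (simp add: end_fixing_def)
  have 2: "end_fixing n C W Y (\<lambda>i. f i \<cdot>\<^bsub>C\<^esub> q i)"
    using chain_map_comp[OF q(1) f WD(1) X(1) Y] q(2,3) fg[of 0] fg[of "Suc n"] WD(2,3)
    by (simp add: end_fixing_def)
  show ?thesis
    using hclass_eq[OF WD(1) Y homotopy_equivalentI[OF WD(1) Y eW eY 2 1]] WD(4) Y
    by (simp add: realised_by_def complexes_betw_def)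
qed

section \<open>Preadditive structures and functors\<close>

lemma preadditive_structureD:
  assumes "preadditive_structure C P"
  shows "A \<in> Obj C \<Longrightarrow> B \<in> Obj C \<Longrightarrow> comm_group (P A B)"
    and "A \<in> Obj C \<Longrightarrow> B \<in> Obj C \<Longrightarrow> carrier (P A B) = Hom C A B"
    and "A \<in> Obj C \<Longrightarrow> B \<in> Obj C \<Longrightarrow> D \<in> Obj C \<Longrightarrow> g \<in> Hom C B D
      \<Longrightarrow> (\<lambda>f. g \<cdot>\<^bsub>C\<^esub> f) \<in> hom (P A B) (P A D)"
    and "A \<in> Obj C \<Longrightarrow> B \<in> Obj C \<Longrightarrow> D \<in> Obj C \<Longrightarrow> f \<in> Hom C A B
      \<Longrightarrow> (\<lambda>g. g \<cdot>\<^bsub>C\<^esub> f) \<in> hom (P B D) (P A D)"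
  using assms by (simp_all add: preadditive_structure_def)

text \<open>A zero morphism factors through a zero object Z. Since Hom(A, Z) has a single element,
  the two zeros agree there, and composition with a fixed morphism from Z to B, additive for P as
  well, carries this to Hom(A, B).\<close>

lemma (in additive_category) preadditive_structure_zero:
  assumes P: "preadditive_structure C P" and AB: "A \<in> Obj C" "B \<in> Obj C"
  shows "\<one>\<^bsub>P A B\<^esub> = hzero C A B"
proof -
  note PD = preadditive_structureD[OF P]
  obtain Z where Z: "zero_object C Z"
    using zero by blast
  then have ZO: "Z \<in> Obj C"
    by (simp add: zero_object_def)
  interpret AZ: comm_group "P A Z" by (rule PD(1)[OF AB(1) ZO])
  interpret PAB: comm_group "P A B" by (rule PD(1)[OF AB])
  have "\<one>\<^bsub>P A Z\<^esub> \<in> Hom C A Z" "hzero C A Z \<in> Hom C A Z"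
    using AZ.one_closed PD(2)[OF AB(1) ZO] AB(1) ZO by (auto simp: in_Hom)
  then have 1: "\<one>\<^bsub>P A Z\<^esub> = hzero C A Z"
    using Z AB(1) unfolding zero_object_def by blast
  have h: "(\<lambda>f. hzero C Z B \<cdot> f) \<in> hom (P A Z) (P A B)"
    using PD(3)[OF AB(1) ZO AB(2)] AB ZO by (simp add: in_Hom)
  have "\<one>\<^bsub>P A B\<^esub> = hzero C Z B \<cdot> \<one>\<^bsub>P A Z\<^esub>"
    using hom_one[OF h] PD(1) AB ZO by (simp add: comm_group_def)
  then show ?thesis
    using 1 AB ZO by simp
qed

text \<open>With biproducts addition is determined by composition: \<open>f + g\<close> is the composite of
  \<open>(f, g) : A \<rightarrow> B \<oplus> B\<close> with the codiagonal.\<close>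

lemma (in additive_category) preadditive_structure_unique:
  assumes P: "preadditive_structure C P" and AB: "A \<in> Obj C" "B \<in> Obj C"
    and f: "f \<in> Hom C A B" and g: "g \<in> Hom C A B"
  shows "f \<otimes>\<^bsub>P A B\<^esub> g = hadd C f g"
proof -
  note PD = preadditive_structureD[OF P]
  obtain S where S: "is_biproduct C B B S"
    using biproducts[OF AB(2,2)] by blast
  define T where "T = bobj S"
  have ST: "T \<in> Obj C" "in1 S \<in> Arr C" "Dom C (in1 S) = B" "Cod C (in1 S) = T"
    "in2 S \<in> Arr C" "Dom C (in2 S) = B" "Cod C (in2 S) = T"
    "pr1 S \<in> Arr C" "Dom C (pr1 S) = T" "Cod C (pr1 S) = B"
    "pr2 S \<in> Arr C" "Dom C (pr2 S) = T" "Cod C (pr2 S) = B"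
    "pr1 S \<cdot> in1 S = Ident C B" "pr2 S \<cdot> in2 S = Ident C B"
    "pr1 S \<cdot> in2 S = hzero C B B" "pr2 S \<cdot> in1 S = hzero C B B"
    "hadd C (in1 S \<cdot> pr1 S) (in2 S \<cdot> pr2 S) = Ident C T"
    using S by (auto simp: is_biproduct_def in_Hom T_def)
  note [simp] = ST(1-13)
  have fT [simp]: "f \<in> Arr C" "Dom C f = A" "Cod C f = B"
    and gT [simp]: "g \<in> Arr C" "Dom C g = A" "Cod C g = B"
    using f g by (auto simp: in_Hom)
  interpret BB: comm_group "P B B" by (rule PD(1)[OF AB(2,2)])
  interpret TB: comm_group "P T B" by (rule PD(1)[OF ST(1) AB(2)])
  \<comment> \<open>The codiagonal, formed with the addition of P, whereas S is a biproduct for the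
    chosen addition.\<close>
  define d where "d = pr1 S \<otimes>\<^bsub>P T B\<^esub> pr2 S"
  have "d \<in> carrier (P T B)"
    using TB.m_closed[of "pr1 S" "pr2 S"] PD(2)[OF ST(1) AB(2)] by (simp add: d_def in_Hom)
  then have [simp]: "d \<in> Arr C" "Dom C d = T" "Cod C d = B"
    using PD(2)[OF ST(1) AB(2)] by (auto simp: in_Hom)
  have d: "d \<cdot> u = (pr1 S \<cdot> u) \<otimes>\<^bsub>P K B\<^esub> (pr2 S \<cdot> u)"
    if "u \<in> Arr C" "Dom C u = K" "Cod C u = T" for u K
  proof -
    have "(\<lambda>g. g \<cdot> u) \<in> hom (P T B) (P K B)"
      using that AB by (intro PD(4)) (auto simp: in_Hom)
    from hom_mult[OF this, of "pr1 S" "pr2 S"] show ?thesis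
      using PD(2)[OF ST(1) AB(2)] by (simp add: d_def in_Hom)
  qed
  have I: "Ident C B \<in> carrier (P B B)"
    using PD(2)[OF AB(2,2)] AB by (simp add: in_Hom)
  have z: "hzero C B B = \<one>\<^bsub>P B B\<^esub>"
    using preadditive_structure_zero[OF P AB(2,2)] by simp
  have d1: "d \<cdot> in1 S = Ident C B"
    using d[of "in1 S" B] ST(14,17) I z by simp
  have d2: "d \<cdot> in2 S = Ident C B"
    using d[of "in2 S" B] ST(15,16) I z by simp
  \<comment> \<open>Decomposing the identity of \<open>bobj S\<close> involves the chosen addition;
    as d restricts to the identity on both summands, it equals the codiagonal formed with that
    addition.\<close>
  have "d = d \<cdot> hadd C (in1 S \<cdot> pr1 S) (in2 S \<cdot> pr2 S)"
    unfolding ST(18) by simp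
  also have "\<dots> = hadd C ((d \<cdot> in1 S) \<cdot> pr1 S) ((d \<cdot> in2 S) \<cdot> pr2 S)"
    by simp
  also have "\<dots> = hadd C (pr1 S) (pr2 S)"
    unfolding d1 d2 by simp
  finally have dd: "d = hadd C (pr1 S) (pr2 S)" .
  define u where "u = hadd C (in1 S \<cdot> f) (in2 S \<cdot> g)"
  have [simp]: "u \<in> Arr C" "Dom C u = A" "Cod C u = T"
    by (auto simp: u_def)
  have "pr1 S \<cdot> u = hadd C ((pr1 S \<cdot> in1 S) \<cdot> f) ((pr1 S \<cdot> in2 S) \<cdot> g)"
    by (simp add: u_def)
  then have u1: "pr1 S \<cdot> u = f"
    unfolding ST(14,16) using AB by simp
  have "pr2 S \<cdot> u = hadd C ((pr2 S \<cdot> in1 S) \<cdot> f) ((pr2 S \<cdot> in2 S) \<cdot> g)"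
    by (simp add: u_def)
  then have u2: "pr2 S \<cdot> u = g"
    unfolding ST(15,17) using AB by simp
  have "f \<otimes>\<^bsub>P A B\<^esub> g = d \<cdot> u"
    using d[of u A] u1 u2 by simp
  also have "\<dots> = hadd C f g"
    unfolding dd using u1 u2 by simp
  finally show ?thesis .
qed

section \<open>Additive and fully faithful functors\<close>

context cfunctor
begin

lemma fmap_simps [simp]:
  assumes "f \<in> Arr C"
  shows "fmap F f \<in> Arr D" "Dom D (fmap F f) = fobj F (Dom C f)" "Cod D (fmap F f) = fobj F (Cod C f)"
  using fmap[of f "Dom C f" "Cod C f"] assms by (auto simp: in_Hom)

lemma fmap_comp' [simp]:
  "f \<in> Arr C \<Longrightarrow> g \<in> Arr C \<Longrightarrow> Cod C f = Dom C g \<Longrightarrow> fmap F (g \<cdot>\<^bsub>C\<^esub> f) = fmap F g \<cdot>\<^bsub>D\<^esub> fmap F f"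
  by (rule fmap_comp) (auto simp: in_Hom)

lemmas [simp] = fobj fmap_ident

end

text \<open>Refers to the chosen groups of two merely preadditive categories, since additivity of
  the functors enters before \<open>C'\<close> is known to have biproducts.\<close>

locale preadditive_functor = cfunctor C D F + C: preadditive_category C + D: preadditive_category D
  for C :: "('o, 'm) cat" and D :: "('p, 'q) cat" and F :: "('o, 'm, 'p, 'q) func" +
  assumes fmap_hadd [simp]: "f \<in> Arr C \<Longrightarrow> g \<in> Arr C \<Longrightarrow> Dom C f = Dom C g \<Longrightarrow> Cod C f = Cod C g
    \<Longrightarrow> fmap F (hadd C f g) = hadd D (fmap F f) (fmap F g)"
begin

lemma fmap_hzero [simp]:
  assumes "A \<in> Obj C" "B \<in> Obj C"
  shows "fmap F (hzero C A B) = hzero D (fobj F A) (fobj F B)"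
  using D.zero_unique[of "fmap F (hzero C A B)"] fmap_hadd[of "hzero C A B" "hzero C A B"] assms
  by simp

lemma fmap_hneg [simp]:
  assumes "f \<in> Arr C"
  shows "fmap F (hneg C f) = hneg D (fmap F f)"
proof (rule D.hneg_unique)
  show "hadd D (fmap F (hneg C f)) (fmap F f) = hzero D (Dom D (fmap F f)) (Cod D (fmap F f))"
    using assms by (subst fmap_hadd[symmetric]) auto
qed (use assms in auto)

end

locale fully_faithful_functor = cfunctor C D F
  for C :: "('o, 'm) cat" and D :: "('p, 'q) cat" and F :: "('o, 'm, 'p, 'q) func" +
  assumes bij_fmap: "A \<in> Obj C \<Longrightarrow> B \<in> Obj C
    \<Longrightarrow> bij_betw (fmap F) (Hom C A B) (Hom D (fobj F A) (fobj F B))"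
begin

lemma fmap_cancel:
  assumes "fmap F f = fmap F g" "f \<in> Arr C" "g \<in> Arr C" "Dom C f = Dom C g" "Cod C f = Cod C g"
  shows "f = g"
  using bij_fmap[of "Dom C g" "Cod C g"] assms by (auto simp: bij_betw_def inj_on_def in_Hom)

lemma fmap_full:
  assumes "u \<in> Hom D (fobj F A) (fobj F B)" "A \<in> Obj C" "B \<in> Obj C"
  shows "\<exists>f \<in> Hom C A B. fmap F f = u"
  using bij_fmap[OF assms(2,3)] assms(1) unfolding bij_betw_def by (metis imageE)

text \<open>A functor need not be injective on objects, so source and target of the preimage are
  arguments. Within that hom-set the preimage is unique.\<close>

definition lift :: "'o \<Rightarrow> 'o \<Rightarrow> 'q \<Rightarrow> 'm" where
  "lift A B u = (SOME f. f \<in> Hom C A B \<and> fmap F f = u)"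

lemma lift:
  assumes "u \<in> Arr D" "Dom D u = fobj F A" "Cod D u = fobj F B" "A \<in> Obj C" "B \<in> Obj C"
  shows "lift A B u \<in> Arr C" "Dom C (lift A B u) = A" "Cod C (lift A B u) = B"
    "fmap F (lift A B u) = u"
proof -
  have "\<exists>f. f \<in> Hom C A B \<and> fmap F f = u"
    using fmap_full[of u A B] assms by (auto simp: in_Hom)
  then have "lift A B u \<in> Hom C A B \<and> fmap F (lift A B u) = u"
    unfolding lift_def by (rule someI_ex)
  then show "lift A B u \<in> Arr C" "Dom C (lift A B u) = A" "Cod C (lift A B u) = B"
    "fmap F (lift A B u) = u"
    by (auto simp: in_Hom)
qed

definition pullback_structure :: "('p \<Rightarrow> 'p \<Rightarrow> 'q monoid) \<Rightarrow> 'o \<Rightarrow> 'o \<Rightarrow> 'm monoid" where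
  "pullback_structure P A B = \<lparr>carrier = Hom C A B,
     mult = (\<lambda>f g. lift A B (fmap F f \<otimes>\<^bsub>P (fobj F A) (fobj F B)\<^esub> fmap F g)),
     one = lift A B \<one>\<^bsub>P (fobj F A) (fobj F B)\<^esub>\<rparr>"

text \<open>Every hom-set of C is in bijection with one of D, so the group laws and the bilinearity
  of composition hold because they hold after applying F. The second part records that F is additive
  for the structure so obtained.\<close>

lemma pullback_structure:
  assumes P: "preadditive_structure D P"
  shows "preadditive_structure C (pullback_structure P)"
    and "A \<in> Obj C \<Longrightarrow> B \<in> Obj C \<Longrightarrow> f \<in> Hom C A B \<Longrightarrow> g \<in> Hom C A B \<Longrightarrow>
      fmap F (f \<otimes>\<^bsub>pullback_structure P A B\<^esub> g) = fmap F f \<otimes>\<^bsub>P (fobj F A) (fobj F B)\<^esub> fmap F g"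
proof -
  note PD = preadditive_structureD[OF P]
  let ?Q = "pullback_structure P"
  have Q [simp]: "carrier (?Q A B) = Hom C A B" for A B
    by (simp add: pullback_structure_def)
  have mult: "f \<otimes>\<^bsub>?Q A B\<^esub> g \<in> Hom C A B"
    "fmap F (f \<otimes>\<^bsub>?Q A B\<^esub> g) = fmap F f \<otimes>\<^bsub>P (fobj F A) (fobj F B)\<^esub> fmap F g"
    if "A \<in> Obj C" "B \<in> Obj C" "f \<in> Hom C A B" "g \<in> Hom C A B" for A B f g
  proof -
    interpret G: comm_group "P (fobj F A) (fobj F B)"
      by (rule PD(1)) (use that in auto)
    have "fmap F f \<otimes>\<^bsub>P (fobj F A) (fobj F B)\<^esub> fmap F g \<in> Hom D (fobj F A) (fobj F B)"
      using G.m_closed[of "fmap F f" "fmap F g"] that by (simp add: PD(2) in_Hom)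
    then show "f \<otimes>\<^bsub>?Q A B\<^esub> g \<in> Hom C A B"
      "fmap F (f \<otimes>\<^bsub>?Q A B\<^esub> g) = fmap F f \<otimes>\<^bsub>P (fobj F A) (fobj F B)\<^esub> fmap F g"
      using that lift[of "fmap F f \<otimes>\<^bsub>P (fobj F A) (fobj F B)\<^esub> fmap F g" A B]
      by (auto simp: pullback_structure_def in_Hom)
  qed
  show "A \<in> Obj C \<Longrightarrow> B \<in> Obj C \<Longrightarrow> f \<in> Hom C A B \<Longrightarrow> g \<in> Hom C A B \<Longrightarrow>
      fmap F (f \<otimes>\<^bsub>?Q A B\<^esub> g) = fmap F f \<otimes>\<^bsub>P (fobj F A) (fobj F B)\<^esub> fmap F g"
    by (rule mult)
  have one: "\<one>\<^bsub>?Q A B\<^esub> \<in> Hom C A B" "fmap F \<one>\<^bsub>?Q A B\<^esub> = \<one>\<^bsub>P (fobj F A) (fobj F B)\<^esub>"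
    if "A \<in> Obj C" "B \<in> Obj C" for A B
  proof -
    interpret G: comm_group "P (fobj F A) (fobj F B)"
      by (rule PD(1)) (use that in auto)
    show "\<one>\<^bsub>?Q A B\<^esub> \<in> Hom C A B" "fmap F \<one>\<^bsub>?Q A B\<^esub> = \<one>\<^bsub>P (fobj F A) (fobj F B)\<^esub>"
      using G.one_closed that lift[of "\<one>\<^bsub>P (fobj F A) (fobj F B)\<^esub>" A B]
      by (auto simp: pullback_structure_def in_Hom PD(2))
  qed
  have eq: "f = g" if "f \<in> Hom C A B" "g \<in> Hom C A B" "fmap F f = fmap F g" for A B f g
    using fmap_cancel[OF that(3)] that(1,2) by (simp add: in_Hom)
  have group: "comm_group (?Q A B)" if AB: "A \<in> Obj C" "B \<in> Obj C" for A B
  proof -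
    interpret G: comm_group "P (fobj F A) (fobj F B)"
      by (rule PD(1)) (use AB in auto)
    have c: "carrier (P (fobj F A) (fobj F B)) = Hom D (fobj F A) (fobj F B)"
      using AB by (simp add: PD(2))
    have c' [simp]: "fmap F f \<in> carrier (P (fobj F A) (fobj F B))" if "f \<in> Hom C A B" for f
      using that by (simp add: c in_Hom)
    show ?thesis
    proof (rule comm_groupI, unfold Q)
      fix f g assume fg: "f \<in> Hom C A B" "g \<in> Hom C A B"
      show "f \<otimes>\<^bsub>?Q A B\<^esub> g \<in> Hom C A B"
        by (rule mult(1)[OF AB fg])
      show "f \<otimes>\<^bsub>?Q A B\<^esub> g = g \<otimes>\<^bsub>?Q A B\<^esub> f"
        by (rule eq[of _ A B]) (use fg AB mult in \<open>auto intro: G.m_comm\<close>)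
      fix h assume h: "h \<in> Hom C A B"
      show "f \<otimes>\<^bsub>?Q A B\<^esub> g \<otimes>\<^bsub>?Q A B\<^esub> h = f \<otimes>\<^bsub>?Q A B\<^esub> (g \<otimes>\<^bsub>?Q A B\<^esub> h)"
        by (rule eq[of _ A B]) (use fg h AB mult in \<open>auto simp: G.m_assoc\<close>)
    next
      show "\<one>\<^bsub>?Q A B\<^esub> \<in> Hom C A B"
        by (rule one(1)[OF AB])
    next
      fix f assume f: "f \<in> Hom C A B"
      show "\<one>\<^bsub>?Q A B\<^esub> \<otimes>\<^bsub>?Q A B\<^esub> f = f"
        by (rule eq[of _ A B]) (use f AB mult one in auto)
      have "inv\<^bsub>P (fobj F A) (fobj F B)\<^esub> fmap F f \<in> Hom D (fobj F A) (fobj F B)"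
        using G.inv_closed[OF c'[OF f]] c by simp
      then obtain g where g: "g \<in> Hom C A B" "fmap F g = inv\<^bsub>P (fobj F A) (fobj F B)\<^esub> fmap F f"
        using fmap_full AB by blast
      have "g \<otimes>\<^bsub>?Q A B\<^esub> f = \<one>\<^bsub>?Q A B\<^esub>"
        by (rule eq[of _ A B]) (use f g AB mult one in auto)
      then show "\<exists>g \<in> Hom C A B. g \<otimes>\<^bsub>?Q A B\<^esub> f = \<one>\<^bsub>?Q A B\<^esub>"
        using g(1) by blast
    qed
  qed
  show "preadditive_structure C ?Q"
    unfolding preadditive_structure_def
  proof (intro conjI ballI)
    fix A B K g assume O: "A \<in> Obj C" "B \<in> Obj C" "K \<in> Obj C" and g: "g \<in> Hom C B K"
    have h: "(\<lambda>f. fmap F g \<cdot>\<^bsub>D\<^esub> f) \<in> hom (P (fobj F A) (fobj F B)) (P (fobj F A) (fobj F K))"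
      by (rule PD(3)) (use O g in \<open>auto simp: in_Hom\<close>)
    show "(\<lambda>f. g \<cdot>\<^bsub>C\<^esub> f) \<in> hom (?Q A B) (?Q A K)"
    proof (rule homI, unfold Q)
      fix f f' assume f: "f \<in> Hom C A B" "f' \<in> Hom C A B"
      show gf: "g \<cdot>\<^bsub>C\<^esub> f \<in> Hom C A K"
        using f(1) g by (rule C.comp)
      have gf': "g \<cdot>\<^bsub>C\<^esub> f' \<in> Hom C A K"
        using f(2) g by (rule C.comp)
      note m = mult(1)[OF O(1,2) f]
      have c: "fmap F f \<in> carrier (P (fobj F A) (fobj F B))" "fmap F f' \<in> carrier (P (fobj F A) (fobj F B))"
        using f O by (auto simp: PD(2) in_Hom)
      show "g \<cdot>\<^bsub>C\<^esub> (f \<otimes>\<^bsub>?Q A B\<^esub> f') = g \<cdot>\<^bsub>C\<^esub> f \<otimes>\<^bsub>?Q A K\<^esub> (g \<cdot>\<^bsub>C\<^esub> f')"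
      proof (rule eq)
        show "g \<cdot>\<^bsub>C\<^esub> (f \<otimes>\<^bsub>?Q A B\<^esub> f') \<in> Hom C A K"
          using m g by (rule C.comp)
        show "g \<cdot>\<^bsub>C\<^esub> f \<otimes>\<^bsub>?Q A K\<^esub> (g \<cdot>\<^bsub>C\<^esub> f') \<in> Hom C A K"
          using mult(1)[OF O(1,3) gf gf'] .
        show "fmap F (g \<cdot>\<^bsub>C\<^esub> (f \<otimes>\<^bsub>?Q A B\<^esub> f')) = fmap F (g \<cdot>\<^bsub>C\<^esub> f \<otimes>\<^bsub>?Q A K\<^esub> (g \<cdot>\<^bsub>C\<^esub> f'))"
          unfolding mult(2)[OF O(1,3) gf gf'] fmap_comp[OF m g] fmap_comp[OF f(1) g]
            fmap_comp[OF f(2) g] mult(2)[OF O(1,2) f]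
          using hom_mult[OF h c] .
      qed
    qed
  next
    fix A B K f assume O: "A \<in> Obj C" "B \<in> Obj C" "K \<in> Obj C" and f: "f \<in> Hom C A B"
    have h: "(\<lambda>g. g \<cdot>\<^bsub>D\<^esub> fmap F f) \<in> hom (P (fobj F B) (fobj F K)) (P (fobj F A) (fobj F K))"
      by (rule PD(4)) (use O f in \<open>auto simp: in_Hom\<close>)
    show "(\<lambda>g. g \<cdot>\<^bsub>C\<^esub> f) \<in> hom (?Q B K) (?Q A K)"
    proof (rule homI, unfold Q)
      fix g g' assume g: "g \<in> Hom C B K" "g' \<in> Hom C B K"
      show gf: "g \<cdot>\<^bsub>C\<^esub> f \<in> Hom C A K"
        using f g(1) by (rule C.comp)
      have gf': "g' \<cdot>\<^bsub>C\<^esub> f \<in> Hom C A K"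
        using f g(2) by (rule C.comp)
      note m = mult(1)[OF O(2,3) g]
      have c: "fmap F g \<in> carrier (P (fobj F B) (fobj F K))" "fmap F g' \<in> carrier (P (fobj F B) (fobj F K))"
        using g O by (auto simp: PD(2) in_Hom)
      show "(g \<otimes>\<^bsub>?Q B K\<^esub> g') \<cdot>\<^bsub>C\<^esub> f = g \<cdot>\<^bsub>C\<^esub> f \<otimes>\<^bsub>?Q A K\<^esub> (g' \<cdot>\<^bsub>C\<^esub> f)"
      proof (rule eq)
        show "(g \<otimes>\<^bsub>?Q B K\<^esub> g') \<cdot>\<^bsub>C\<^esub> f \<in> Hom C A K"
          using f m by (rule C.comp)
        show "g \<cdot>\<^bsub>C\<^esub> f \<otimes>\<^bsub>?Q A K\<^esub> (g' \<cdot>\<^bsub>C\<^esub> f) \<in> Hom C A K"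
          using mult(1)[OF O(1,3) gf gf'] .
        show "fmap F ((g \<otimes>\<^bsub>?Q B K\<^esub> g') \<cdot>\<^bsub>C\<^esub> f) = fmap F (g \<cdot>\<^bsub>C\<^esub> f \<otimes>\<^bsub>?Q A K\<^esub> (g' \<cdot>\<^bsub>C\<^esub> f))"
          unfolding mult(2)[OF O(1,3) gf gf'] fmap_comp[OF f m] fmap_comp[OF f g(1)]
            fmap_comp[OF f g(2)] mult(2)[OF O(2,3) g]
          using hom_mult[OF h c] .
      qed
    qed
  qed (use group in auto)
qed

text \<open>Applied to a quasi-inverse, this endows a bare category equivalent to a preadditive one
  with an addition.\<close>

lemma preadditive_source:
  assumes "preadditive_category D"
  shows "preadditive_category C"
  using pullback_structure(1)[OF preadditive_category.structure_hom_group[OF assms]]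
  by (intro preadditive_category.intro C.category_axioms preadditive_category_axioms.intro exI)

text \<open>The addition on D may be any preadditive structure that happened to be chosen. Its
  pull-back along F is a preadditive structure on C, and C, having biproducts, admits only one
  addition, so F respects the chosen additions.\<close>

lemma preadditive_functor_additive_source:
  assumes C: "additive_category C" and D: "preadditive_category D"
  shows "preadditive_functor C D F"
proof -
  interpret C: additive_category C by (rule C)
  interpret D: preadditive_category D by (rule D)
  show ?thesis
  proof unfold_locales
    fix f g assume fg: "f \<in> Arr C" "g \<in> Arr C" "Dom C f = Dom C g" "Cod C f = Cod C g"
    let ?P = "pullback_structure (hom_group D)"
    note P = pullback_structure[OF D.structure_hom_group]
    have H: "f \<in> Hom C (Dom C g) (Cod C g)" "g \<in> Hom C (Dom C g) (Cod C g)"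
      using fg by (auto simp: in_Hom)
    have "hadd C f g = f \<otimes>\<^bsub>?P (Dom C g) (Cod C g)\<^esub> g"
      by (rule C.preadditive_structure_unique[OF P(1) _ _ H, symmetric]) (use fg in auto)
    then show "fmap F (hadd C f g) = hadd D (fmap F f) (fmap F g)"
      using P(2)[OF _ _ H] fg by (simp add: hadd_def)
  qed
qed

end

section \<open>Transport along a fully faithful, essentially surjective functor\<close>

text \<open>Turns a universal property into one equation between morphisms, which additive functors
  preserve and faithful additive functors reflect.\<close>

lemma (in preadditive_category) zero_object_iff:
  "zero_object C Z \<longleftrightarrow> Z \<in> Obj C \<and> Ident C Z = hzero C Z Z"
proof
  assume "zero_object C Z"
  then show "Z \<in> Obj C \<and> Ident C Z = hzero C Z Z"
    unfolding zero_object_def by (metis ident hzero_simps in_Hom)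
next
  assume Z: "Z \<in> Obj C \<and> Ident C Z = hzero C Z Z"
  have "f = hzero C Z A" if "f \<in> Hom C Z A" "A \<in> Obj C" for f A
    using that Z comp_ident(2)[of f Z] by (auto simp: in_Hom simp del: comp_ident)
  moreover have "f = hzero C A Z" if "f \<in> Hom C A Z" "A \<in> Obj C" for f A
    using that Z comp_ident(1)[of f Z] by (auto simp: in_Hom simp del: comp_ident)
  moreover have "hzero C Z A \<in> Hom C Z A" "hzero C A Z \<in> Hom C A Z" if "A \<in> Obj C" for A
    using that Z by (auto simp: in_Hom)
  ultimately show "zero_object C Z"
    unfolding zero_object_def using Z by blast
qed

section \<open>Complexes and homotopies under an additive functor\<close>

lemma map_cpx_simps [simp]:
  "cobj (map_cpx F X) i = fobj F (cobj X i)" "diff (map_cpx F X) i = fmap F (diff X i)"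
  by (simp_all add: map_cpx_def)

lemma homotopic_cong:
  assumes "\<And>i. i \<le> Suc n \<Longrightarrow> f i = f' i" "\<And>i. i \<le> Suc n \<Longrightarrow> g i = g' i"
  shows "homotopic n C X Y f g \<longleftrightarrow> homotopic n C X Y f' g'"
  unfolding homotopic_iff using assms by (auto cong: conj_cong)

context preadditive_functor
begin

lemma map_complex:
  assumes "X \<in> complexes n C"
  shows "map_cpx F X \<in> complexes n D"
proof -
  note XD = complexesD[OF assms]
  have "fmap F (diff X (Suc i)) \<cdot>\<^bsub>D\<^esub> fmap F (diff X i) =
      hzero D (fobj F (cobj X i)) (fobj F (cobj X (Suc (Suc i))))" if "i < n" for i
    using fmap_comp'[of "diff X i" "diff X (Suc i)"] that by (simp add: XD)
  then show ?thesis
    by (auto simp: complexes_def in_Hom XD)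
qed

lemma map_chain_map:
  assumes "X \<in> complexes n C" "Y \<in> complexes n C" "chain_map n C X Y f"
  shows "chain_map n D (map_cpx F X) (map_cpx F Y) (\<lambda>i. fmap F (f i))"
proof -
  note D = chain_mapD[OF assms(3)] complexesD[OF assms(1)] complexesD[OF assms(2)]
  have "fmap F (f (Suc i)) \<cdot>\<^bsub>D\<^esub> fmap F (diff X i) = fmap F (diff Y i) \<cdot>\<^bsub>D\<^esub> fmap F (f i)"
    if "i \<le> n" for i
    using fmap_comp'[of "diff X i" "f (Suc i)"] fmap_comp'[of "f i" "diff Y i"] that by (simp add: D)
  then show ?thesis
    by (auto simp: chain_map_def in_Hom D)
qed

lemma map_end_fixing:
  assumes "X \<in> complexes n C" "Y \<in> complexes n C" "end_fixing n C X Y f"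
  shows "end_fixing n D (map_cpx F X) (map_cpx F Y) (\<lambda>i. fmap F (f i))"
  using map_chain_map[OF assms(1,2)] end_fixingD[OF assms(3)] complexesD(1)[OF assms(1)]
  by (auto simp: end_fixing_def)

lemma map_homotopic:
  assumes X: "X \<in> complexes n C" and Y: "Y \<in> complexes n C"
    and g: "chain_map n C X Y g" and fg: "homotopic n C X Y f g"
  shows "homotopic n D (map_cpx F X) (map_cpx F Y) (\<lambda>i. fmap F (f i)) (\<lambda>i. fmap F (g i))"
proof -
  obtain k where k: "\<And>i. i \<le> n \<Longrightarrow> k i \<in> Hom C (cobj X (Suc i)) (cobj Y i)"
     "f 0 = hadd C (g 0) (k 0 \<cdot>\<^bsub>C\<^esub> diff X 0)"
     "\<And>i. i < n \<Longrightarrow> f (Suc i) = hadd C (g (Suc i))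
        (hadd C (diff Y i \<cdot>\<^bsub>C\<^esub> k i) (k (Suc i) \<cdot>\<^bsub>C\<^esub> diff X (Suc i)))"
     "f (Suc n) = hadd C (g (Suc n)) (diff Y n \<cdot>\<^bsub>C\<^esub> k n)"
    using fg unfolding homotopic_iff by blast
  have kT: "k i \<in> Arr C" "Dom C (k i) = cobj X (Suc i)" "Cod C (k i) = cobj Y i" if "i \<le> n" for i
    using k(1)[OF that] by (auto simp: in_Hom)
  note [simp] = kT complexesD[OF X] complexesD[OF Y] chain_mapD(1-3)[OF g]
  show ?thesis
    unfolding homotopic_iff
    by (rule exI[of _ "\<lambda>i. fmap F (k i)"]) (auto simp: k(2-) in_Hom)
qed

end

locale fully_faithful_preadditive_functor = preadditive_functor C D F + fully_faithful_functor C D F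
  for C :: "('o, 'm) cat" and D :: "('p, 'q) cat" and F :: "('o, 'm, 'p, 'q) func"
begin

lemma lift_chain_map:
  assumes X: "X \<in> complexes n C" and Y: "Y \<in> complexes n C"
    and u: "chain_map n D (map_cpx F X) (map_cpx F Y) u"
  obtains f where "chain_map n C X Y f" "\<And>i. i \<le> Suc n \<Longrightarrow> fmap F (f i) = u i"
proof -
  define f where "f i = lift (cobj X i) (cobj Y i) (u i)" for i
  note [simp] = complexesD[OF X] complexesD[OF Y] chain_mapD(1-3)[OF u, simplified]
  have f [simp]: "f i \<in> Arr C" "Dom C (f i) = cobj X i" "Cod C (f i) = cobj Y i" "fmap F (f i) = u i"
    if "i \<le> Suc n" for i
    using lift[of "u i" "cobj X i" "cobj Y i"] that by (auto simp: f_def)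
  have "chain_map n C X Y f"
    unfolding chain_map_def
  proof (intro conjI allI impI)
    fix i assume "i \<le> n"
    then show "f (i + 1) \<cdot>\<^bsub>C\<^esub> diff X i = diff Y i \<cdot>\<^bsub>C\<^esub> f i"
      using chain_mapD(4)[OF u] by (intro fmap_cancel) auto
  qed (auto simp: in_Hom)
  then show ?thesis
    using f(4) that by blast
qed

text \<open>The equality of the end terms is an assumption because F may identify distinct objects,
  so that it cannot be read off from the images.\<close>

lemma lift_end_fixing:
  assumes X: "X \<in> complexes n C" and Y: "Y \<in> complexes n C"
    and u: "end_fixing n D (map_cpx F X) (map_cpx F Y) u"
    and ends: "cobj Y 0 = cobj X 0" "cobj Y (Suc n) = cobj X (Suc n)"
  obtains f where "end_fixing n C X Y f" "\<And>i. i \<le> Suc n \<Longrightarrow> fmap F (f i) = u i"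
proof -
  note uD = end_fixingD[OF u]
  obtain f where f: "chain_map n C X Y f" "\<And>i. i \<le> Suc n \<Longrightarrow> fmap F (f i) = u i"
    using lift_chain_map[OF X Y uD(1)] by blast
  note [simp] = complexesD[OF X] complexesD[OF Y] chain_mapD(1-3)[OF f(1)] f(2) ends
  have "f 0 = Ident C (cobj X 0)" "f (Suc n) = Ident C (cobj X (Suc n))"
    using uD(2,3) by (auto intro!: fmap_cancel)
  then show ?thesis
    using f that by (auto simp: end_fixing_def)
qed

lemma lift_homotopic:
  assumes X: "X \<in> complexes n C" and Y: "Y \<in> complexes n C"
    and f: "chain_map n C X Y f" and g: "chain_map n C X Y g"
    and fg: "homotopic n D (map_cpx F X) (map_cpx F Y) (\<lambda>i. fmap F (f i)) (\<lambda>i. fmap F (g i))"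
  shows "homotopic n C X Y f g"
proof -
  obtain k where k: "\<And>i. i \<le> n \<Longrightarrow> k i \<in> Hom D (fobj F (cobj X (Suc i))) (fobj F (cobj Y i))"
     "fmap F (f 0) = hadd D (fmap F (g 0)) (k 0 \<cdot>\<^bsub>D\<^esub> fmap F (diff X 0))"
     "\<And>i. i < n \<Longrightarrow> fmap F (f (Suc i)) = hadd D (fmap F (g (Suc i)))
        (hadd D (fmap F (diff Y i) \<cdot>\<^bsub>D\<^esub> k i) (k (Suc i) \<cdot>\<^bsub>D\<^esub> fmap F (diff X (Suc i))))"
     "fmap F (f (Suc n)) = hadd D (fmap F (g (Suc n))) (fmap F (diff Y n) \<cdot>\<^bsub>D\<^esub> k n)"
    using fg unfolding homotopic_iff by auto
  define l where "l i = lift (cobj X (Suc i)) (cobj Y i) (k i)" for i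
  note [simp] = complexesD[OF X] complexesD[OF Y] chain_mapD(1-3)[OF f] chain_mapD(1-3)[OF g]
  have l [simp]: "l i \<in> Arr C" "Dom C (l i) = cobj X (Suc i)" "Cod C (l i) = cobj Y i"
    "fmap F (l i) = k i" if "i \<le> n" for i
    using lift[of "k i" "cobj X (Suc i)" "cobj Y i"] that k(1)[OF that] by (auto simp: l_def in_Hom)
  show ?thesis
    unfolding homotopic_iff
    by (rule exI[of _ l]) (auto simp: k(2-) in_Hom intro!: fmap_cancel)
qed

text \<open>A homotopy consists of finitely many morphisms subject to additive equations, so an
  additive functor maps it and a fully faithful one lifts it componentwise.\<close>

lemma homotopy_equivalent_map_iff:
  assumes X: "X \<in> complexes n C" and Y: "Y \<in> complexes n C"
    and ends: "cobj Y 0 = cobj X 0" "cobj Y (Suc n) = cobj X (Suc n)"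
  shows "homotopy_equivalent n C X Y \<longleftrightarrow> homotopy_equivalent n D (map_cpx F X) (map_cpx F Y)"
proof
  assume "homotopy_equivalent n C X Y"
  then obtain f g where f: "end_fixing n C X Y f" and g: "end_fixing n C Y X g"
    and gf: "homotopic n C X X (\<lambda>i. g i \<cdot>\<^bsub>C\<^esub> f i) (\<lambda>i. Ident C (cobj X i))"
    and fg: "homotopic n C Y Y (\<lambda>i. f i \<cdot>\<^bsub>C\<^esub> g i) (\<lambda>i. Ident C (cobj Y i))"
    unfolding homotopy_equivalent_def by blast
  note [simp] = complexesD(1)[OF X] complexesD(1)[OF Y] chain_mapD(1-3)[OF end_fixingD(1)[OF f]]
    chain_mapD(1-3)[OF end_fixingD(1)[OF g]]
  let ?f = "\<lambda>i. fmap F (f i)" and ?g = "\<lambda>i. fmap F (g i)"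
  have "homotopic n D (map_cpx F X) (map_cpx F X) (\<lambda>i. ?g i \<cdot>\<^bsub>D\<^esub> ?f i)
      (\<lambda>i. Ident D (cobj (map_cpx F X) i))"
    using map_homotopic[OF X X end_fixingD(1)[OF C.end_fixing_ident[OF X]] gf]
    by (rule iffD1[OF homotopic_cong, rotated -1]) auto
  moreover have "homotopic n D (map_cpx F Y) (map_cpx F Y) (\<lambda>i. ?f i \<cdot>\<^bsub>D\<^esub> ?g i)
      (\<lambda>i. Ident D (cobj (map_cpx F Y) i))"
    using map_homotopic[OF Y Y end_fixingD(1)[OF C.end_fixing_ident[OF Y]] fg]
    by (rule iffD1[OF homotopic_cong, rotated -1]) auto
  ultimately show "homotopy_equivalent n D (map_cpx F X) (map_cpx F Y)"
    unfolding homotopy_equivalent_def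
    using map_end_fixing[OF X Y f] map_end_fixing[OF Y X g] by blast
next
  assume "homotopy_equivalent n D (map_cpx F X) (map_cpx F Y)"
  then obtain u v where u: "end_fixing n D (map_cpx F X) (map_cpx F Y) u"
    and v: "end_fixing n D (map_cpx F Y) (map_cpx F X) v"
    and vu: "homotopic n D (map_cpx F X) (map_cpx F X) (\<lambda>i. v i \<cdot>\<^bsub>D\<^esub> u i)
      (\<lambda>i. Ident D (cobj (map_cpx F X) i))"
    and uv: "homotopic n D (map_cpx F Y) (map_cpx F Y) (\<lambda>i. u i \<cdot>\<^bsub>D\<^esub> v i)
      (\<lambda>i. Ident D (cobj (map_cpx F Y) i))"
    unfolding homotopy_equivalent_def by blast
  obtain f where f: "end_fixing n C X Y f" "\<And>i. i \<le> Suc n \<Longrightarrow> fmap F (f i) = u i"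
    using lift_end_fixing[OF X Y u ends] by blast
  obtain g where g: "end_fixing n C Y X g" "\<And>i. i \<le> Suc n \<Longrightarrow> fmap F (g i) = v i"
    using lift_end_fixing[OF Y X v ends[symmetric]] by blast
  note fc = end_fixingD(1)[OF f(1)] and gc = end_fixingD(1)[OF g(1)]
  note [simp] = complexesD(1)[OF X] complexesD(1)[OF Y] chain_mapD(1-3)[OF fc] chain_mapD(1-3)[OF gc]
  have "homotopic n D (map_cpx F X) (map_cpx F X) (\<lambda>i. fmap F (g i \<cdot>\<^bsub>C\<^esub> f i))
      (\<lambda>i. fmap F (Ident C (cobj X i)))"
    using vu by (rule iffD1[OF homotopic_cong, rotated -1]) (auto simp: f(2) g(2))
  then have "homotopic n C X X (\<lambda>i. g i \<cdot>\<^bsub>C\<^esub> f i) (\<lambda>i. Ident C (cobj X i))"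
    by (rule lift_homotopic[OF X X C.chain_map_comp[OF fc gc X Y X]
      end_fixingD(1)[OF C.end_fixing_ident[OF X]]])
  moreover have "homotopic n D (map_cpx F Y) (map_cpx F Y) (\<lambda>i. fmap F (f i \<cdot>\<^bsub>C\<^esub> g i))
      (\<lambda>i. fmap F (Ident C (cobj Y i)))"
    using uv by (rule iffD1[OF homotopic_cong, rotated -1]) (auto simp: f(2) g(2))
  then have "homotopic n C Y Y (\<lambda>i. f i \<cdot>\<^bsub>C\<^esub> g i) (\<lambda>i. Ident C (cobj Y i))"
    by (rule lift_homotopic[OF Y Y C.chain_map_comp[OF gc fc Y X Y]
      end_fixingD(1)[OF C.end_fixing_ident[OF Y]]])
  ultimately show "homotopy_equivalent n C X Y"
    unfolding homotopy_equivalent_def using f(1) g(1) by blast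
qed

text \<open>Homotopy classes are preimages of homotopy classes, cut down to the prescribed end
  terms. The transported realisation is defined in this shape.\<close>

lemma hclass_map:
  assumes X: "X \<in> complexes n C"
  shows "hclass n C X = {Y \<in> complexes_betw n C (cobj X 0) (cobj X (Suc n)).
     map_cpx F Y \<in> hclass n D (map_cpx F X)}"
proof -
  have "homotopy_equivalent n C X Y \<longleftrightarrow> map_cpx F Y \<in> hclass n D (map_cpx F X)"
    if Y: "Y \<in> complexes_betw n C (cobj X 0) (cobj X (Suc n))" for Y
    using homotopy_equivalent_map_iff[OF X, of Y] Y map_complex[of Y n]
    by (auto simp: hclass_def complexes_betw_def)
  then show ?thesis
    unfolding hclass_def[of n C] by auto
qed

section \<open>Zero objects, biproducts and exactness under a fully faithful functor\<close>

lemma reflect_zero_object: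
  assumes "zero_object D (fobj F Z)" "Z \<in> Obj C"
  shows "zero_object C Z"
  using assms unfolding C.zero_object_iff D.zero_object_iff by (auto intro!: fmap_cancel)

lemma map_zero_object: "zero_object C Z \<Longrightarrow> zero_object D (fobj F Z)"
  unfolding C.zero_object_iff D.zero_object_iff
  using fmap_ident[of Z] fmap_hzero[of Z Z] fobj[of Z] by metis

text \<open>S is a biproduct of images in D, and S' its copy in C on an object whose image is
  isomorphic to \<open>bobj S\<close> by p with inverse q. This is a relation in p and q, as these
  isomorphisms come with a lifted complex that has \<open>bobj S'\<close> as a term, and its
  differentials are conjugated by exactly these.\<close>

definition lifted_biproduct ::
    "'o \<Rightarrow> 'o \<Rightarrow> ('p, 'q) biprod \<Rightarrow> ('o, 'm) biprod \<Rightarrow> 'q \<Rightarrow> 'q \<Rightarrow> bool" where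
  "lifted_biproduct A B S S' p q \<longleftrightarrow>
     A \<in> Obj C \<and> B \<in> Obj C \<and> bobj S' \<in> Obj C \<and> is_biproduct D (fobj F A) (fobj F B) S \<and>
     p \<in> Hom D (bobj S) (fobj F (bobj S')) \<and> q \<in> Hom D (fobj F (bobj S')) (bobj S) \<and>
     q \<cdot>\<^bsub>D\<^esub> p = Ident D (bobj S) \<and> p \<cdot>\<^bsub>D\<^esub> q = Ident D (fobj F (bobj S')) \<and>
     in1 S' \<in> Hom C A (bobj S') \<and> in2 S' \<in> Hom C B (bobj S') \<and>
     pr1 S' \<in> Hom C (bobj S') A \<and> pr2 S' \<in> Hom C (bobj S') B \<and>
     fmap F (in1 S') = p \<cdot>\<^bsub>D\<^esub> in1 S \<and> fmap F (in2 S') = p \<cdot>\<^bsub>D\<^esub> in2 S \<and>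
     fmap F (pr1 S') = pr1 S \<cdot>\<^bsub>D\<^esub> q \<and> fmap F (pr2 S') = pr2 S \<cdot>\<^bsub>D\<^esub> q"

lemma is_biproductD:
  assumes "is_biproduct D A B S"
  shows "bobj S \<in> Obj D" "in1 S \<in> Arr D" "Dom D (in1 S) = A" "Cod D (in1 S) = bobj S"
    "in2 S \<in> Arr D" "Dom D (in2 S) = B" "Cod D (in2 S) = bobj S"
    "pr1 S \<in> Arr D" "Dom D (pr1 S) = bobj S" "Cod D (pr1 S) = A"
    "pr2 S \<in> Arr D" "Dom D (pr2 S) = bobj S" "Cod D (pr2 S) = B"
    "pr1 S \<cdot>\<^bsub>D\<^esub> in1 S = Ident D A" "pr2 S \<cdot>\<^bsub>D\<^esub> in2 S = Ident D B"
    "pr1 S \<cdot>\<^bsub>D\<^esub> in2 S = hzero D B A" "pr2 S \<cdot>\<^bsub>D\<^esub> in1 S = hzero D A B"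
    "hadd D (in1 S \<cdot>\<^bsub>D\<^esub> pr1 S) (in2 S \<cdot>\<^bsub>D\<^esub> pr2 S) = Ident D (bobj S)"
  using assms by (auto simp: is_biproduct_def in_Hom)

lemma lifted_biproduct_exists:
  assumes "A \<in> Obj C" "B \<in> Obj C" "P \<in> Obj C" "is_biproduct D (fobj F A) (fobj F B) S"
    "p \<in> Hom D (bobj S) (fobj F P)" "q \<in> Hom D (fobj F P) (bobj S)"
    "q \<cdot>\<^bsub>D\<^esub> p = Ident D (bobj S)" "p \<cdot>\<^bsub>D\<^esub> q = Ident D (fobj F P)"
  shows "\<exists>S'. lifted_biproduct A B S S' p q \<and> bobj S' = P"
proof -
  note S = is_biproductD[OF assms(4)]
  note [simp] = S(1-13) assms(1-3)
  have pq [simp]: "p \<in> Arr D" "Dom D p = bobj S" "Cod D p = fobj F P"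
    "q \<in> Arr D" "Dom D q = fobj F P" "Cod D q = bobj S"
    using assms(5,6) by (auto simp: in_Hom)
  let ?S = "\<lparr>bobj = P, in1 = lift A P (p \<cdot>\<^bsub>D\<^esub> in1 S), in2 = lift B P (p \<cdot>\<^bsub>D\<^esub> in2 S),
    pr1 = lift P A (pr1 S \<cdot>\<^bsub>D\<^esub> q), pr2 = lift P B (pr2 S \<cdot>\<^bsub>D\<^esub> q)\<rparr>"
  have "lifted_biproduct A B S ?S p q"
    unfolding lifted_biproduct_def using assms by (simp add: in_Hom lift)
  then show ?thesis
    by (intro exI[of _ ?S]) simp
qed

context
  fixes A B S S' p q
  assumes L: "lifted_biproduct A B S S' p q"
begin

lemma lifted_biproductD:
  "A \<in> Obj C" "B \<in> Obj C" "bobj S' \<in> Obj C"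
  "p \<in> Arr D" "Dom D p = bobj S" "Cod D p = fobj F (bobj S')"
  "q \<in> Arr D" "Dom D q = fobj F (bobj S')" "Cod D q = bobj S"
  "in1 S' \<in> Arr C" "Dom C (in1 S') = A" "Cod C (in1 S') = bobj S'"
  "in2 S' \<in> Arr C" "Dom C (in2 S') = B" "Cod C (in2 S') = bobj S'"
  "pr1 S' \<in> Arr C" "Dom C (pr1 S') = bobj S'" "Cod C (pr1 S') = A"
  "pr2 S' \<in> Arr C" "Dom C (pr2 S') = bobj S'" "Cod C (pr2 S') = B"
  "fmap F (in1 S') = p \<cdot>\<^bsub>D\<^esub> in1 S" "fmap F (in2 S') = p \<cdot>\<^bsub>D\<^esub> in2 S"
  "fmap F (pr1 S') = pr1 S \<cdot>\<^bsub>D\<^esub> q" "fmap F (pr2 S') = pr2 S \<cdot>\<^bsub>D\<^esub> q"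
  "q \<cdot>\<^bsub>D\<^esub> p = Ident D (bobj S)" "p \<cdot>\<^bsub>D\<^esub> q = Ident D (fobj F (bobj S'))"
  "is_biproduct D (fobj F A) (fobj F B) S"
  using L by (auto simp: lifted_biproduct_def in_Hom)

lemmas lifted_biproduct_rules = lifted_biproductD(1-25) is_biproductD(1-13)[OF lifted_biproductD(28)]

lemma lifted_biproduct_cancel:
  assumes "u \<in> Arr D" "Cod D u = bobj S"
  shows "q \<cdot>\<^bsub>D\<^esub> (p \<cdot>\<^bsub>D\<^esub> u) = u"
  using assms lifted_biproductD(26) D.comp_assoc[of u p q] lifted_biproduct_rules by simp

lemma lifted_biproduct_is_biproduct: "is_biproduct C A B S'"
proof -
  note [simp] = lifted_biproduct_rules lifted_biproduct_cancel
  note S = is_biproductD[OF lifted_biproductD(28)]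
  \<comment> \<open>The decomposition of the identity of \<open>bobj S\<close>, conjugated by p and
    q, is the image of the one wanted in C.\<close>
  have "p \<cdot>\<^bsub>D\<^esub> (hadd D (in1 S \<cdot>\<^bsub>D\<^esub> pr1 S) (in2 S \<cdot>\<^bsub>D\<^esub> pr2 S) \<cdot>\<^bsub>D\<^esub> q) = Ident D (fobj F (bobj S'))"
    unfolding S(18) by (simp add: lifted_biproductD(27))
  then have "fmap F (hadd C (in1 S' \<cdot>\<^bsub>C\<^esub> pr1 S') (in2 S' \<cdot>\<^bsub>C\<^esub> pr2 S')) = fmap F (Ident C (bobj S'))"
    by simp
  then have "hadd C (in1 S' \<cdot>\<^bsub>C\<^esub> pr1 S') (in2 S' \<cdot>\<^bsub>C\<^esub> pr2 S') = Ident C (bobj S')"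
    by (rule fmap_cancel) simp_all
  then show ?thesis
    unfolding is_biproduct_def using S(14-17) by (auto simp: in_Hom intro!: fmap_cancel)
qed

text \<open>Only the target of a column is a biproduct, hence only p enters; dually a row involves
  only q, and a matrix is conjugated on both sides.\<close>

lemma fmap_col:
  assumes "f \<in> Arr C" "g \<in> Arr C" "Dom C f = Dom C g" "Cod C f = A" "Cod C g = B"
  shows "fmap F (col C S' f g) = p \<cdot>\<^bsub>D\<^esub> col D S (fmap F f) (fmap F g)"
    "col C S' f g \<in> Arr C" "Dom C (col C S' f g) = Dom C g" "Cod C (col C S' f g) = bobj S'"
  using assms lifted_biproduct_rules by (simp_all add: col_def)

lemma fmap_row:
  assumes "f \<in> Arr C" "g \<in> Arr C" "Dom C f = A" "Dom C g = B" "Cod C f = Cod C g"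
  shows "fmap F (row C S' f g) = row D S (fmap F f) (fmap F g) \<cdot>\<^bsub>D\<^esub> q"
    "row C S' f g \<in> Arr C" "Dom C (row C S' f g) = bobj S'" "Cod C (row C S' f g) = Cod C g"
  using assms lifted_biproduct_rules by (simp_all add: row_def)

end

lemma fmap_matrix:
  assumes S: "lifted_biproduct A B S S' p q" and T: "lifted_biproduct A' B' T T' p' q'"
    and a: "a \<in> Hom C A A'" and b: "b \<in> Hom C B A'" and c: "c \<in> Hom C A B'" and d: "d \<in> Hom C B B'"
  shows "fmap F (matrix C S' T' a b c d) =
      p' \<cdot>\<^bsub>D\<^esub> matrix D S T (fmap F a) (fmap F b) (fmap F c) (fmap F d) \<cdot>\<^bsub>D\<^esub> q"
    "matrix C S' T' a b c d \<in> Arr C" "Dom C (matrix C S' T' a b c d) = bobj S'"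
    "Cod C (matrix C S' T' a b c d) = bobj T'"
proof -
  note [simp] = lifted_biproduct_rules[OF S] lifted_biproduct_rules[OF T]
  have [simp]: "a \<in> Arr C" "Dom C a = A" "Cod C a = A'" "b \<in> Arr C" "Dom C b = B" "Cod C b = A'"
    "c \<in> Arr C" "Dom C c = A" "Cod C c = B'" "d \<in> Arr C" "Dom C d = B" "Cod C d = B'"
    using a b c d by (auto simp: in_Hom)
  show "fmap F (matrix C S' T' a b c d) =
      p' \<cdot>\<^bsub>D\<^esub> matrix D S T (fmap F a) (fmap F b) (fmap F c) (fmap F d) \<cdot>\<^bsub>D\<^esub> q"
    by (simp add: matrix_def col_def row_def)
  show "matrix C S' T' a b c d \<in> Arr C" "Dom C (matrix C S' T' a b c d) = bobj S'"
    "Cod C (matrix C S' T' a b c d) = bobj T'"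
    by (simp_all add: matrix_def col_def row_def)
qed

text \<open>Image and kernel are compared inside the middle group, where b is injective. The third
  groups are compared only through which elements go to zero, which also covers the ends of the
  exangle sequences, where the third group consists of extensions.\<close>

lemma exact_at_reflect:
  fixes G H K G' H' K'
  assumes ex: "exact_at G' H' K' u' v'"
    and a: "a ` carrier G = carrier G'" and b: "bij_betw b (carrier H) (carrier H')"
    and u: "\<And>x. x \<in> carrier G \<Longrightarrow> u x \<in> carrier H \<and> b (u x) = u' (a x)"
    and v: "\<And>y. y \<in> carrier H \<Longrightarrow> v y = \<one>\<^bsub>K\<^esub> \<longleftrightarrow> v' (b y) = \<one>\<^bsub>K'\<^esub>"
  shows "exact_at G H K u v"
proof -
  have inj: "inj_on b (carrier H)" and im: "b ` carrier H = carrier H'"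
    using b by (auto simp: bij_betw_def)
  have "b ` u ` carrier G = u' ` a ` carrier G"
    using u by (auto simp: image_image intro!: image_cong)
  also have "\<dots> = kernel H' K' v'"
    using ex a by (simp add: exact_at_def)
  also have "\<dots> = b ` kernel H K v"
    unfolding kernel_def im[symmetric] using v by blast
  finally have "b ` u ` carrier G = b ` kernel H K v" .
  then show ?thesis
    unfolding exact_at_def using inj u
    by (subst (asm) inj_on_image_eq_iff[OF inj]) (auto simp: kernel_def)
qed

text \<open>Differentials are conjugated by the given isomorphisms; consecutive ones compose to p d
  d q = 0, since q p = 1 in between. The isomorphisms are arguments so that some can be prescribed
  as identities.\<close>

lemma lift_complex:
  assumes X: "X \<in> complexes n D"
    and P: "\<And>i. i \<le> Suc n \<Longrightarrow> P i \<in> Obj C"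
    and p: "\<And>i. i \<le> Suc n \<Longrightarrow> p i \<in> Hom D (cobj X i) (fobj F (P i))"
    and q: "\<And>i. i \<le> Suc n \<Longrightarrow> q i \<in> Hom D (fobj F (P i)) (cobj X i)"
    and qp: "\<And>i. i \<le> Suc n \<Longrightarrow> q i \<cdot>\<^bsub>D\<^esub> p i = Ident D (cobj X i)"
    and pq: "\<And>i. i \<le> Suc n \<Longrightarrow> p i \<cdot>\<^bsub>D\<^esub> q i = Ident D (fobj F (P i))"
  obtains X' where "X' \<in> complexes n C" "cobj X' = P"
    "\<And>i. i \<le> n \<Longrightarrow> fmap F (diff X' i) = p (Suc i) \<cdot>\<^bsub>D\<^esub> (diff X i \<cdot>\<^bsub>D\<^esub> q i)"
    "chain_map n D X (map_cpx F X') p" "chain_map n D (map_cpx F X') X q"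
proof -
  note [simp] = complexesD(1-4)[OF X] P D.complexes_comp_zero[OF X]
  have [simp]: "p i \<in> Arr D" "Dom D (p i) = cobj X i" "Cod D (p i) = fobj F (P i)"
    "q i \<in> Arr D" "Dom D (q i) = fobj F (P i)" "Cod D (q i) = cobj X i" if "i \<le> Suc n" for i
    using p q that by (auto simp: in_Hom)
  have cancel [simp]: "q i \<cdot>\<^bsub>D\<^esub> (p i \<cdot>\<^bsub>D\<^esub> u) = u"
    if "i \<le> Suc n" "u \<in> Arr D" "Cod D u = cobj X i" for i u
    using that qp[OF that(1)] D.comp_assoc[of u "p i" "q i"] by simp
  let ?d = "\<lambda>i. p (Suc i) \<cdot>\<^bsub>D\<^esub> (diff X i \<cdot>\<^bsub>D\<^esub> q i)"
  define X' where "X' = \<lparr>cobj = P, diff = \<lambda>i. lift (P i) (P (Suc i)) (?d i)\<rparr>"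
  have d [simp]: "diff X' i \<in> Arr C" "Dom C (diff X' i) = P i" "Cod C (diff X' i) = P (Suc i)"
    "fmap F (diff X' i) = ?d i" if "i \<le> n" for i
    using lift[of "?d i" "P i" "P (Suc i)"] that by (auto simp: X'_def)
  have [simp]: "cobj X' = P"
    by (simp add: X'_def)
  have "X' \<in> complexes n C"
    by (auto simp: complexes_def in_Hom intro!: fmap_cancel)
  moreover have "chain_map n D X (map_cpx F X') p" "chain_map n D (map_cpx F X') X q"
    using qp by (auto simp: chain_map_def in_Hom)
  ultimately show ?thesis
    using that[of X'] d(4) by simp
qed

end

lemma isomorphismE:
  assumes "isomorphism C A B f"
  obtains g where "f \<in> Hom C A B" "g \<in> Hom C B A" "g \<cdot>\<^bsub>C\<^esub> f = Ident C A" "f \<cdot>\<^bsub>C\<^esub> g = Ident C B"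
  using assms unfolding isomorphism_def by blast

lemma mapping_cone_iff:
  "mapping_cone n C X Y f M \<longleftrightarrow> (\<exists>B.
     (\<forall>i \<in> {1..n}. is_biproduct C (cobj X (Suc i)) (cobj Y i) (B i) \<and> cobj M i = bobj (B i)) \<and>
     cobj M 0 = cobj X 1 \<and> cobj M (Suc n) = cobj Y (Suc n) \<and>
     diff M 0 = col C (B 1) (hneg C (diff X 1)) (f 1) \<and>
     (\<forall>i \<in> {1..<n}. diff M i = matrix C (B i) (B (Suc i))
        (hneg C (diff X (Suc i))) (hzero C (cobj Y i) (cobj X (Suc (Suc i))))
        (f (Suc i)) (diff Y i)) \<and>
     diff M n = row C (B n) (f (Suc n)) (diff Y n))"
  by (simp add: mapping_cone_def)

section \<open>The transported structure\<close>

text \<open>Formulated with G alone: the structure on \<open>C'\<close> is built from the functor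
  back to \<open>C\<close>, while F enters only when it is shown to be exangulated. The zero object
  and the biproducts of \<open>C'\<close> are consequences.\<close>

locale exangulated_transport =
  S: n_exangulated_category n C E s + T: preadditive_category C' +
  G: fully_faithful_preadditive_functor C' C G
  for n :: nat and C :: "('o, 'm) cat" and E :: "('o, 'm, 'e) bifunctor"
    and s :: "('o, 'm, 'e) realis" and C' :: "('p, 'q) cat" and G :: "('p, 'q, 'o, 'm) func" +
  assumes n_pos: "n \<ge> 1"
    and essentially_surjective:
      "A \<in> Obj C \<Longrightarrow> \<exists>P \<in> Obj C'. \<exists>p. isomorphism C A (fobj G P) p"
begin

definition E' :: "('p, 'q, 'e) bifunctor" where
  "E' = \<lparr>egrp = (\<lambda>D A. egrp E (fobj G D) (fobj G A)), emap = (\<lambda>z x. emap E (fmap G z) (fmap G x))\<rparr>"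

text \<open>The ends are prescribed separately, since G may send different objects to the same
  one.\<close>

definition s' :: "('p, 'q, 'e) realis" where
  "s' D A \<delta> = {X \<in> complexes_betw n C' A D. map_cpx G X \<in> s (fobj G D) (fobj G A) \<delta>}"

lemma E'_simps [simp]:
  "egrp E' D A = egrp E (fobj G D) (fobj G A)"
  "emap E' z x = emap E (fmap G z) (fmap G x)"
  "D \<in> Obj C' \<Longrightarrow> push C' E' D x \<delta> = push C E (fobj G D) (fmap G x) \<delta>"
  "A \<in> Obj C' \<Longrightarrow> pull C' E' A z \<delta> = pull C E (fobj G A) (fmap G z) \<delta>"
  by (simp_all add: E'_def push_def pull_def)

lemma essentially_surjective':
  assumes "A \<in> Obj C"
  obtains P p q where "P \<in> Obj C'" "p \<in> Hom C A (fobj G P)" "q \<in> Hom C (fobj G P) A"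
    "q \<cdot>\<^bsub>C\<^esub> p = Ident C A" "p \<cdot>\<^bsub>C\<^esub> q = Ident C (fobj G P)"
  using essentially_surjective[OF assms] by (blast elim: isomorphismE)

lemma additive: "additive_category C'"
proof unfold_locales
  obtain Z where Z: "zero_object C Z"
    using S.zero by blast
  then have ZO: "Z \<in> Obj C" "Ident C Z = hzero C Z Z"
    by (simp_all add: S.zero_object_iff)
  obtain P p q where P: "P \<in> Obj C'" and p: "p \<in> Hom C Z (fobj G P)"
    and q: "q \<in> Hom C (fobj G P) Z" and pq: "p \<cdot>\<^bsub>C\<^esub> q = Ident C (fobj G P)"
    using essentially_surjective'[OF ZO(1)] by blast
  \<comment> \<open>The identity of the image of P factors through the zero object Z, so it is
    zero.\<close>
  have "p \<cdot>\<^bsub>C\<^esub> (Ident C Z \<cdot>\<^bsub>C\<^esub> q) = hzero C (fobj G P) (fobj G P)"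
    unfolding ZO(2) using p q ZO(1) P by (simp add: in_Hom)
  then have "Ident C (fobj G P) = hzero C (fobj G P) (fobj G P)"
    using pq q by (simp add: in_Hom)
  then have "zero_object C (fobj G P)"
    unfolding S.zero_object_iff using P by simp
  then show "\<exists>Z. zero_object C' Z"
    using G.reflect_zero_object P by blast
next
  fix A B assume AB: "A \<in> Obj C'" "B \<in> Obj C'"
  obtain S where S: "is_biproduct C (fobj G A) (fobj G B) S"
    using S.biproducts[of "fobj G A" "fobj G B"] AB by auto
  obtain P p q where P: "P \<in> Obj C'" "p \<in> Hom C (bobj S) (fobj G P)"
    "q \<in> Hom C (fobj G P) (bobj S)" "q \<cdot>\<^bsub>C\<^esub> p = Ident C (bobj S)"
    "p \<cdot>\<^bsub>C\<^esub> q = Ident C (fobj G P)"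
    using essentially_surjective'[OF G.is_biproductD(1)[OF S]] by blast
  show "\<exists>S. is_biproduct C' A B S"
    using G.lifted_biproduct_exists[OF AB P(1) S P(2-5)] G.lifted_biproduct_is_biproduct by blast
qed (rule T.preadditive)

sublocale T: additive_category C'
  by (rule additive)

sublocale T: biadditive_functor C' E'
proof (intro biadditive_functor.intro biadditive_functor_axioms.intro additive)
  fix D A X x y \<delta>
  assume *: "D \<in> Obj C'" "x \<in> Hom C' A X" "y \<in> Hom C' A X" "\<delta> \<in> ext E' D A"
  then have "fmap G x \<in> Hom C (fobj G A) (fobj G X)" "fmap G y \<in> Hom C (fobj G A) (fobj G X)"
    by (auto simp: in_Hom)
  from S.push_add[OF _ this] show "push C' E' D (hadd C' x y) \<delta> =
      push C' E' D x \<delta> \<otimes>\<^bsub>egrp E' D X\<^esub> push C' E' D y \<delta>"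
    using * by (auto simp: in_Hom)
next
  fix A D Z z w \<delta>
  assume *: "A \<in> Obj C'" "z \<in> Hom C' Z D" "w \<in> Hom C' Z D" "\<delta> \<in> ext E' D A"
  then have "fmap G z \<in> Hom C (fobj G Z) (fobj G D)" "fmap G w \<in> Hom C (fobj G Z) (fobj G D)"
    by (auto simp: in_Hom)
  from S.pull_add[OF _ this] show "pull C' E' A (hadd C' z w) \<delta> =
      pull C' E' A z \<delta> \<otimes>\<^bsub>egrp E' Z A\<^esub> pull C' E' A w \<delta>"
    using * by (auto simp: in_Hom)
next
  fix z Z D z' Z' x A X x' X' \<delta>
  assume *: "z \<in> Hom C' Z D" "z' \<in> Hom C' Z' Z" "x \<in> Hom C' A X" "x' \<in> Hom C' X X'"
    "\<delta> \<in> ext E' D A"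
  show "emap E' (z \<cdot>\<^bsub>C'\<^esub> z') (x' \<cdot>\<^bsub>C'\<^esub> x) \<delta> = emap E' z' x' (emap E' z x \<delta>)"
    unfolding E'_simps G.fmap_comp[OF *(2,1)] G.fmap_comp[OF *(3,4)]
    by (rule S.emap_comp[OF G.fmap[OF *(1)] G.fmap[OF *(2)] G.fmap[OF *(3)] G.fmap[OF *(4)]])
      (use *(5) in simp)
next
  fix D A assume "D \<in> Obj C'" "A \<in> Obj C'"
  then show "comm_group (egrp E' D A)"
    using S.egrp by simp
next
  fix z Z D x A X assume "z \<in> Hom C' Z D" "x \<in> Hom C' A X"
  then show "emap E' z x \<in> hom (egrp E' D A) (egrp E' Z X)"
    using S.emap[OF G.fmap G.fmap] by simp
next
  fix D A \<delta> assume "D \<in> Obj C'" "A \<in> Obj C'" "\<delta> \<in> ext E' D A"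
  then show "emap E' (Ident C' D) (Ident C' A) \<delta> = \<delta>"
    using S.emap_ident by simp
qed

text \<open>\<open>s'\<close> is given by membership, whereas \<open>realised_by\<close> asks for
  equality of classes. They agree since \<open>s\<close> takes homotopy classes as values: if the
  image of X belongs to the class of some W, it generates the same class. The converse is the
  description of classes as preimages.\<close>

lemma realised_by_map_iff:
  assumes D: "D \<in> Obj C'" and A: "A \<in> Obj C'" and \<delta>: "\<delta> \<in> ext E' D A"
  shows "realised_by n C' s' D A \<delta> X \<longleftrightarrow>
    X \<in> complexes_betw n C' A D \<and> realised_by n C s (fobj G D) (fobj G A) \<delta> (map_cpx G X)"
proof (cases "X \<in> complexes_betw n C' A D")
  case True
  then have X: "X \<in> complexes n C'" "cobj X 0 = A" "cobj X (Suc n) = D"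
    by (auto simp: complexes_betw_def)
  have FX: "map_cpx G X \<in> complexes_betw n C (fobj G A) (fobj G D)"
    using X G.map_complex by (auto simp: complexes_betw_def)
  have h: "hclass n C' X = {Y \<in> complexes_betw n C' A D. map_cpx G Y \<in> hclass n C (map_cpx G X)}"
    using G.hclass_map[OF X(1)] X(2,3) by simp
  have "s' D A \<delta> = hclass n C' X \<longleftrightarrow> s (fobj G D) (fobj G A) \<delta> = hclass n C (map_cpx G X)"
  proof
    assume "s (fobj G D) (fobj G A) \<delta> = hclass n C (map_cpx G X)"
    then show "s' D A \<delta> = hclass n C' X"
      by (simp add: h s'_def)
  next
    assume "s' D A \<delta> = hclass n C' X"
    then have 1: "map_cpx G X \<in> s (fobj G D) (fobj G A) \<delta>"
      using T.hclass_self[OF X(1)] unfolding s'_def by blast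
    obtain W where "realised_by n C s (fobj G D) (fobj G A) \<delta> W"
      using S.realised[of "fobj G D" "fobj G A" \<delta>] D A \<delta> by auto
    note W = realised_byD[OF this]
    have "homotopy_equivalent n C W (map_cpx G X)"
      using 1 unfolding W(4) hclass_def by blast
    then show "s (fobj G D) (fobj G A) \<delta> = hclass n C (map_cpx G X)"
      unfolding W(4) using W(1) FX S.hclass_eq by (auto simp: complexes_betw_def)
  qed
  then show ?thesis
    using True FX by (simp add: realised_by_def)
qed (simp add: realised_by_def)

text \<open>The bridge from \<open>C\<close> back to \<open>C'\<close>: every conflation of
  \<open>C\<close> is isomorphic to the image of one of \<open>C'\<close>. In the degrees of J,
  where the object is already the image of \<open>Q i\<close>, the isomorphism is the identity and
  the lifted object is \<open>Q i\<close> itself. The extension is conjugated by the end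
  isomorphisms, so it stays \<delta> when J contains 0 and n + 1.\<close>

lemma lift_realised_by:
  assumes r: "realised_by n C s D A \<delta> X" and \<delta>: "\<delta> \<in> ext E D A"
    and J: "\<And>i. i \<in> J \<Longrightarrow> Q i \<in> Obj C'" "\<And>i. i \<in> J \<Longrightarrow> cobj X i = fobj G (Q i)"
  obtains X' p q where
    "\<And>i. i \<in> J \<Longrightarrow> i \<le> Suc n \<Longrightarrow>
      cobj X' i = Q i \<and> p i = Ident C (fobj G (Q i)) \<and> q i = Ident C (fobj G (Q i))"
    "\<And>i. i \<le> Suc n \<Longrightarrow> p i \<in> Hom C (cobj X i) (fobj G (cobj X' i))"
    "\<And>i. i \<le> Suc n \<Longrightarrow> q i \<in> Hom C (fobj G (cobj X' i)) (cobj X i)"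
    "\<And>i. i \<le> Suc n \<Longrightarrow> q i \<cdot>\<^bsub>C\<^esub> p i = Ident C (cobj X i)"
    "\<And>i. i \<le> Suc n \<Longrightarrow> p i \<cdot>\<^bsub>C\<^esub> q i = Ident C (fobj G (cobj X' i))"
    "\<And>i. i \<le> n \<Longrightarrow> fmap G (diff X' i) = p (Suc i) \<cdot>\<^bsub>C\<^esub> (diff X i \<cdot>\<^bsub>C\<^esub> q i)"
    "X' \<in> complexes n C'"
    "emap E (q (Suc n)) (p 0) \<delta> \<in> ext E' (cobj X' (Suc n)) (cobj X' 0)"
    "realised_by n C' s' (cobj X' (Suc n)) (cobj X' 0) (emap E (q (Suc n)) (p 0) \<delta>) X'"
proof -
  note X = realised_byD[OF r]
  define R where "R i P p q \<longleftrightarrow>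
      P \<in> Obj C' \<and> p \<in> Hom C (cobj X i) (fobj G P) \<and> q \<in> Hom C (fobj G P) (cobj X i) \<and>
      q \<cdot>\<^bsub>C\<^esub> p = Ident C (cobj X i) \<and> p \<cdot>\<^bsub>C\<^esub> q = Ident C (fobj G P) \<and>
      (i \<in> J \<longrightarrow> P = Q i \<and> p = Ident C (fobj G (Q i)) \<and> q = Ident C (fobj G (Q i)))" for i P p q
  have "\<exists>P p q. R i P p q" if i: "i \<le> Suc n" for i
  proof (cases "i \<in> J")
    case True
    then show ?thesis
      unfolding R_def using J[OF True]
      by (intro exI[of _ "Q i"] exI[of _ "Ident C (fobj G (Q i))"]) (auto simp: in_Hom)
  next
    case False
    then show ?thesis
      unfolding R_def using essentially_surjective'[OF complexesD(1)[OF X(1) i]] by metis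
  qed
  then obtain P p q where R: "\<And>i. i \<le> Suc n \<Longrightarrow> R i (P i) (p i) (q i)"
    by metis
  have P: "\<And>i. i \<le> Suc n \<Longrightarrow> P i \<in> Obj C'"
    and p: "\<And>i. i \<le> Suc n \<Longrightarrow> p i \<in> Hom C (cobj X i) (fobj G (P i))"
    and q: "\<And>i. i \<le> Suc n \<Longrightarrow> q i \<in> Hom C (fobj G (P i)) (cobj X i)"
    and qp: "\<And>i. i \<le> Suc n \<Longrightarrow> q i \<cdot>\<^bsub>C\<^esub> p i = Ident C (cobj X i)"
    and pq: "\<And>i. i \<le> Suc n \<Longrightarrow> p i \<cdot>\<^bsub>C\<^esub> q i = Ident C (fobj G (P i))"
    and PJ: "\<And>i. i \<in> J \<Longrightarrow> i \<le> Suc n \<Longrightarrow>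
      P i = Q i \<and> p i = Ident C (fobj G (Q i)) \<and> q i = Ident C (fobj G (Q i))"
    using R unfolding R_def by auto
  obtain X' where X': "X' \<in> complexes n C'" "cobj X' = P"
    "\<And>i. i \<le> n \<Longrightarrow> fmap G (diff X' i) = p (Suc i) \<cdot>\<^bsub>C\<^esub> (diff X i \<cdot>\<^bsub>C\<^esub> q i)"
    "chain_map n C X (map_cpx G X') p" "chain_map n C (map_cpx G X') X q"
    using G.lift_complex[OF X(1) P p q qp pq] by blast
  have "realised_by n C s (cobj (map_cpx G X') (Suc n)) (cobj (map_cpx G X') 0)
      (emap E (q (Suc n)) (p 0) \<delta>) (map_cpx G X')"
    by (rule S.realised_by_iso[OF r \<delta> G.map_complex[OF X'(1)] X'(4,5)])
      (use qp pq X'(2) in auto)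
  moreover have e: "emap E (q (Suc n)) (p 0) \<delta> \<in> ext E' (P (Suc n)) (P 0)"
    using hom_in_carrier[OF S.emap[OF q[of "Suc n"] p[of 0]], of \<delta>] \<delta> X(2,3) by simp
  ultimately have "realised_by n C' s' (P (Suc n)) (P 0) (emap E (q (Suc n)) (p 0) \<delta>) X'"
    using realised_by_map_iff[OF P P e] X'(1,2) by (simp add: complexes_betw_def)
  then show ?thesis
    using that[of X' p q] X'(1-3) PJ p q qp pq e by auto
qed

lemma T_realisation: "realisation n C' E' s'"
proof unfold_locales
  fix D A \<delta> assume D: "D \<in> Obj C'" and A: "A \<in> Obj C'" and \<delta>: "\<delta> \<in> ext E' D A"
  have \<delta>': "\<delta> \<in> ext E (fobj G D) (fobj G A)"
    using \<delta> by simp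
  obtain W where W: "realised_by n C s (fobj G D) (fobj G A) \<delta> W"
    using S.realised[OF _ _ \<delta>'] D A by auto
  \<comment> \<open>Prescribing both end degrees preserves the end objects and the
    extension.\<close>
  let ?J = "{0, Suc n}" and ?Q = "\<lambda>i. if i = 0 then A else D"
  show "\<exists>X. realised_by n C' s' D A \<delta> X"
  proof (rule lift_realised_by[OF W \<delta>', of ?J ?Q])
    fix X' p q
    assume J: "\<And>i. i \<in> ?J \<Longrightarrow> i \<le> Suc n \<Longrightarrow>
        cobj X' i = ?Q i \<and> p i = Ident C (fobj G (?Q i)) \<and> q i = Ident C (fobj G (?Q i))"
      and r: "realised_by n C' s' (cobj X' (Suc n)) (cobj X' 0) (emap E (q (Suc n)) (p 0) \<delta>) X'"
    have "emap E (q (Suc n)) (p 0) \<delta> = \<delta>"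
      using J[of 0] J[of "Suc n"] S.emap_ident[OF _ _ \<delta>'] D A by simp
    then show ?thesis
      using r J[of 0] J[of "Suc n"] by auto
  qed (use D A realised_byD[OF W] in auto)
next
  fix D A \<delta> D' A' \<epsilon> X Y a c
  assume D: "D \<in> Obj C'" and A: "A \<in> Obj C'" and \<delta>: "\<delta> \<in> ext E' D A"
    and D': "D' \<in> Obj C'" and A': "A' \<in> Obj C'" and \<epsilon>: "\<epsilon> \<in> ext E' D' A'"
    and X: "realised_by n C' s' D A \<delta> X" and Y: "realised_by n C' s' D' A' \<epsilon> Y"
    and m: "ext_morphism C' E' D A \<delta> D' A' \<epsilon> a c"
  have ac: "a \<in> Hom C' A A'" "c \<in> Hom C' D D'"
    using m by (auto simp: ext_morphism_def)
  have "ext_morphism C E (fobj G D) (fobj G A) \<delta> (fobj G D') (fobj G A') \<epsilon> (fmap G a) (fmap G c)"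
    using m D A' G.fmap[OF ac(1)] G.fmap[OF ac(2)] by (simp add: ext_morphism_def)
  then obtain u where u: "chain_map n C (map_cpx G X) (map_cpx G Y) u"
    "u 0 = fmap G a" "u (n + 1) = fmap G c"
    using S.R0[of "fobj G D" "fobj G A" \<delta> "fobj G D'" "fobj G A'" \<epsilon> "map_cpx G X" "map_cpx G Y"]
      X Y D A \<delta> D' A' \<epsilon> by (auto simp: realised_by_map_iff)
  note XD = realised_byD[OF X] and YD = realised_byD[OF Y]
  obtain f where f: "chain_map n C' X Y f" "\<And>i. i \<le> Suc n \<Longrightarrow> fmap G (f i) = u i"
    using G.lift_chain_map[OF XD(1) YD(1) u(1)] by blast
  have "f 0 = a" "f (Suc n) = c"
    using f(2)[of 0] f(2)[of "Suc n"] u(2,3) ac XD YD chain_mapD(1-3)[OF f(1)]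
    by (auto simp: in_Hom intro!: G.fmap_cancel)
  then show "\<exists>f. chain_map n C' X Y f \<and> f 0 = a \<and> f (n + 1) = c"
    using f(1) by auto
qed

sublocale T: realisation n C' E' s'
  by (rule T_realisation)

section \<open>Exactness of the transported realisation\<close>

text \<open>The image of X is tested on objects in the image of G: there the hom-groups correspond
  under G, and the groups of \<open>E'\<close> are literally those of \<open>E\<close>, so the maps
  into extensions vanish on corresponding morphisms.\<close>

lemma reflect_n_exangle:
  assumes X: "X \<in> complexes n C'" and ex: "n_exangle n C E (map_cpx G X) \<delta>"
  shows "n_exangle n C' E' X \<delta>"
  unfolding n_exangle_def
proof (intro conjI ballI allI impI)
  note [simp] = complexesD(1-4)[OF X]
  have onto: "fmap G ` carrier (hom_group C' A B) = carrier (hom_group C (fobj G A) (fobj G B))"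
    and bij: "bij_betw (fmap G) (carrier (hom_group C' A B)) (carrier (hom_group C (fobj G A) (fobj G B)))"
    if "A \<in> Obj C'" "B \<in> Obj C'" for A B
    using G.bij_fmap[OF that] that by (auto simp: bij_betw_def)
  have zero: "f = \<one>\<^bsub>hom_group C' A B\<^esub> \<longleftrightarrow> fmap G f = \<one>\<^bsub>hom_group C (fobj G A) (fobj G B)\<^esub>"
    if "f \<in> Hom C' A B" "A \<in> Obj C'" "B \<in> Obj C'" for f A B
  proof -
    have "fmap G f = fmap G (hzero C' A B) \<Longrightarrow> f = hzero C' A B"
      by (rule G.fmap_cancel) (use that in \<open>auto simp: in_Hom\<close>)
    then have "f = hzero C' A B \<longleftrightarrow> fmap G f = fmap G (hzero C' A B)"
      by blast
    then show ?thesis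
      unfolding G.fmap_hzero[OF that(2,3)] unfolding hzero_def .
  qed
  show "X \<in> complexes n C'"
    by (rule X)
  show "\<delta> \<in> ext E' (cobj X (n + 1)) (cobj X 0)"
    using ex by (simp add: n_exangle_def)
  fix Z assume Z [simp]: "Z \<in> Obj C'"
  have "\<forall>Z \<in> Obj C. (\<forall>i < n. exact_at (hom_group C Z (fobj G (cobj X i)))
        (hom_group C Z (fobj G (cobj X (Suc i)))) (hom_group C Z (fobj G (cobj X (Suc (Suc i)))))
        (\<lambda>g. fmap G (diff X i) \<cdot>\<^bsub>C\<^esub> g) (\<lambda>g. fmap G (diff X (Suc i)) \<cdot>\<^bsub>C\<^esub> g)) \<and>
      exact_at (hom_group C Z (fobj G (cobj X n))) (hom_group C Z (fobj G (cobj X (Suc n))))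
        (egrp E Z (fobj G (cobj X 0)))
        (\<lambda>g. fmap G (diff X n) \<cdot>\<^bsub>C\<^esub> g) (\<lambda>g. pull C E (fobj G (cobj X 0)) g \<delta>) \<and>
      (\<forall>i < n. exact_at (hom_group C (fobj G (cobj X (Suc (Suc i)))) Z)
        (hom_group C (fobj G (cobj X (Suc i))) Z) (hom_group C (fobj G (cobj X i)) Z)
        (\<lambda>g. g \<cdot>\<^bsub>C\<^esub> fmap G (diff X (Suc i))) (\<lambda>g. g \<cdot>\<^bsub>C\<^esub> fmap G (diff X i))) \<and>
      exact_at (hom_group C (fobj G (cobj X 1)) Z) (hom_group C (fobj G (cobj X 0)) Z)
        (egrp E (fobj G (cobj X (Suc n))) Z)
        (\<lambda>g. g \<cdot>\<^bsub>C\<^esub> fmap G (diff X 0)) (\<lambda>g. push C E (fobj G (cobj X (Suc n))) g \<delta>)"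
    using ex unfolding n_exangle_def by simp
  from bspec[OF this G.fobj[OF Z]]
  have ex: "\<And>i. i < n \<Longrightarrow> exact_at (hom_group C (fobj G Z) (fobj G (cobj X i)))
        (hom_group C (fobj G Z) (fobj G (cobj X (Suc i))))
        (hom_group C (fobj G Z) (fobj G (cobj X (Suc (Suc i)))))
        (\<lambda>g. fmap G (diff X i) \<cdot>\<^bsub>C\<^esub> g) (\<lambda>g. fmap G (diff X (Suc i)) \<cdot>\<^bsub>C\<^esub> g)"
      "exact_at (hom_group C (fobj G Z) (fobj G (cobj X n)))
        (hom_group C (fobj G Z) (fobj G (cobj X (Suc n))))
        (egrp E (fobj G Z) (fobj G (cobj X 0)))
        (\<lambda>g. fmap G (diff X n) \<cdot>\<^bsub>C\<^esub> g) (\<lambda>g. pull C E (fobj G (cobj X 0)) g \<delta>)"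
      "\<And>i. i < n \<Longrightarrow> exact_at (hom_group C (fobj G (cobj X (Suc (Suc i)))) (fobj G Z))
        (hom_group C (fobj G (cobj X (Suc i))) (fobj G Z))
        (hom_group C (fobj G (cobj X i)) (fobj G Z))
        (\<lambda>g. g \<cdot>\<^bsub>C\<^esub> fmap G (diff X (Suc i))) (\<lambda>g. g \<cdot>\<^bsub>C\<^esub> fmap G (diff X i))"
      "exact_at (hom_group C (fobj G (cobj X 1)) (fobj G Z))
        (hom_group C (fobj G (cobj X 0)) (fobj G Z))
        (egrp E (fobj G (cobj X (Suc n))) (fobj G Z))
        (\<lambda>g. g \<cdot>\<^bsub>C\<^esub> fmap G (diff X 0)) (\<lambda>g. push C E (fobj G (cobj X (Suc n))) g \<delta>)"
    by blast+
  {
    fix i assume i: "i < n"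
    show "exact_at (hom_group C' Z (cobj X i)) (hom_group C' Z (cobj X (i + 1)))
        (hom_group C' Z (cobj X (i + 2))) (\<lambda>g. diff X i \<cdot>\<^bsub>C'\<^esub> g) (\<lambda>g. diff X (i + 1) \<cdot>\<^bsub>C'\<^esub> g)"
      unfolding Suc_eq_plus1[symmetric] add_2_eq_Suc'
      by (rule G.exact_at_reflect[OF ex(1)[OF i] onto bij])
        (use i in \<open>auto simp: in_Hom zero\<close>)
    show "exact_at (hom_group C' (cobj X (i + 2)) Z) (hom_group C' (cobj X (i + 1)) Z)
        (hom_group C' (cobj X i) Z) (\<lambda>g. g \<cdot>\<^bsub>C'\<^esub> diff X (i + 1)) (\<lambda>g. g \<cdot>\<^bsub>C'\<^esub> diff X i)"
      unfolding Suc_eq_plus1[symmetric] add_2_eq_Suc'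
      by (rule G.exact_at_reflect[OF ex(3)[OF i] onto bij])
        (use i in \<open>auto simp: in_Hom zero\<close>)
  }
  show "exact_at (hom_group C' Z (cobj X n)) (hom_group C' Z (cobj X (n + 1)))
      (egrp E' Z (cobj X 0)) (\<lambda>g. diff X n \<cdot>\<^bsub>C'\<^esub> g) (\<lambda>g. pull C' E' (cobj X 0) g \<delta>)"
    unfolding Suc_eq_plus1[symmetric]
    by (rule G.exact_at_reflect[OF ex(2) onto bij]) (auto simp: in_Hom)
  show "exact_at (hom_group C' (cobj X 1) Z) (hom_group C' (cobj X 0) Z)
      (egrp E' (cobj X (n + 1)) Z) (\<lambda>g. g \<cdot>\<^bsub>C'\<^esub> diff X 0) (\<lambda>g. push C' E' (cobj X (n + 1)) g \<delta>)"
    unfolding Suc_eq_plus1[symmetric]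
    by (rule G.exact_at_reflect[OF ex(4) onto bij]) (auto simp: in_Hom)
qed

text \<open>G preserves identities and zero morphisms strictly, so the image is equal, not only
  isomorphic, to the trivial complex of \<open>C\<close>.\<close>

lemma left_trivial_complex:
  assumes "Z \<in> Obj C'" "A \<in> Obj C'"
  shows "left_trivial C' Z A \<in> complexes n C'"
    "map_cpx G (left_trivial C' Z A) = left_trivial C (fobj G Z) (fobj G A)"
  using assms by (auto simp: left_trivial_def complexes_def in_Hom map_cpx_def fun_eq_iff)

lemma right_trivial_complex:
  assumes "Z \<in> Obj C'" "A \<in> Obj C'"
  shows "right_trivial n C' Z A \<in> complexes n C'"
    "map_cpx G (right_trivial n C' Z A) = right_trivial n C (fobj G Z) (fobj G A)"
  using assms by (auto simp: right_trivial_def complexes_def in_Hom map_cpx_def fun_eq_iff)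

lemma T_exact_realisation: "exact_realisation n C' E' s'"
proof unfold_locales
  fix D A \<delta> X
  assume D: "D \<in> Obj C'" and A: "A \<in> Obj C'" and \<delta>: "\<delta> \<in> ext E' D A"
    and X: "realised_by n C' s' D A \<delta> X"
  have "n_exangle n C E (map_cpx G X) \<delta>"
    using X D A \<delta> by (intro S.R1[of "fobj G D" "fobj G A"]) (auto simp: realised_by_map_iff)
  then show "n_exangle n C' E' X \<delta>"
    using realised_byD(1)[OF X] by (rule reflect_n_exangle[rotated])
next
  fix Z A assume Z: "zero_object C' Z" and A: "A \<in> Obj C'"
  have ZO: "Z \<in> Obj C'"
    using Z by (simp add: zero_object_def)
  \<comment> \<open>For n >= 1 the top degree n + 1 exceeds 1, so the right end is Z and not
    A.\<close>
  have "left_trivial C' Z A \<in> complexes_betw n C' A Z"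
    using left_trivial_complex(1)[OF ZO A] n_pos by (simp add: complexes_betw_def left_trivial_def)
  then show "s' Z A \<one>\<^bsub>egrp E' Z A\<^esub> = hclass n C' (left_trivial C' Z A)"
    using G.hclass_map[OF left_trivial_complex(1)[OF ZO A]] left_trivial_complex(2)[OF ZO A]
      S.R2_left[OF G.map_zero_object[OF Z] G.fobj[OF A]]
    by (simp add: s'_def complexes_betw_def)
  \<comment> \<open>Here n >= 1 ensures that degree 0 carries Z.\<close>
  have "right_trivial n C' Z A \<in> complexes_betw n C' Z A"
    using right_trivial_complex(1)[OF ZO A] n_pos by (simp add: complexes_betw_def right_trivial_def)
  then show "s' A Z \<one>\<^bsub>egrp E' A Z\<^esub> = hclass n C' (right_trivial n C' Z A)"
    using G.hclass_map[OF right_trivial_complex(1)[OF ZO A]] right_trivial_complex(2)[OF ZO A]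
      S.R2_right[OF G.map_zero_object[OF Z] G.fobj[OF A]]
    by (simp add: s'_def complexes_betw_def)
qed

sublocale T: exact_realisation n C' E' s'
  by (rule T_exact_realisation)

section \<open>Inflations, deflations and cones\<close>

lemma conflation_map:
  assumes "conflation n C' E' s' X"
  shows "conflation n C E s (map_cpx G X)" "X \<in> complexes n C'"
proof -
  obtain D A \<delta> where *: "D \<in> Obj C'" "A \<in> Obj C'" "\<delta> \<in> ext E' D A" "realised_by n C' s' D A \<delta> X"
    using assms unfolding conflation_def by blast
  then show "conflation n C E s (map_cpx G X)"
    unfolding conflation_def using realised_by_map_iff[OF *(1-3)]
    by (intro bexI[of _ "fobj G D"] bexI[of _ "fobj G A"] bexI[of _ \<delta>]) auto
  show "X \<in> complexes n C'"
    using realised_byD(1)[OF *(4)] .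
qed

text \<open>For the composition axioms the differential in degree i must be f itself, not a
  conjugate of it. So the isomorphisms are identities in degrees i and i + 1; elsewhere they are
  arbitrary and the extension may change, which is harmless as a conflation may realise any
  extension.\<close>

lemma lift_conflation_diff:
  assumes "conflation n C E s X" and i: "i \<le> n" and f: "f \<in> Arr C'" and d: "diff X i = fmap G f"
  shows "\<exists>X'. conflation n C' E' s' X' \<and> diff X' i = f"
proof -
  obtain D A \<delta> where *: "D \<in> Obj C" "A \<in> Obj C" and \<delta>: "\<delta> \<in> ext E D A"
    and r: "realised_by n C s D A \<delta> X"
    using assms unfolding conflation_def by blast
  note X = complexesD[OF realised_byD(1)[OF r]]
  let ?J = "{i, Suc i}" and ?Q = "\<lambda>j. if j = i then Dom C' f else Cod C' f"
  show ?thesis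
  proof (rule lift_realised_by[OF r \<delta>, of ?J ?Q])
    fix X' p q
    assume J: "\<And>j. j \<in> ?J \<Longrightarrow> j \<le> Suc n \<Longrightarrow>
        cobj X' j = ?Q j \<and> p j = Ident C (fobj G (?Q j)) \<and> q j = Ident C (fobj G (?Q j))"
      and X': "X' \<in> complexes n C'"
      and d': "\<And>i. i \<le> n \<Longrightarrow> fmap G (diff X' i) = p (Suc i) \<cdot>\<^bsub>C\<^esub> (diff X i \<cdot>\<^bsub>C\<^esub> q i)"
      and e: "emap E (q (Suc n)) (p 0) \<delta> \<in> ext E' (cobj X' (Suc n)) (cobj X' 0)"
      and r': "realised_by n C' s' (cobj X' (Suc n)) (cobj X' 0) (emap E (q (Suc n)) (p 0) \<delta>) X'"
    have "fmap G (diff X' i) = fmap G f"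
      using d'[OF i] J[of i] J[of "Suc i"] i f d by simp
    then have "diff X' i = f"
      using J[of i] J[of "Suc i"] i f complexesD[OF X'] by (intro G.fmap_cancel) auto
    moreover have "conflation n C' E' s' X'"
      unfolding conflation_def using e r' complexesD(1)[OF X'] by blast
    ultimately show ?thesis
      by blast
  next
    fix j assume "j \<in> ?J"
    then show "?Q j \<in> Obj C'" "cobj X j = fobj G (?Q j)"
      using X(3)[OF i] X(4)[OF i] f d by auto
  qed
qed

lemma lifted_map_cpx_ident:
  assumes "X \<in> complexes n C'" "chain_map n C' X Y f" "i \<le> Suc n" "cobj Y i = cobj X i"
    and "fmap G (f i) = Ident C (fobj G (cobj X i))"
  shows "f i = Ident C' (cobj X i)"
  using assms chain_mapD(1-3)[OF assms(2,3)] complexesD(1)[OF assms(1,3)]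
  by (intro G.fmap_cancel) auto

text \<open>Apply the axiom in \<open>C\<close> to the images of X and Y and lift the resulting cone
  M with both ends prescribed. The lift is again a cone: its inner terms correspond to the
  biproducts in M, the biproduct structure is carried over along the same isomorphisms, and the
  conjugated differentials become the matrices of the lifted map f.\<close>

lemma T_EA2:
  assumes D: "D \<in> Obj C'" and A: "A \<in> Obj C'" and \<delta>: "\<delta> \<in> ext E' D A" and c: "c \<in> Hom C' K D"
    and rX: "realised_by n C' s' K A (pull C' E' A c \<delta>) X" and rY: "realised_by n C' s' D A \<delta> Y"
  shows "\<exists>f M. chain_map n C' X Y f \<and> f 0 = Ident C' A \<and> f (n + 1) = c \<and>
    mapping_cone n C' X Y f M \<and> realised_by n C' s' D (cobj X 1) (push C' E' D (diff X 0) \<delta>) M"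
proof -
  note XD = realised_byD[OF rX] and YD = realised_byD[OF rY]
  note [simp] = complexesD(1-4)[OF XD(1)] complexesD(1-4)[OF YD(1)]
  have K: "K \<in> Obj C'" and cT: "c \<in> Arr C'" "Dom C' c = K" "Cod C' c = D"
    using c by (auto simp: in_Hom)
  have pe: "pull C' E' A c \<delta> \<in> ext E' K A"
    using hom_in_carrier[OF T.emap[OF c T.ident[OF A]] \<delta>] by (simp add: pull_def)
  have X0: "diff X 0 \<in> Hom C' A (cobj X 1)"
    using XD(2) by (simp add: in_Hom)
  have qe: "push C E (fobj G D) (fmap G (diff X 0)) \<delta> \<in> ext E (fobj G D) (fobj G (cobj X 1))"
    using hom_in_carrier[OF T.emap[OF T.ident[OF D] X0] \<delta>] D by (simp add: push_def)
  have rGX: "realised_by n C s (fobj G K) (fobj G A) (pull C E (fobj G A) (fmap G c) \<delta>) (map_cpx G X)"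
    using realised_by_map_iff[OF K A pe] rX A by simp
  have rGY: "realised_by n C s (fobj G D) (fobj G A) \<delta> (map_cpx G Y)"
    using realised_by_map_iff[OF D A \<delta>] rY by simp
  obtain u M where u: "chain_map n C (map_cpx G X) (map_cpx G Y) u"
    "u 0 = Ident C (fobj G A)" "u (Suc n) = fmap G c"
    and cone: "mapping_cone n C (map_cpx G X) (map_cpx G Y) u M"
    and rM: "realised_by n C s (fobj G D) (fobj G (cobj X 1))
      (push C E (fobj G D) (fmap G (diff X 0)) \<delta>) M"
    using S.EA2[OF _ _ _ G.fmap[OF c] rGX rGY] D A \<delta> by auto
  note MD = realised_byD[OF rM]
  note [simp] = complexesD(1-4)[OF MD(1)]
  obtain f where f: "chain_map n C' X Y f" "\<And>i. i \<le> Suc n \<Longrightarrow> fmap G (f i) = u i"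
    using G.lift_chain_map[OF XD(1) YD(1) u(1)] by blast
  note [simp] = chain_mapD(1-3)[OF f(1)]
  have f0: "f 0 = Ident C' A"
    using lifted_map_cpx_ident[OF XD(1) f(1), of 0] f(2)[of 0] u(2) XD(2) YD(2) by simp
  have fn: "f (Suc n) = c"
    using f(2)[of "Suc n"] u(3) cT XD(3) YD(3) by (intro G.fmap_cancel) auto
  obtain B where B: "\<And>i. i \<in> {1..n} \<Longrightarrow>
      is_biproduct C (fobj G (cobj X (Suc i))) (fobj G (cobj Y i)) (B i)"
    and MB: "\<And>i. i \<in> {1..n} \<Longrightarrow> cobj M i = bobj (B i)"
    and M0: "diff M 0 = col C (B 1) (hneg C (fmap G (diff X 1))) (u 1)"
    and Mi: "\<And>i. i \<in> {1..<n} \<Longrightarrow> diff M i = matrix C (B i) (B (Suc i))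
        (hneg C (fmap G (diff X (Suc i)))) (hzero C (fobj G (cobj Y i)) (fobj G (cobj X (Suc (Suc i)))))
        (u (Suc i)) (fmap G (diff Y i))"
    and Mn: "diff M n = row C (B n) (u (Suc n)) (fmap G (diff Y n))"
    using cone unfolding mapping_cone_iff map_cpx_simps by blast
  \<comment> \<open>The cone runs from \<open>cobj X 1\<close> to D, and these ends have to be met
    exactly.\<close>
  let ?J = "{0, Suc n}" and ?Q = "\<lambda>i. if i = 0 then cobj X 1 else D"
  have "\<exists>M'. mapping_cone n C' X Y f M' \<and>
      realised_by n C' s' D (cobj X 1) (push C' E' D (diff X 0) \<delta>) M'"
  proof (rule lift_realised_by[OF rM qe, of ?J ?Q])
    fix M' p q
    assume J: "\<And>i. i \<in> ?J \<Longrightarrow> i \<le> Suc n \<Longrightarrow>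
        cobj M' i = ?Q i \<and> p i = Ident C (fobj G (?Q i)) \<and> q i = Ident C (fobj G (?Q i))"
      and p: "\<And>i. i \<le> Suc n \<Longrightarrow> p i \<in> Hom C (cobj M i) (fobj G (cobj M' i))"
      and q: "\<And>i. i \<le> Suc n \<Longrightarrow> q i \<in> Hom C (fobj G (cobj M' i)) (cobj M i)"
      and qp: "\<And>i. i \<le> Suc n \<Longrightarrow> q i \<cdot>\<^bsub>C\<^esub> p i = Ident C (cobj M i)"
      and pq: "\<And>i. i \<le> Suc n \<Longrightarrow> p i \<cdot>\<^bsub>C\<^esub> q i = Ident C (fobj G (cobj M' i))"
      and M': "M' \<in> complexes n C'"
      and d: "\<And>i. i \<le> n \<Longrightarrow> fmap G (diff M' i) = p (Suc i) \<cdot>\<^bsub>C\<^esub> (diff M i \<cdot>\<^bsub>C\<^esub> q i)"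
      and r': "realised_by n C' s' (cobj M' (Suc n)) (cobj M' 0)
        (emap E (q (Suc n)) (p 0) (push C E (fobj G D) (fmap G (diff X 0)) \<delta>)) M'"
    note M'D = complexesD[OF M']
    have J0: "cobj M' 0 = cobj X 1" "p 0 = Ident C (fobj G (cobj X 1))" "q 0 = Ident C (fobj G (cobj X 1))"
      and Jn: "cobj M' (Suc n) = D" "p (Suc n) = Ident C (fobj G D)" "q (Suc n) = Ident C (fobj G D)"
      using J[of 0] J[of "Suc n"] by auto
    have "\<exists>S'. G.lifted_biproduct (cobj X (Suc i)) (cobj Y i) (B i) S' (p i) (q i) \<and> bobj S' = cobj M' i"
      if "i \<in> {1..n}" for i
      using that B[OF that] p[of i] q[of i] qp[of i] pq[of i] MB[OF that] M'D(1)[of i]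
      by (intro G.lifted_biproduct_exists) auto
    then obtain B' where B': "\<And>i. i \<in> {1..n} \<Longrightarrow>
        G.lifted_biproduct (cobj X (Suc i)) (cobj Y i) (B i) (B' i) (p i) (q i)"
      and B'M: "\<And>i. i \<in> {1..n} \<Longrightarrow> bobj (B' i) = cobj M' i"
      by metis
    have "mapping_cone n C' X Y f M'"
      unfolding mapping_cone_iff
    proof (intro exI[of _ B'] conjI ballI)
      fix i assume i: "i \<in> {1..n}"
      show "is_biproduct C' (cobj X (Suc i)) (cobj Y i) (B' i)"
        using G.lifted_biproduct_is_biproduct[OF B'[OF i]] by simp
      show "cobj M' i = bobj (B' i)"
        using B'M[OF i] by simp
    next
      show "cobj M' 0 = cobj X 1" "cobj M' (Suc n) = cobj Y (Suc n)"
        using J0 Jn YD(3) by simp_all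
    next
      have 1: "1 \<in> {1..n}"
        using n_pos by simp
      note col = G.fmap_col[OF B'[OF 1], of "hneg C' (diff X 1)" "f 1"]
      show "diff M' 0 = col C' (B' 1) (hneg C' (diff X 1)) (f 1)"
      proof (rule G.fmap_cancel)
        \<comment> \<open>At the left end \<open>q 0\<close> is an identity, so the first
          differential is conjugated by \<open>p 1\<close> alone, as a column requires; the last one
          is dual.\<close>
        show "fmap G (diff M' 0) = fmap G (col C' (B' 1) (hneg C' (diff X 1)) (f 1))"
          using d[of 0] n_pos f(2)[of 1] M0[symmetric] J0 MD(2) col(1) by simp
      qed (use col(2-4) n_pos M'D J0 B'M[OF 1] in simp_all)
    next
      fix i assume i: "i \<in> {1..<n}"
      have i1: "i \<in> {1..n}" and i2: "Suc i \<in> {1..n}"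
        using i by auto
      note mat = G.fmap_matrix[OF B'[OF i1] B'[OF i2], of "hneg C' (diff X (Suc i))"
        "hzero C' (cobj Y i) (cobj X (Suc (Suc i)))" "f (Suc i)" "diff Y i"]
      show "diff M' i = matrix C' (B' i) (B' (Suc i))
        (hneg C' (diff X (Suc i))) (hzero C' (cobj Y i) (cobj X (Suc (Suc i)))) (f (Suc i)) (diff Y i)"
      proof (rule G.fmap_cancel)
        show "fmap G (diff M' i) = fmap G (matrix C' (B' i) (B' (Suc i))
          (hneg C' (diff X (Suc i))) (hzero C' (cobj Y i) (cobj X (Suc (Suc i)))) (f (Suc i)) (diff Y i))"
          using d[of i] i f(2)[of "Suc i"] Mi[OF i, symmetric] mat(1) p[of "Suc i"] q[of i]
          by (simp add: in_Hom)
      qed (use mat(2-4) i M'D B'M[OF i1] B'M[OF i2] in \<open>simp_all add: in_Hom\<close>)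
    next
      have n: "n \<in> {1..n}"
        using n_pos by simp
      note row = G.fmap_row[OF B'[OF n], of "f (Suc n)" "diff Y n"]
      show "diff M' n = row C' (B' n) (f (Suc n)) (diff Y n)"
      proof (rule G.fmap_cancel)
        show "fmap G (diff M' n) = fmap G (row C' (B' n) (f (Suc n)) (diff Y n))"
          using d[of n] f(2)[of "Suc n"] Mn[symmetric] Jn MD(3) row(1) q[of n] D by (simp add: in_Hom)
      qed (use row(2-4) M'D Jn YD(3) B'M[OF n] in simp_all)
    qed
    \<comment> \<open>The end isomorphisms are identities, so the extension is unaltered.\<close>
    moreover have "realised_by n C' s' D (cobj X 1) (push C' E' D (diff X 0) \<delta>) M'"
      using r' J0 Jn S.emap_ident[OF _ _ qe] D by simp
    ultimately show ?thesis
      by blast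
  qed (use D MD in auto)
  then show ?thesis
    using f(1) f0 fn by auto
qed

end

lemma mapping_cocone_iff:
  "mapping_cocone n C X Y f M \<longleftrightarrow> (\<exists>B.
     (\<forall>i \<in> {1..n}. is_biproduct C (cobj X i) (cobj Y (i - 1)) (B i) \<and> cobj M i = bobj (B i)) \<and>
     cobj M 0 = cobj X 0 \<and> cobj M (Suc n) = cobj Y n \<and>
     diff M 0 = col C (B 1) (diff X 0) (f 0) \<and>
     (\<forall>i \<in> {1..<n}. diff M i = matrix C (B i) (B (Suc i))
        (diff X i) (hzero C (cobj Y (i - 1)) (cobj X (Suc i)))
        (f i) (hneg C (diff Y (i - 1)))) \<and>
     diff M n = row C (B n) (f n) (hneg C (diff Y (n - 1))))"
  by (simp add: mapping_cocone_def)

context exangulated_transport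
begin

text \<open>Parallel to the cone case, with inner terms that join degree i of X to degree i - 1 of
  Y; the predecessor is meaningful because i >= 1. The ends are now A and \<open>cobj Y n\<close>,
  and the extension is a pull-back instead of a push-forward.\<close>

lemma T_EA2_op:
  assumes D: "D \<in> Obj C'" and A: "A \<in> Obj C'" and \<delta>: "\<delta> \<in> ext E' D A" and a: "a \<in> Hom C' A K"
    and rX: "realised_by n C' s' D A \<delta> X" and rY: "realised_by n C' s' D K (push C' E' D a \<delta>) Y"
  shows "\<exists>f M. chain_map n C' X Y f \<and> f 0 = a \<and> f (n + 1) = Ident C' D \<and>
    mapping_cocone n C' X Y f M \<and> realised_by n C' s' (cobj Y n) A (pull C' E' A (diff Y n) \<delta>) M"
proof -
  note XD = realised_byD[OF rX] and YD = realised_byD[OF rY]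
  note [simp] = complexesD(1-4)[OF XD(1)] complexesD(1-4)[OF YD(1)]
  \<comment> \<open>Reconciles predecessor and successor: for i >= 1 the differential of Y with
    index i - 1 ends in degree i.\<close>
  have Yc [simp]: "Cod C' (diff Y (i - Suc 0)) = cobj Y i" if "i \<in> {1..n}" for i
    using that complexesD(4)[OF YD(1), of "i - Suc 0"] by auto
  have K: "K \<in> Obj C'" and aT: "a \<in> Arr C'" "Dom C' a = A" "Cod C' a = K"
    using a by (auto simp: in_Hom)
  have pe: "push C' E' D a \<delta> \<in> ext E' D K"
    using hom_in_carrier[OF T.emap[OF T.ident[OF D] a] \<delta>] by (simp add: push_def)
  have Yn: "diff Y n \<in> Hom C' (cobj Y n) D"
    using YD(3) by (simp add: in_Hom)
  have qe: "pull C E (fobj G A) (fmap G (diff Y n)) \<delta> \<in> ext E (fobj G (cobj Y n)) (fobj G A)"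
    using hom_in_carrier[OF T.emap[OF Yn T.ident[OF A]] \<delta>] A by (simp add: pull_def)
  have rGX: "realised_by n C s (fobj G D) (fobj G A) \<delta> (map_cpx G X)"
    using realised_by_map_iff[OF D A \<delta>] rX by simp
  have rGY: "realised_by n C s (fobj G D) (fobj G K) (push C E (fobj G D) (fmap G a) \<delta>) (map_cpx G Y)"
    using realised_by_map_iff[OF D K pe] rY D by simp
  obtain u M where u: "chain_map n C (map_cpx G X) (map_cpx G Y) u"
    "u 0 = fmap G a" "u (Suc n) = Ident C (fobj G D)"
    and cone: "mapping_cocone n C (map_cpx G X) (map_cpx G Y) u M"
    and rM: "realised_by n C s (fobj G (cobj Y n)) (fobj G A)
      (pull C E (fobj G A) (fmap G (diff Y n)) \<delta>) M"
    using S.EA2_op[OF _ _ _ G.fmap[OF a] rGX rGY] D A \<delta> by auto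
  note MD = realised_byD[OF rM]
  note [simp] = complexesD(1-4)[OF MD(1)]
  obtain f where f: "chain_map n C' X Y f" "\<And>i. i \<le> Suc n \<Longrightarrow> fmap G (f i) = u i"
    using G.lift_chain_map[OF XD(1) YD(1) u(1)] by blast
  note [simp] = chain_mapD(1-3)[OF f(1)]
  have f0: "f 0 = a"
    using f(2)[of 0] u(2) aT XD(2) YD(2) by (intro G.fmap_cancel) auto
  have fn: "f (Suc n) = Ident C' D"
    using lifted_map_cpx_ident[OF XD(1) f(1), of "Suc n"] f(2)[of "Suc n"] u(3) XD(3) YD(3) by simp
  obtain B where B: "\<And>i. i \<in> {1..n} \<Longrightarrow>
      is_biproduct C (fobj G (cobj X i)) (fobj G (cobj Y (i - 1))) (B i)"
    and MB: "\<And>i. i \<in> {1..n} \<Longrightarrow> cobj M i = bobj (B i)"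
    and M0: "diff M 0 = col C (B 1) (fmap G (diff X 0)) (u 0)"
    and Mi: "\<And>i. i \<in> {1..<n} \<Longrightarrow> diff M i = matrix C (B i) (B (Suc i))
        (fmap G (diff X i)) (hzero C (fobj G (cobj Y (i - 1))) (fobj G (cobj X (Suc i))))
        (u i) (hneg C (fmap G (diff Y (i - 1))))"
    and Mn: "diff M n = row C (B n) (u n) (hneg C (fmap G (diff Y (n - 1))))"
    using cone unfolding mapping_cocone_iff map_cpx_simps by blast
  let ?J = "{0, Suc n}" and ?Q = "\<lambda>i. if i = 0 then A else cobj Y n"
  have "\<exists>M'. mapping_cocone n C' X Y f M' \<and>
      realised_by n C' s' (cobj Y n) A (pull C' E' A (diff Y n) \<delta>) M'"
  proof (rule lift_realised_by[OF rM qe, of ?J ?Q])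
    fix M' p q
    assume J: "\<And>i. i \<in> ?J \<Longrightarrow> i \<le> Suc n \<Longrightarrow>
        cobj M' i = ?Q i \<and> p i = Ident C (fobj G (?Q i)) \<and> q i = Ident C (fobj G (?Q i))"
      and p: "\<And>i. i \<le> Suc n \<Longrightarrow> p i \<in> Hom C (cobj M i) (fobj G (cobj M' i))"
      and q: "\<And>i. i \<le> Suc n \<Longrightarrow> q i \<in> Hom C (fobj G (cobj M' i)) (cobj M i)"
      and qp: "\<And>i. i \<le> Suc n \<Longrightarrow> q i \<cdot>\<^bsub>C\<^esub> p i = Ident C (cobj M i)"
      and pq: "\<And>i. i \<le> Suc n \<Longrightarrow> p i \<cdot>\<^bsub>C\<^esub> q i = Ident C (fobj G (cobj M' i))"
      and M': "M' \<in> complexes n C'"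
      and d: "\<And>i. i \<le> n \<Longrightarrow> fmap G (diff M' i) = p (Suc i) \<cdot>\<^bsub>C\<^esub> (diff M i \<cdot>\<^bsub>C\<^esub> q i)"
      and r': "realised_by n C' s' (cobj M' (Suc n)) (cobj M' 0)
        (emap E (q (Suc n)) (p 0) (pull C E (fobj G A) (fmap G (diff Y n)) \<delta>)) M'"
    note M'D = complexesD[OF M']
    have J0: "cobj M' 0 = A" "p 0 = Ident C (fobj G A)" "q 0 = Ident C (fobj G A)"
      and Jn: "cobj M' (Suc n) = cobj Y n" "p (Suc n) = Ident C (fobj G (cobj Y n))"
        "q (Suc n) = Ident C (fobj G (cobj Y n))"
      using J[of 0] J[of "Suc n"] by auto
    have "\<exists>S'. G.lifted_biproduct (cobj X i) (cobj Y (i - 1)) (B i) S' (p i) (q i) \<and> bobj S' = cobj M' i"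
      if "i \<in> {1..n}" for i
      using that B[OF that] p[of i] q[of i] qp[of i] pq[of i] MB[OF that] M'D(1)[of i]
      by (intro G.lifted_biproduct_exists) auto
    then obtain B' where B': "\<And>i. i \<in> {1..n} \<Longrightarrow>
        G.lifted_biproduct (cobj X i) (cobj Y (i - 1)) (B i) (B' i) (p i) (q i)"
      and B'M: "\<And>i. i \<in> {1..n} \<Longrightarrow> bobj (B' i) = cobj M' i"
      by metis
    have "mapping_cocone n C' X Y f M'"
      unfolding mapping_cocone_iff
    proof (intro exI[of _ B'] conjI ballI)
      fix i assume i: "i \<in> {1..n}"
      show "is_biproduct C' (cobj X i) (cobj Y (i - 1)) (B' i)"
        using G.lifted_biproduct_is_biproduct[OF B'[OF i]] by simp
      show "cobj M' i = bobj (B' i)"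
        using B'M[OF i] by simp
    next
      show "cobj M' 0 = cobj X 0" "cobj M' (Suc n) = cobj Y n"
        using J0 Jn XD(2) by simp_all
    next
      have 1: "1 \<in> {1..n}"
        using n_pos by simp
      note col = G.fmap_col[OF B'[OF 1], of "diff X 0" "f 0"]
      show "diff M' 0 = col C' (B' 1) (diff X 0) (f 0)"
      proof (rule G.fmap_cancel)
        show "fmap G (diff M' 0) = fmap G (col C' (B' 1) (diff X 0) (f 0))"
          using d[of 0] n_pos f(2)[of 0] M0[symmetric] J0 MD(2) col(1) XD(2) p[of 1] A
          by (simp add: in_Hom)
      qed (use col(2-4) n_pos M'D J0 B'M[OF 1] XD(2) in simp_all)
    next
      fix i assume i: "i \<in> {1..<n}"
      have i1: "i \<in> {1..n}" and i2: "Suc i \<in> {1..n}"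
        using i by auto
      \<comment> \<open>The second summand of the target \<open>B' (Suc i)\<close> is written
        \<open>cobj Y (Suc i - 1)\<close>; this is \<open>cobj Y i\<close>.\<close>
      have "diff X i \<in> Hom C' (cobj X i) (cobj X (Suc i))"
        "hzero C' (cobj Y (i - 1)) (cobj X (Suc i)) \<in> Hom C' (cobj Y (i - 1)) (cobj X (Suc i))"
        "f i \<in> Hom C' (cobj X i) (cobj Y (Suc i - 1))"
        "hneg C' (diff Y (i - 1)) \<in> Hom C' (cobj Y (i - 1)) (cobj Y (Suc i - 1))"
        using i by (cases i; simp add: in_Hom)+
      note mat = G.fmap_matrix[OF B'[OF i1] B'[OF i2] this]
      have [simp]: "cobj Y (i - Suc 0) \<in> Obj C'" "diff Y (i - Suc 0) \<in> Arr C'"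
        using i by (cases i; simp)+
      show "diff M' i = matrix C' (B' i) (B' (Suc i))
        (diff X i) (hzero C' (cobj Y (i - 1)) (cobj X (Suc i))) (f i) (hneg C' (diff Y (i - 1)))"
      proof (rule G.fmap_cancel)
        show "fmap G (diff M' i) = fmap G (matrix C' (B' i) (B' (Suc i))
          (diff X i) (hzero C' (cobj Y (i - 1)) (cobj X (Suc i))) (f i) (hneg C' (diff Y (i - 1))))"
          using d[of i] i f(2)[of i] Mi[OF i, symmetric] mat(1) p[of "Suc i"] q[of i]
          by (simp add: in_Hom)
      qed (use mat(2-4) i M'D B'M[OF i1] B'M[OF i2] in \<open>simp_all add: in_Hom\<close>)
    next
      have n: "n \<in> {1..n}"
        using n_pos by simp
      note row = G.fmap_row[OF B'[OF n], of "f n" "hneg C' (diff Y (n - 1))"]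
      show "diff M' n = row C' (B' n) (f n) (hneg C' (diff Y (n - 1)))"
      proof (rule G.fmap_cancel)
        show "fmap G (diff M' n) = fmap G (row C' (B' n) (f n) (hneg C' (diff Y (n - 1))))"
          using d[of n] f(2)[of n] Mn[symmetric] Jn MD(3) row(1) q[of n] n by (simp add: in_Hom)
      qed (use row(2-4) M'D Jn B'M[OF n] n in simp_all)
    qed
    moreover have "realised_by n C' s' (cobj Y n) A (pull C' E' A (diff Y n) \<delta>) M'"
      using r' J0 Jn S.emap_ident[OF _ _ qe] A by simp
    ultimately show ?thesis
      by blast
  qed (use A MD in auto)
  then show ?thesis
    using f(1) f0 fn by auto
qed

text \<open>For the composition axioms the composite is formed in \<open>C\<close>: the images of f
  and g are inflations there, so the image of their composite is the first differential of a
  conflation of \<open>C\<close>, and this conflation lifts with exactly that differential.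
  Deflations are treated alike in degree n.\<close>

lemma T_n_exangulated: "n_exangulated_category n C' E' s'"
proof (intro n_exangulated_category.intro T_exact_realisation n_exangulated_category_axioms.intro)
  fix f g
  assume f: "inflation n C' E' s' f" and g: "inflation n C' E' s' g" and fg: "Cod C' f = Dom C' g"
  obtain X where X: "conflation n C' E' s' X" "f = diff X 0"
    using f unfolding inflation_def by blast
  obtain Y where Y: "conflation n C' E' s' Y" "g = diff Y 0"
    using g unfolding inflation_def by blast
  have fgT: "f \<in> Arr C'" "g \<in> Arr C'"
    using X(2) Y(2) complexesD(2)[OF conflation_map(2)[OF X(1)], of 0]
      complexesD(2)[OF conflation_map(2)[OF Y(1)], of 0] by auto
  have "inflation n C E s (fmap G f)" "inflation n C E s (fmap G g)"
    unfolding inflation_def using X(2) Y(2) conflation_map(1)[OF X(1)] conflation_map(1)[OF Y(1)]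
    by (metis map_cpx_simps(2))+
  then have "inflation n C E s (fmap G g \<cdot>\<^bsub>C\<^esub> fmap G f)"
    using fg fgT by (intro S.EA1_inflation) auto
  then obtain W where "conflation n C E s W" "diff W 0 = fmap G (g \<cdot>\<^bsub>C'\<^esub> f)"
    unfolding inflation_def using fg fgT by auto
  then show "inflation n C' E' s' (g \<cdot>\<^bsub>C'\<^esub> f)"
    unfolding inflation_def using lift_conflation_diff[of W 0 "g \<cdot>\<^bsub>C'\<^esub> f"] fg fgT by auto
next
  fix f g
  assume f: "deflation n C' E' s' f" and g: "deflation n C' E' s' g" and fg: "Cod C' f = Dom C' g"
  obtain X where X: "conflation n C' E' s' X" "f = diff X n"
    using f unfolding deflation_def by blast
  obtain Y where Y: "conflation n C' E' s' Y" "g = diff Y n"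
    using g unfolding deflation_def by blast
  have fgT: "f \<in> Arr C'" "g \<in> Arr C'"
    using X(2) Y(2) complexesD(2)[OF conflation_map(2)[OF X(1)], of n]
      complexesD(2)[OF conflation_map(2)[OF Y(1)], of n] by auto
  have "deflation n C E s (fmap G f)" "deflation n C E s (fmap G g)"
    unfolding deflation_def using X(2) Y(2) conflation_map(1)[OF X(1)] conflation_map(1)[OF Y(1)]
    by (metis map_cpx_simps(2))+
  then have "deflation n C E s (fmap G g \<cdot>\<^bsub>C\<^esub> fmap G f)"
    using fg fgT by (intro S.EA1_deflation) auto
  then obtain W where "conflation n C E s W" "diff W n = fmap G (g \<cdot>\<^bsub>C'\<^esub> f)"
    unfolding deflation_def using fg fgT by auto
  then show "deflation n C' E' s' (g \<cdot>\<^bsub>C'\<^esub> f)"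
    unfolding deflation_def using lift_conflation_diff[of W n "g \<cdot>\<^bsub>C'\<^esub> f"] fg fgT by auto
next
  fix D A \<delta> c K X Y
  assume "D \<in> Obj C'" "A \<in> Obj C'" "\<delta> \<in> ext E' D A" "c \<in> Hom C' K D"
    "realised_by n C' s' K A (pull C' E' A c \<delta>) X" "realised_by n C' s' D A \<delta> Y"
  then show "\<exists>f M. chain_map n C' X Y f \<and> f 0 = Ident C' A \<and> f (n + 1) = c \<and>
    mapping_cone n C' X Y f M \<and> realised_by n C' s' D (cobj X 1) (push C' E' D (diff X 0) \<delta>) M"
    by (rule T_EA2)
next
  fix D A \<delta> a K X Y
  assume "D \<in> Obj C'" "A \<in> Obj C'" "\<delta> \<in> ext E' D A" "a \<in> Hom C' A K"
    "realised_by n C' s' D A \<delta> X" "realised_by n C' s' D K (push C' E' D a \<delta>) Y"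
  then show "\<exists>f M. chain_map n C' X Y f \<and> f 0 = a \<and> f (n + 1) = Ident C' D \<and>
    mapping_cocone n C' X Y f M \<and> realised_by n C' s' (cobj Y n) A (pull C' E' A (diff Y n) \<delta>) M"
    by (rule T_EA2_op)
qed

end

section \<open>Equivalences of categories\<close>

text \<open>One half of an equivalence: G F is isomorphic to the identity, with the inverse \<theta>
  as part of the data. An equivalence is used as two such halves with F and G exchanged, so that
  facts about a half serve both functors.\<close>

locale quasi_retraction = F: cfunctor C D F + G: cfunctor D C G
  for C :: "('o, 'm) cat" and D :: "('p, 'q) cat"
    and F :: "('o, 'm, 'p, 'q) func" and G :: "('p, 'q, 'o, 'm) func" +
  fixes \<eta> \<theta> :: "'o \<Rightarrow> 'm"
  assumes \<eta>: "A \<in> Obj C \<Longrightarrow> \<eta> A \<in> Hom C A (fobj G (fobj F A))"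
    and \<theta>: "A \<in> Obj C \<Longrightarrow> \<theta> A \<in> Hom C (fobj G (fobj F A)) A"
    and \<theta>\<eta>: "A \<in> Obj C \<Longrightarrow> \<theta> A \<cdot>\<^bsub>C\<^esub> \<eta> A = Ident C A"
    and \<eta>\<theta>: "A \<in> Obj C \<Longrightarrow> \<eta> A \<cdot>\<^bsub>C\<^esub> \<theta> A = Ident C (fobj G (fobj F A))"
    and natural: "f \<in> Hom C A B \<Longrightarrow> \<eta> B \<cdot>\<^bsub>C\<^esub> f = fmap G (fmap F f) \<cdot>\<^bsub>C\<^esub> \<eta> A"
begin

lemma unit_simps [simp]:
  assumes "A \<in> Obj C"
  shows "\<eta> A \<in> Arr C" "Dom C (\<eta> A) = A" "Cod C (\<eta> A) = fobj G (fobj F A)"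
    "\<theta> A \<in> Arr C" "Dom C (\<theta> A) = fobj G (fobj F A)" "Cod C (\<theta> A) = A"
  using \<eta>[OF assms] \<theta>[OF assms] by (auto simp: in_Hom)

lemma unit_cancel [simp]:
  "A \<in> Obj C \<Longrightarrow> u \<in> Arr C \<Longrightarrow> Cod C u = A \<Longrightarrow> \<theta> A \<cdot>\<^bsub>C\<^esub> (\<eta> A \<cdot>\<^bsub>C\<^esub> u) = u"
  using F.C.comp_assoc[of u "\<eta> A" "\<theta> A"] \<theta>\<eta>[of A] by simp

text \<open>The first formula recovers f from F f and gives faithfulness; the second expresses G F f
  through f and serves for fullness and additivity.\<close>

lemma conjugate:
  assumes "f \<in> Arr C" "Dom C f = A" "Cod C f = B"
  shows "f = \<theta> B \<cdot>\<^bsub>C\<^esub> (fmap G (fmap F f) \<cdot>\<^bsub>C\<^esub> \<eta> A)"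
    and "fmap G (fmap F f) = \<eta> B \<cdot>\<^bsub>C\<^esub> (f \<cdot>\<^bsub>C\<^esub> \<theta> A)"
proof -
  have O: "A \<in> Obj C" "B \<in> Obj C"
    using assms by auto
  have n: "\<eta> B \<cdot>\<^bsub>C\<^esub> f = fmap G (fmap F f) \<cdot>\<^bsub>C\<^esub> \<eta> A"
    using natural[of f A B] assms by (simp add: in_Hom)
  then show "f = \<theta> B \<cdot>\<^bsub>C\<^esub> (fmap G (fmap F f) \<cdot>\<^bsub>C\<^esub> \<eta> A)"
    using unit_cancel[OF O(2), of f] assms by simp
  have "\<eta> B \<cdot>\<^bsub>C\<^esub> (f \<cdot>\<^bsub>C\<^esub> \<theta> A) = (\<eta> B \<cdot>\<^bsub>C\<^esub> f) \<cdot>\<^bsub>C\<^esub> \<theta> A"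
    using assms O by simp
  also have "\<dots> = fmap G (fmap F f)"
    unfolding n using assms O \<eta>\<theta>[OF O(1)] by simp
  finally show "fmap G (fmap F f) = \<eta> B \<cdot>\<^bsub>C\<^esub> (f \<cdot>\<^bsub>C\<^esub> \<theta> A)" ..
qed

lemma faithful:
  assumes "fmap F f = fmap F g" "f \<in> Arr C" "g \<in> Arr C" "Dom C f = Dom C g" "Cod C f = Cod C g"
  shows "f = g"
  using conjugate(1)[OF assms(2) refl refl] conjugate(1)[OF assms(3) refl refl] assms(1,4,5) by simp

end

text \<open>The unit of an equivalence starts at the identity functor and the counit ends there;
  admitting both orientations yields both halves of the equivalence. In the second case naturality
  has to be transferred to the inverse of \<tau>.\<close>

lemma natural_isomorphism_unit:
  assumes F: "cfunctor C D F" and G: "cfunctor D C G"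
    and \<tau>: "natural_isomorphism C C id_func (comp_func G F) \<tau> \<or>
      natural_isomorphism C C (comp_func G F) id_func \<tau>"
  shows "\<exists>\<eta> \<theta>. quasi_retraction C D F G \<eta> \<theta>"
  using \<tau>
proof
  interpret F: cfunctor C D F by (rule F)
  interpret G: cfunctor D C G by (rule G)
  assume n: "natural_isomorphism C C id_func (comp_func G F) \<tau>"
  then have "\<forall>A \<in> Obj C. isomorphism C A (fobj G (fobj F A)) (\<tau> A)"
    by (simp add: natural_isomorphism_def id_func_def comp_func_def)
  then have "\<forall>A \<in> Obj C. \<exists>t. \<tau> A \<in> Hom C A (fobj G (fobj F A)) \<and> t \<in> Hom C (fobj G (fobj F A)) A \<and>
      t \<cdot>\<^bsub>C\<^esub> \<tau> A = Ident C A \<and> \<tau> A \<cdot>\<^bsub>C\<^esub> t = Ident C (fobj G (fobj F A))"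
    by (auto simp: isomorphism_def)
  then obtain \<theta> where \<theta>: "\<forall>A \<in> Obj C. \<tau> A \<in> Hom C A (fobj G (fobj F A)) \<and>
      \<theta> A \<in> Hom C (fobj G (fobj F A)) A \<and>
      \<theta> A \<cdot>\<^bsub>C\<^esub> \<tau> A = Ident C A \<and> \<tau> A \<cdot>\<^bsub>C\<^esub> \<theta> A = Ident C (fobj G (fobj F A))"
    by metis
  have "quasi_retraction C D F G \<tau> \<theta>"
  proof (unfold_locales)
    fix f A B assume f: "f \<in> Hom C A B"
    then show "\<tau> B \<cdot>\<^bsub>C\<^esub> f = fmap G (fmap F f) \<cdot>\<^bsub>C\<^esub> \<tau> A"
      using n by (auto simp: natural_isomorphism_def id_func_def comp_func_def in_Hom)
  qed (use \<theta> in auto)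
  then show ?thesis
    by blast
next
  interpret F: cfunctor C D F by (rule F)
  interpret G: cfunctor D C G by (rule G)
  assume n: "natural_isomorphism C C (comp_func G F) id_func \<tau>"
  then have "\<forall>A \<in> Obj C. isomorphism C (fobj G (fobj F A)) A (\<tau> A)"
    by (simp add: natural_isomorphism_def id_func_def comp_func_def)
  then have "\<forall>A \<in> Obj C. \<exists>t. \<tau> A \<in> Hom C (fobj G (fobj F A)) A \<and> t \<in> Hom C A (fobj G (fobj F A)) \<and>
      t \<cdot>\<^bsub>C\<^esub> \<tau> A = Ident C (fobj G (fobj F A)) \<and> \<tau> A \<cdot>\<^bsub>C\<^esub> t = Ident C A"
    by (auto simp: isomorphism_def)
  then obtain \<eta> where \<eta>: "\<forall>A \<in> Obj C. \<tau> A \<in> Hom C (fobj G (fobj F A)) A \<and>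
      \<eta> A \<in> Hom C A (fobj G (fobj F A)) \<and>
      \<eta> A \<cdot>\<^bsub>C\<^esub> \<tau> A = Ident C (fobj G (fobj F A)) \<and> \<tau> A \<cdot>\<^bsub>C\<^esub> \<eta> A = Ident C A"
    by metis
  have "quasi_retraction C D F G \<eta> \<tau>"
  proof (unfold_locales)
    fix f A B assume f: "f \<in> Hom C A B"
    then have O: "A \<in> Obj C" "B \<in> Obj C" and fT: "f \<in> Arr C" "Dom C f = A" "Cod C f = B"
      by (auto simp: in_Hom)
    have T: "\<tau> A \<in> Arr C" "Dom C (\<tau> A) = fobj G (fobj F A)" "Cod C (\<tau> A) = A"
      "\<tau> B \<in> Arr C" "Dom C (\<tau> B) = fobj G (fobj F B)" "Cod C (\<tau> B) = B"
      "\<eta> A \<in> Arr C" "Cod C (\<eta> A) = fobj G (fobj F A)" "Dom C (\<eta> A) = A"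
      "\<eta> B \<in> Arr C" "Cod C (\<eta> B) = fobj G (fobj F B)" "Dom C (\<eta> B) = B"
      using \<eta> O by (auto simp: in_Hom)
    have nat: "\<tau> B \<cdot>\<^bsub>C\<^esub> fmap G (fmap F f) = f \<cdot>\<^bsub>C\<^esub> \<tau> A"
      using n f O by (auto simp: natural_isomorphism_def id_func_def comp_func_def)
    \<comment> \<open>Insert the identity as \<open>\<tau> A\<close> after \<open>\<eta> A\<close>,
      move f across by naturality of \<tau>, and cancel \<open>\<eta> B\<close> against
      \<open>\<tau> B\<close>.\<close>
    have "\<eta> B \<cdot>\<^bsub>C\<^esub> f = \<eta> B \<cdot>\<^bsub>C\<^esub> ((f \<cdot>\<^bsub>C\<^esub> \<tau> A) \<cdot>\<^bsub>C\<^esub> \<eta> A)"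
      using \<eta> O fT T by simp
    also have "\<dots> = (\<eta> B \<cdot>\<^bsub>C\<^esub> \<tau> B) \<cdot>\<^bsub>C\<^esub> (fmap G (fmap F f) \<cdot>\<^bsub>C\<^esub> \<eta> A)"
      unfolding nat[symmetric] using fT T by simp
    also have "\<dots> = fmap G (fmap F f) \<cdot>\<^bsub>C\<^esub> \<eta> A"
      using \<eta> O fT T by simp
    finally show "\<eta> B \<cdot>\<^bsub>C\<^esub> f = fmap G (fmap F f) \<cdot>\<^bsub>C\<^esub> \<eta> A" .
  qed (use \<eta> in auto)
  then show ?thesis
    by blast
qed

text \<open>For u between images put f = \<theta> (G u) \<eta>. Then G F f = G u by conjugation, and
  F f = u since G is faithful, which is where the second half enters.\<close>

lemma quasi_inverse_fully_faithful:
  assumes "quasi_retraction C D F G \<eta> \<theta>" and "quasi_retraction D C G F \<eta>' \<theta>'"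
  shows "fully_faithful_functor C D F"
proof -
  interpret F: quasi_retraction C D F G \<eta> \<theta> by fact
  interpret G: quasi_retraction D C G F \<eta>' \<theta>' by fact
  show ?thesis
  proof unfold_locales
    fix A B assume O: "A \<in> Obj C" "B \<in> Obj C"
    show "bij_betw (fmap F) (Hom C A B) (Hom D (fobj F A) (fobj F B))"
      unfolding bij_betw_def
    proof (intro conjI equalityI subsetI)
      show "inj_on (fmap F) (Hom C A B)"
        by (rule inj_onI, rule F.faithful) (auto simp: in_Hom)
    next
      fix u assume "u \<in> fmap F ` Hom C A B"
      then show "u \<in> Hom D (fobj F A) (fobj F B)"
        using F.F.fmap by auto
    next
      fix u assume u: "u \<in> Hom D (fobj F A) (fobj F B)"
      define f where "f = \<theta> B \<cdot>\<^bsub>C\<^esub> (fmap G u \<cdot>\<^bsub>C\<^esub> \<eta> A)"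
      have uT: "u \<in> Arr D" "Dom D u = fobj F A" "Cod D u = fobj F B"
        using u by (auto simp: in_Hom)
      have fT: "f \<in> Arr C" "Dom C f = A" "Cod C f = B"
        using uT O by (auto simp: f_def)
      have "fmap G (fmap F f) = \<eta> B \<cdot>\<^bsub>C\<^esub> (f \<cdot>\<^bsub>C\<^esub> \<theta> A)"
        by (rule F.conjugate(2)[OF fT])
      also have "\<dots> = (\<eta> B \<cdot>\<^bsub>C\<^esub> \<theta> B) \<cdot>\<^bsub>C\<^esub> (fmap G u \<cdot>\<^bsub>C\<^esub> (\<eta> A \<cdot>\<^bsub>C\<^esub> \<theta> A))"
        unfolding f_def using uT O by simp
      also have "\<dots> = fmap G u"
        using uT O F.\<eta>\<theta> by simp
      finally have "fmap F f = u"
        by (rule G.faithful) (use fT uT in auto)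
      then show "u \<in> fmap F ` Hom C A B"
        using fT by (auto simp: in_Hom)
    qed
  qed
qed

text \<open>F G is conjugation by isomorphisms of D, hence additive; as F is additive and faithful,
  additivity of G can be checked after applying F.\<close>

lemma quasi_inverse_preadditive:
  assumes "preadditive_functor C D F" and "quasi_retraction C D F G \<eta> \<theta>"
    and "quasi_retraction D C G F \<eta>' \<theta>'"
  shows "preadditive_functor D C G"
proof -
  interpret F: quasi_retraction C D F G \<eta> \<theta> by fact
  interpret G: quasi_retraction D C G F \<eta>' \<theta>' by fact
  interpret F: preadditive_functor C D F by fact
  show ?thesis
  proof unfold_locales
    fix f g assume fg: "f \<in> Arr D" "g \<in> Arr D" "Dom D f = Dom D g" "Cod D f = Cod D g"
    have "fmap F (fmap G (hadd D f g)) = fmap F (hadd C (fmap G f) (fmap G g))"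
      using fg G.conjugate(2)[OF fg(1) refl refl] G.conjugate(2)[OF fg(2) refl refl]
        G.conjugate(2)[of "hadd D f g", OF _ refl refl] by simp
    then show "fmap G (hadd D f g) = hadd C (fmap G f) (fmap G g)"
      by (rule F.faithful) (use fg in auto)
  qed
qed

lemma (in preadditive_functor) additive_functor: "additive_functor C D F"
  unfolding additive_functor_def
proof (intro conjI ballI cfunctor_axioms)
  fix A B assume O: "A \<in> Obj C" "B \<in> Obj C"
  show "fmap F \<in> hom (hom_group C A B) (hom_group D (fobj F A) (fobj F B))"
  proof (rule homI)
    fix f g assume "f \<in> carrier (hom_group C A B)" "g \<in> carrier (hom_group C A B)"
    then show "fmap F (f \<otimes>\<^bsub>hom_group C A B\<^esub> g) =
        fmap F f \<otimes>\<^bsub>hom_group D (fobj F A) (fobj F B)\<^esub> fmap F g"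
      using O fmap_hadd[of f g] by (simp add: in_Hom hadd_def)
  qed (use O in \<open>auto simp: in_Hom\<close>)
qed

section \<open>The equivalence as an exangulated functor\<close>

text \<open>The components of \<eta> form an isomorphism of complexes from X to G F X, so G F X
  realises the conjugated extension in \<open>C\<close>, which is what it means for F X to realise
  it in \<open>C'\<close>.\<close>

lemma (in exangulated_transport) n_exangle_equivalence:
  assumes "quasi_retraction C C' F G \<eta> \<theta>" and "preadditive_functor C C' F"
    and "equivalence_of_categories C C' F"
  shows "n_exangle_equivalence n C E s C' E' s' F"
proof -
  interpret F: quasi_retraction C C' F G \<eta> \<theta> by fact
  interpret F: preadditive_functor C C' F by fact
  \<comment> \<open>The first argument is contravariant, so the inverse \<theta> stands there, while
    \<eta> acts covariantly.\<close>
  define \<Gamma> where "\<Gamma> D A = emap E (\<theta> D) (\<eta> A)" for D A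
  have \<Gamma>_ext: "\<Gamma> D A \<delta> \<in> ext E' (fobj F D) (fobj F A)"
    if "D \<in> Obj C" "A \<in> Obj C" "\<delta> \<in> ext E D A" for D A \<delta>
    using hom_in_carrier[OF S.emap[OF F.\<theta>[OF that(1)] F.\<eta>[OF that(2)]] that(3)] by (simp add: \<Gamma>_def)
  have "ext_transformation C E E' F \<Gamma>"
    unfolding ext_transformation_def
  proof (intro conjI ballI)
    fix D A assume "D \<in> Obj C" "A \<in> Obj C"
    then show "\<Gamma> D A \<in> hom (egrp E D A) (egrp E' (fobj F D) (fobj F A))"
      using S.emap[OF F.\<theta> F.\<eta>] by (simp add: \<Gamma>_def)
  next
    fix D A Z X z x \<delta>
    assume O: "D \<in> Obj C" "A \<in> Obj C" "Z \<in> Obj C" "X \<in> Obj C"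
      and z: "z \<in> Hom C Z D" and x: "x \<in> Hom C A X" and \<delta>: "\<delta> \<in> ext E D A"
    have zT: "z \<in> Arr C" "Dom C z = Z" "Cod C z = D" and xT: "x \<in> Arr C" "Dom C x = A" "Cod C x = X"
      using z x by (auto simp: in_Hom)
    \<comment> \<open>Naturality of the inverse \<theta>, read off from the conjugation
      formula.\<close>
    have n1: "z \<cdot>\<^bsub>C\<^esub> \<theta> Z = \<theta> D \<cdot>\<^bsub>C\<^esub> fmap G (fmap F z)"
      using F.conjugate(2)[OF zT] zT O by simp
    have n2: "\<eta> X \<cdot>\<^bsub>C\<^esub> x = fmap G (fmap F x) \<cdot>\<^bsub>C\<^esub> \<eta> A"
      by (rule F.natural[OF x])
    have GF: "fmap G (fmap F z) \<in> Hom C (fobj G (fobj F Z)) (fobj G (fobj F D))"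
      "fmap G (fmap F x) \<in> Hom C (fobj G (fobj F A)) (fobj G (fobj F X))"
      using zT xT by (auto simp: in_Hom)
    have "\<Gamma> Z X (emap E z x \<delta>) = emap E (z \<cdot>\<^bsub>C\<^esub> \<theta> Z) (\<eta> X \<cdot>\<^bsub>C\<^esub> x) \<delta>"
      unfolding \<Gamma>_def by (rule S.emap_comp[OF z F.\<theta>[OF O(3)] x F.\<eta>[OF O(4)] \<delta>, symmetric])
    also have "\<dots> = emap E' (fmap F z) (fmap F x) (\<Gamma> D A \<delta>)"
      unfolding n1 n2 \<Gamma>_def E'_simps
      by (rule S.emap_comp[OF F.\<theta>[OF O(1)] GF(1) F.\<eta>[OF O(2)] GF(2) \<delta>])
    finally show "\<Gamma> Z X (emap E z x \<delta>) = emap E' (fmap F z) (fmap F x) (\<Gamma> D A \<delta>)" .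
  qed
  moreover have "realised_by n C' s' (fobj F D) (fobj F A) (\<Gamma> D A \<delta>) (map_cpx F X)"
    if O: "D \<in> Obj C" "A \<in> Obj C" and \<delta>: "\<delta> \<in> ext E D A" and r: "realised_by n C s D A \<delta> X"
    for D A \<delta> X
  proof -
    note XD = realised_byD[OF r]
    note [simp] = complexesD(1-4)[OF XD(1)]
    let ?Y = "map_cpx G (map_cpx F X)"
    have FX: "map_cpx F X \<in> complexes n C'"
      by (rule F.map_complex[OF XD(1)])
    have \<eta>X: "chain_map n C X ?Y (\<lambda>i. \<eta> (cobj X i))"
      using F.natural[of "diff X _" "cobj X _" "cobj X (Suc _)"] by (auto simp: chain_map_def in_Hom)
    have \<theta>X: "chain_map n C ?Y X (\<lambda>i. \<theta> (cobj X i))"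
      using F.conjugate(2) by (auto simp: chain_map_def in_Hom)
    from S.realised_by_iso[OF r \<delta> G.map_complex[OF FX] \<eta>X \<theta>X]
    have "realised_by n C s (fobj G (fobj F D)) (fobj G (fobj F A)) (\<Gamma> D A \<delta>) ?Y"
      using XD(2,3) F.\<theta>\<eta> F.\<eta>\<theta> by (simp add: \<Gamma>_def)
    then show ?thesis
      using realised_by_map_iff[OF _ _ \<Gamma>_ext[OF O \<delta>]] O FX XD(2,3) by (simp add: complexes_betw_def)
  qed
  ultimately have "n_exangulated_functor n C E s C' E' s' F"
    by (intro n_exangulated_functor.intro n_exangulated_functor_axioms.intro
      S.n_exangulated_category_axioms T_n_exangulated F.additive_functor exI[of _ \<Gamma>]) auto
  then show ?thesis
    by (intro n_exangle_equivalence.intro n_exangle_equivalence_axioms.intro assms(3))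
qed

theorem theorem3p9:
  fixes n :: nat
    and C :: "('o, 'm) cat" and E :: "('o, 'm, 'e) bifunctor" and s :: "('o, 'm, 'e) realis"
    and C' :: "('p, 'q) cat" and F :: "('o, 'm, 'p, 'q) func"
  assumes "n \<ge> 1"
    and "n_exangulated_category n C E s"
    and "category C'"
    and "equivalence_of_categories C C' F"
  shows "\<exists>(E' :: ('p, 'q, 'e) bifunctor) (s' :: ('p, 'q, 'e) realis).
           biadditive_functor C' E' \<and>
           exact_realisation n C' E' s' \<and>
           n_exangulated_category n C' E' s' \<and>
           n_exangle_equivalence n C E s C' E' s' F"
proof -
  interpret S: n_exangulated_category n C E s
    by (rule assms(2))
  obtain G \<eta>' \<epsilon> where G: "cfunctor C C' F" "cfunctor C' C G"
    "natural_isomorphism C C id_func (comp_func G F) \<eta>'"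
    "natural_isomorphism C' C' (comp_func F G) id_func \<epsilon>"
    using assms(4) unfolding equivalence_of_categories_def by blast
  obtain \<eta> \<theta> where 1: "quasi_retraction C C' F G \<eta> \<theta>"
    using natural_isomorphism_unit[OF G(1,2)] G(3) by blast
  obtain \<zeta> \<xi> where 2: "quasi_retraction C' C G F \<zeta> \<xi>"
    using natural_isomorphism_unit[OF G(2,1)] G(4) by blast
  interpret F: quasi_retraction C C' F G \<eta> \<theta> by (rule 1)
  interpret G: fully_faithful_functor C' C G
    by (rule quasi_inverse_fully_faithful[OF 2 1])
  \<comment> \<open>Full faithfulness of G involves no addition, so it is available before
    \<open>C'\<close> has one.\<close>
  interpret T: preadditive_category C'
    by (rule G.preadditive_source) unfold_locales
  \<comment> \<open>Additivity of F precedes that of G, because uniqueness of the addition is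
    available in the additive category \<open>C\<close> and not yet in \<open>C'\<close>.\<close>
  have F: "preadditive_functor C C' F"
    using fully_faithful_functor.preadditive_functor_additive_source[OF
      quasi_inverse_fully_faithful[OF 1 2] S.additive_category_axioms T.preadditive_category_axioms] .
  interpret G: preadditive_functor C' C G
    by (rule quasi_inverse_preadditive[OF F 1 2])
  interpret X: exangulated_transport n C E s C' G
  proof unfold_locales
    show "1 \<le> n"
      by (rule assms(1))
    fix A assume A: "A \<in> Obj C"
    then have "isomorphism C A (fobj G (fobj F A)) (\<eta> A)"
      unfolding isomorphism_def using F.\<eta> F.\<theta> F.\<eta>\<theta> F.\<theta>\<eta> by blast
    then show "\<exists>P \<in> Obj C'. \<exists>p. isomorphism C A (fobj G P) p"
      using F.F.fobj[OF A] by blast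
  qed
  show ?thesis
    using X.T.biadditive_functor_axioms X.T_exact_realisation X.T_n_exangulated
      X.n_exangle_equivalence[OF 1 F assms(4)] by blast
qed

end
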